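(* Let $\mathcal T$ be a triangulated category, $\mathcal A$ a full subcategory of $\mathcal T$, $\mathcal X$ a covariantly finite subcategory of $\mathcal A$ and $\mathcal Y$ a contravariantly finite subcategory of $\mathcal A$. (1) If every $\mathcal X$-monomorphism of $\mathcal A$ has a cone in $\mathcal A$, then the subfactor category $\mathcal A/[\mathcal X]$ forms a right triangulated category (with the suspension functor $\Sigma$ and the class $\nabla$ of $\mathcal X$-distinguished right triangles described in the context). (2) If every $\mathcal Y$-epimorphism of $\mathcal A$ has a cocone in $\mathcal A$, then the subfactor category $\mathcal A/[\mathcal Y]$ forms a left triangulated category (with the loop functor $\Omega$ and the class $\triangle$ of $\mathcal Y$-distinguished left triangles described in the context).
   Context: Conventions. All categories are $k$-linear over a field $k$, Hom-finite, skeletally small and Krull-Schmidt. "Subcategory" means full subcategory closed under isomorphisms, (finite) direct sums and direct summands. The shift of $\mathcal T$ is $[1]$; "triangle" means distinguished triangle of $\mathcal T$. Approximations. For a subcategory $\mathcal X\subset\mathcal A$, a right $\mathcal X$-approximation of $B\in\mathcal A$ is a morphism $f:X_B\to B$ with $X_B\in\mathcal X$ such that $\mathcal A(X,X_B)\to\mathcal A(X,B)$ is surjective for all $X\in\mathcal X$; $\mathcal X$ is contravariantly finite in $\mathcal A$ if every object of $\mathcal A$ has a right $\mathcal X$-approximation. Left approximations and covariantly finite subcategories are defined dually. Monomorphisms and epimorphisms. A morphism $f:A\to B$ is $\mathcal X$-monic (an $\mathcal X$-monomorphism) if $\mathcal T(f,X):\mathcal T(B,X)\to\mathcal T(A,X)$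 is surjective for all $X\in\mathcal X$; dually, $f$ is $\mathcal Y$-epic (a $\mathcal Y$-epimorphism) if $\mathcal T(Y,f)$ is surjective for all $Y\in\mathcal Y$. "Every $\mathcal X$-monomorphism of $\mathcal A$ has a cone" means: for every $\mathcal X$-monic $f:A\to B$ with $A,B\in\mathcal A$, in the triangle $A\xrightarrow{f}B\to C\to A[1]$ one has $C\in\mathcal A$. "Every $\mathcal Y$-epimorphism of $\mathcal A$ has a cocone" means: for every $\mathcal Y$-epic $f:B\to C$ with $B,C\in\mathcal A$, in the triangle $K\to B\xrightarrow{f}C\to K[1]$ one has $K\in\mathcal A$. Subfactor category. $\mathcal A/[\mathcal X]$ has the objects of $\mathcal A$ (written $\bar A$) and morphisms $\mathcal A(A,B)/[\mathcal X](A,B)$, where $[\mathcal X](A,B)$ is the set of morphisms factoring through an object of $\mathcal X$; $\bar f$ is the class of $f$. Right triangulated category. Let $\mathcal C$ be an additive category with an additive endofunctor $\Sigma$. A sextuple is a diagram $A\xrightarrow{f}B\xrightarrow{g}C\xrightarrow{h}\Sigma A$; a morphism of sextuples is a triple $(\alpha,\beta,\gamma)$ with $\beta f=f'\alpha$, $\gamma g=g'\beta$, $(\Sigma\alpha)h=h'\gamma$; it is an isomorphism if $\alpha,\beta,\gamma$ are. $(\mathcal C,\Sigma,\nabla)$ is right triangulated if $\nabla$ is a class of sextuples ("right triangles") closed under isomorphism such that: [rTR0] $0\to A\xrightarrow{1}A\to 0$ is in $\nabla$ for every $A$. [rTR1] Every $f:A\to B$ embeds in a right triangle $A\xrightarrow{f}B\xrightarrow{g}C\xrightarrow{h}\Sigma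 A$. [rTR2] If $A\xrightarrow{f}B\xrightarrow{g}C\xrightarrow{h}\Sigma A$ is in $\nabla$, so is $B\xrightarrow{g}C\xrightarrow{h}\Sigma A\xrightarrow{-\Sigma f}\Sigma B$. [rTR3] Given right triangles $(A,B,C,f,g,h)$, $(A',B',C',f',g',h')$ and $\alpha:A\to A'$, $\beta:B\to B'$ with $\beta f=f'\alpha$, there is $\gamma$ such that $(\alpha,\beta,\gamma)$ is a morphism of sextuples. [rTR4] Given right triangles $A\xrightarrow{f}B\xrightarrow{g}C\xrightarrow{h}\Sigma A$, $B\xrightarrow{a}X\xrightarrow{b}Y\xrightarrow{c}\Sigma B$, $A\xrightarrow{af}X\xrightarrow{d}Z\xrightarrow{e}\Sigma A$, there are $s:C\to Z$, $t:Z\to Y$ with $sg=da$, $es=h$, $td=b$, $ct=(\Sigma f)e$, and $C\xrightarrow{s}Z\xrightarrow{t}Y\xrightarrow{(\Sigma g)c}\Sigma C$ is in $\nabla$. A left triangulated category $(\mathcal C,\Omega,\triangle)$, with left triangles $\Omega C\to A\to B\to C$, is defined dually, i.e. $(\mathcal C^{op},\Omega^{op},\triangle^{op})$ is right triangulated. Structure in (1). For each $A\in\mathcal A$ fix a triangle $A\xrightarrow{\alpha_A}X_A\xrightarrow{\beta_A}\Sigma A\xrightarrow{\gamma_A}A[1]$ with $\alpha_A$ a left $\mathcal X$-approximation (then $\Sigma A\in\mathcal A$). Put $\Sigma\bar A=\overline{\Sigma A}$; for $f:A\to A'$ choose a morphism of triangles $(f,g,h)$ between the fixed triangles and put $\Sigma\bar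 f=\bar h$ (well defined). For $f:A\to B$ in $\mathcal A$ take a triangle $B\xrightarrow{g}C_f\xrightarrow{h}\Sigma A\xrightarrow{f[1]\gamma_A}B[1]$ (then $C_f\in\mathcal A$). An $\mathcal X$-distinguished right triangle is a sextuple in $\mathcal A/[\mathcal X]$ isomorphic to some $\bar A\xrightarrow{\bar f}\bar B\xrightarrow{\bar g}\bar C_f\xrightarrow{\bar h}\Sigma\bar A$ obtained this way. Structure in (2), dually. For each $C\in\mathcal A$ fix a triangle $\Omega C\xrightarrow{a_C}Y_C\xrightarrow{b_C}C\xrightarrow{c_C}\Omega C[1]$ with $b_C$ a right $\mathcal Y$-approximation; $\Omega$ on morphisms is induced by morphisms of triangles. For $f:B\to C$ in $\mathcal A$ take a triangle $\Omega C\xrightarrow{h}K_f\xrightarrow{g}B\xrightarrow{c_Cf}\Omega C[1]$; a $\mathcal Y$-distinguished left triangle is one isomorphic to some $\Omega\bar C\xrightarrow{\bar h}\bar K_f\xrightarrow{\bar g}\bar B\xrightarrow{\bar f}\bar C$. *)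

theory Defs
  imports "HOL-Algebra.Module" "HOL-Algebra.AbelCoset"
begin

section \<open>Categories enriched in abelian groups\<close>

record ('o, 'm) cat =
  Obj :: "'o set"
  Hom :: "'o \<Rightarrow> 'o \<Rightarrow> 'm set"
  Id :: "'o \<Rightarrow> 'm"
  Comp :: "'m \<Rightarrow> 'm \<Rightarrow> 'm"  (infixl "\<cdot>\<index>" 70)
  Add :: "'m \<Rightarrow> 'm \<Rightarrow> 'm"
  Zero :: "'o \<Rightarrow> 'o \<Rightarrow> 'm"

text \<open>\<open>g \<cdot>\<^bsub>C\<^esub> f\<close> is "first \<open>f\<close>, then \<open>g\<close>". For \<open>A = B\<close> the following record is the
  endomorphism ring of \<open>A\<close>; for \<open>A \<noteq> B\<close> only its additive part is meaningful.\<close>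

definition hom_group :: "('o, 'm, 'z) cat_scheme \<Rightarrow> 'o \<Rightarrow> 'o \<Rightarrow> 'm ring" where
  "hom_group C A B =
     \<lparr>carrier = Hom C A B, mult = Comp C, one = Id C A, zero = Zero C A B, add = Add C\<rparr>"

locale category =
  fixes C :: "('o, 'm, 'z) cat_scheme" (structure)
  assumes Id_in: "A \<in> Obj C \<Longrightarrow> Id C A \<in> Hom C A A"
    and Comp_in: "\<lbrakk>A \<in> Obj C; B \<in> Obj C; D \<in> Obj C; f \<in> Hom C A B; g \<in> Hom C B D\<rbrakk>
      \<Longrightarrow> g \<cdot> f \<in> Hom C A D"
    and Comp_Id: "\<lbrakk>A \<in> Obj C; B \<in> Obj C; f \<in> Hom C A B\<rbrakk> \<Longrightarrow> f \<cdot> Id C A = f"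
    and Id_Comp: "\<lbrakk>A \<in> Obj C; B \<in> Obj C; f \<in> Hom C A B\<rbrakk> \<Longrightarrow> Id C B \<cdot> f = f"
    and Comp_assoc: "\<lbrakk>A \<in> Obj C; B \<in> Obj C; D \<in> Obj C; E \<in> Obj C;
        f \<in> Hom C A B; g \<in> Hom C B D; h \<in> Hom C D E\<rbrakk>
      \<Longrightarrow> (h \<cdot> g) \<cdot> f = h \<cdot> (g \<cdot> f)"
    and Hom_disjoint: "\<lbrakk>A \<in> Obj C; B \<in> Obj C; A' \<in> Obj C; B' \<in> Obj C;
        f \<in> Hom C A B; f \<in> Hom C A' B'\<rbrakk> \<Longrightarrow> A = A' \<and> B = B'"

locale preadditive_category = category +
  assumes Hom_abelian_group:
      "\<lbrakk>A \<in> Obj C; B \<in> Obj C\<rbrakk> \<Longrightarrow> abelian_group (hom_group C A B)"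
    and Comp_Add_right: "\<lbrakk>A \<in> Obj C; B \<in> Obj C; D \<in> Obj C;
        f \<in> Hom C A B; f' \<in> Hom C A B; g \<in> Hom C B D\<rbrakk>
      \<Longrightarrow> g \<cdot> Add C f f' = Add C (g \<cdot> f) (g \<cdot> f')"
    and Comp_Add_left: "\<lbrakk>A \<in> Obj C; B \<in> Obj C; D \<in> Obj C;
        f \<in> Hom C A B; g \<in> Hom C B D; g' \<in> Hom C B D\<rbrakk>
      \<Longrightarrow> Add C g g' \<cdot> f = Add C (g \<cdot> f) (g' \<cdot> f)"

definition isomorphism :: "('o, 'm, 'z) cat_scheme \<Rightarrow> 'o \<Rightarrow> 'o \<Rightarrow> 'm \<Rightarrow> bool" where
  "isomorphism C A B f \<longleftrightarrow> A \<in> Obj C \<and> B \<in> Obj C \<and> f \<in> Hom C A B \<and>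
     (\<exists>g \<in> Hom C B A. g \<cdot>\<^bsub>C\<^esub> f = Id C A \<and> f \<cdot>\<^bsub>C\<^esub> g = Id C B)"

definition isomorphic :: "('o, 'm, 'z) cat_scheme \<Rightarrow> 'o \<Rightarrow> 'o \<Rightarrow> bool" where
  "isomorphic C A B \<longleftrightarrow> (\<exists>f. isomorphism C A B f)"

definition zero_object :: "('o, 'm, 'z) cat_scheme \<Rightarrow> 'o \<Rightarrow> bool" where
  "zero_object C Z \<longleftrightarrow> Z \<in> Obj C \<and>
     (\<forall>A \<in> Obj C. (\<exists>!f. f \<in> Hom C Z A) \<and> (\<exists>!f. f \<in> Hom C A Z))"

definition direct_sum :: "('o, 'm, 'z) cat_scheme \<Rightarrow> 'o \<Rightarrow> 'o \<Rightarrow> 'o \<Rightarrow> bool" where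
  "direct_sum C A B D \<longleftrightarrow> A \<in> Obj C \<and> B \<in> Obj C \<and> D \<in> Obj C \<and>
     (\<exists>i \<in> Hom C A D. \<exists>j \<in> Hom C B D. \<exists>p \<in> Hom C D A. \<exists>q \<in> Hom C D B.
        p \<cdot>\<^bsub>C\<^esub> i = Id C A \<and> q \<cdot>\<^bsub>C\<^esub> j = Id C B \<and>
        q \<cdot>\<^bsub>C\<^esub> i = Zero C A B \<and> p \<cdot>\<^bsub>C\<^esub> j = Zero C B A \<and>
        Add C (i \<cdot>\<^bsub>C\<^esub> p) (j \<cdot>\<^bsub>C\<^esub> q) = Id C D)"

locale additive_category = preadditive_category +
  assumes ex_zero_object: "\<exists>Z. zero_object C Z"
    and ex_direct_sum: "\<lbrakk>A \<in> Obj C; B \<in> Obj C\<rbrakk> \<Longrightarrow> \<exists>D. direct_sum C A B D"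

definition op_cat :: "('o, 'm, 'z) cat_scheme \<Rightarrow> ('o, 'm) cat" where
  "op_cat C = \<lparr>Obj = Obj C, Hom = (\<lambda>A B. Hom C B A), Id = Id C,
     Comp = (\<lambda>g f. f \<cdot>\<^bsub>C\<^esub> g), Add = Add C, Zero = (\<lambda>A B. Zero C B A)\<rparr>"

definition full_subcat :: "('o, 'm, 'z) cat_scheme \<Rightarrow> 'o set \<Rightarrow> ('o, 'm, 'z) cat_scheme" where
  "full_subcat C S = C\<lparr>Obj := S\<rparr>"

text \<open>A subcategory is given by its set of objects; finite direct sums include the empty one.\<close>

definition subcategory :: "('o, 'm, 'z) cat_scheme \<Rightarrow> 'o set \<Rightarrow> bool" where
  "subcategory C S \<longleftrightarrow> S \<subseteq> Obj C \<and>
     (\<forall>A B. A \<in> S \<and> isomorphic C A B \<longrightarrow> B \<in> S) \<and>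
     (\<forall>Z. zero_object C Z \<longrightarrow> Z \<in> S) \<and>
     (\<forall>A B D. A \<in> S \<and> B \<in> S \<and> direct_sum C A B D \<longrightarrow> D \<in> S) \<and>
     (\<forall>A B D. D \<in> S \<and> direct_sum C A B D \<longrightarrow> A \<in> S \<and> B \<in> S)"


section \<open>Linear, Hom-finite and Krull--Schmidt categories\<close>

record ('k, 'o, 'm) lin_cat = "('o, 'm) cat" +
  Scale :: "'k \<Rightarrow> 'm \<Rightarrow> 'm"

definition hom_module :: "('k, 'o, 'm, 'z) lin_cat_scheme \<Rightarrow> 'o \<Rightarrow> 'o \<Rightarrow> ('k, 'm) module" where
  "hom_module C A B =
     \<lparr>carrier = Hom C A B, mult = Comp C, one = Id C A, zero = Zero C A B, add = Add C,
      smult = Scale C\<rparr>"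

locale linear_category = K: field K + preadditive_category C
  for K :: "('k, 'y) ring_scheme" and C :: "('k, 'o, 'm, 'z) lin_cat_scheme" (structure) +
  assumes Hom_module: "\<lbrakk>A \<in> Obj C; B \<in> Obj C\<rbrakk> \<Longrightarrow> module K (hom_module C A B)"
    and Comp_Scale_right: "\<lbrakk>A \<in> Obj C; B \<in> Obj C; D \<in> Obj C; k \<in> carrier K;
        f \<in> Hom C A B; g \<in> Hom C B D\<rbrakk> \<Longrightarrow> g \<cdot> Scale C k f = Scale C k (g \<cdot> f)"
    and Comp_Scale_left: "\<lbrakk>A \<in> Obj C; B \<in> Obj C; D \<in> Obj C; k \<in> carrier K;
        f \<in> Hom C A B; g \<in> Hom C B D\<rbrakk> \<Longrightarrow> Scale C k g \<cdot> f = Scale C k (g \<cdot> f)"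

definition Hom_finite ::
  "('k, 'y) ring_scheme \<Rightarrow> ('k, 'o, 'm, 'z) lin_cat_scheme \<Rightarrow> bool" where
  "Hom_finite K C \<longleftrightarrow> (\<forall>A \<in> Obj C. \<forall>B \<in> Obj C. \<exists>G. finite G \<and> G \<subseteq> Hom C A B \<and>
     (\<forall>f \<in> Hom C A B. \<exists>k \<in> G \<rightarrow> carrier K.
        f = finsum (hom_module C A B) (\<lambda>x. Scale C (k x) x) G))"

definition local_ring :: "('a, 'y) ring_scheme \<Rightarrow> bool" where
  "local_ring R \<longleftrightarrow> ring R \<and> \<one>\<^bsub>R\<^esub> \<noteq> \<zero>\<^bsub>R\<^esub> \<and>
     (\<forall>a \<in> carrier R - Units R. \<forall>b \<in> carrier R - Units R. a \<oplus>\<^bsub>R\<^esub> b \<notin> Units R)"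

primrec finite_direct_sum :: "('o, 'm, 'z) cat_scheme \<Rightarrow> 'o list \<Rightarrow> 'o \<Rightarrow> bool" where
  "finite_direct_sum C [] D \<longleftrightarrow> zero_object C D"
| "finite_direct_sum C (A # As) D \<longleftrightarrow>
     (\<exists>B. finite_direct_sum C As B \<and> direct_sum C A B D)"

definition Krull_Schmidt :: "('o, 'm, 'z) cat_scheme \<Rightarrow> bool" where
  "Krull_Schmidt C \<longleftrightarrow> (\<forall>D \<in> Obj C. \<exists>As. finite_direct_sum C As D \<and>
     (\<forall>A \<in> set As. local_ring (hom_group C A A)))"


section \<open>Endofunctors, sextuples, triangulated and one-sided triangulated categories\<close>

record ('o, 'm) endofunctor =
  ob :: "'o \<Rightarrow> 'o"
  mor :: "'m \<Rightarrow> 'm"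

locale additive_endofunctor = preadditive_category C
  for C :: "('o, 'm, 'z) cat_scheme" (structure) and F :: "('o, 'm) endofunctor" +
  assumes ob_in: "A \<in> Obj C \<Longrightarrow> ob F A \<in> Obj C"
    and mor_in: "\<lbrakk>A \<in> Obj C; B \<in> Obj C; f \<in> Hom C A B\<rbrakk>
      \<Longrightarrow> mor F f \<in> Hom C (ob F A) (ob F B)"
    and mor_Id: "A \<in> Obj C \<Longrightarrow> mor F (Id C A) = Id C (ob F A)"
    and mor_Comp: "\<lbrakk>A \<in> Obj C; B \<in> Obj C; D \<in> Obj C; f \<in> Hom C A B; g \<in> Hom C B D\<rbrakk>
      \<Longrightarrow> mor F (g \<cdot> f) = mor F g \<cdot> mor F f"
    and mor_Add: "\<lbrakk>A \<in> Obj C; B \<in> Obj C; f \<in> Hom C A B; f' \<in> Hom C A B\<rbrakk>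
      \<Longrightarrow> mor F (Add C f f') = Add C (mor F f) (mor F f')"

locale additive_autoequivalence = additive_endofunctor +
  assumes fully_faithful: "\<lbrakk>A \<in> Obj C; B \<in> Obj C\<rbrakk>
      \<Longrightarrow> bij_betw (mor F) (Hom C A B) (Hom C (ob F A) (ob F B))"
    and essentially_surjective: "B \<in> Obj C \<Longrightarrow> \<exists>A \<in> Obj C. isomorphic C (ob F A) B"

text \<open>\<open>(A, B, D, f, g, h)\<close> stands for \<open>A \<rightarrow> B \<rightarrow> D \<rightarrow> F A\<close> with maps \<open>f\<close>, \<open>g\<close>, \<open>h\<close>.\<close>

type_synonym ('o, 'm) sextuple = "'o \<times> 'o \<times> 'o \<times> 'm \<times> 'm \<times> 'm"

definition sextuples ::
  "('o, 'm, 'z) cat_scheme \<Rightarrow> ('o, 'm) endofunctor \<Rightarrow> ('o, 'm) sextuple set" where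
  "sextuples C F = {(A, B, D, f, g, h). A \<in> Obj C \<and> B \<in> Obj C \<and> D \<in> Obj C \<and>
     f \<in> Hom C A B \<and> g \<in> Hom C B D \<and> h \<in> Hom C D (ob F A)}"

definition sextuple_mor :: "('o, 'm, 'z) cat_scheme \<Rightarrow> ('o, 'm) endofunctor \<Rightarrow>
    ('o, 'm) sextuple \<Rightarrow> ('o, 'm) sextuple \<Rightarrow> 'm \<Rightarrow> 'm \<Rightarrow> 'm \<Rightarrow> bool" where
  "sextuple_mor C F s s' \<alpha> \<beta> \<gamma> \<longleftrightarrow> s \<in> sextuples C F \<and> s' \<in> sextuples C F \<and>
     (case (s, s') of ((A, B, D, f, g, h), (A', B', D', f', g', h')) \<Rightarrow>
        \<alpha> \<in> Hom C A A' \<and> \<beta> \<in> Hom C B B' \<and> \<gamma> \<in> Hom C D D' \<and>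
        \<beta> \<cdot>\<^bsub>C\<^esub> f = f' \<cdot>\<^bsub>C\<^esub> \<alpha> \<and> \<gamma> \<cdot>\<^bsub>C\<^esub> g = g' \<cdot>\<^bsub>C\<^esub> \<beta> \<and>
        mor F \<alpha> \<cdot>\<^bsub>C\<^esub> h = h' \<cdot>\<^bsub>C\<^esub> \<gamma>)"

definition sextuple_isomorphic :: "('o, 'm, 'z) cat_scheme \<Rightarrow> ('o, 'm) endofunctor \<Rightarrow>
    ('o, 'm) sextuple \<Rightarrow> ('o, 'm) sextuple \<Rightarrow> bool" where
  "sextuple_isomorphic C F s s' \<longleftrightarrow> (\<exists>\<alpha> \<beta> \<gamma>. sextuple_mor C F s s' \<alpha> \<beta> \<gamma> \<and>
     (case (s, s') of ((A, B, D, f, g, h), (A', B', D', f', g', h')) \<Rightarrow>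
        isomorphism C A A' \<alpha> \<and> isomorphism C B B' \<beta> \<and> isomorphism C D D' \<gamma>))"

text \<open>The axioms common to triangulated and right triangulated categories.\<close>

locale triangle_class = additive_category C + additive_endofunctor C F
  for C :: "('o, 'm, 'z) cat_scheme" (structure) and F :: "('o, 'm) endofunctor"
    and \<Delta> :: "('o, 'm) sextuple set" +
  assumes \<Delta>_sextuples: "\<Delta> \<subseteq> sextuples C F"
    and \<Delta>_iso_closed: "\<lbrakk>s \<in> \<Delta>; sextuple_isomorphic C F s s'\<rbrakk> \<Longrightarrow> s' \<in> \<Delta>"
    and embed: "\<lbrakk>A \<in> Obj C; B \<in> Obj C; f \<in> Hom C A B\<rbrakk>
      \<Longrightarrow> \<exists>D g h. (A, B, D, f, g, h) \<in> \<Delta>"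
    and rotate: "(A, B, D, f, g, h) \<in> \<Delta>
      \<Longrightarrow> (B, D, ob F A, g, h, \<ominus>\<^bsub>hom_group C (ob F A) (ob F B)\<^esub> mor F f) \<in> \<Delta>"
    and fill: "\<lbrakk>(A, B, D, f, g, h) \<in> \<Delta>; (A', B', D', f', g', h') \<in> \<Delta>;
        \<alpha> \<in> Hom C A A'; \<beta> \<in> Hom C B B'; \<beta> \<cdot> f = f' \<cdot> \<alpha>\<rbrakk>
      \<Longrightarrow> \<exists>\<gamma>. sextuple_mor C F (A, B, D, f, g, h) (A', B', D', f', g', h') \<alpha> \<beta> \<gamma>"
    and octahedron: "\<lbrakk>(A, B, D, f, g, h) \<in> \<Delta>; (B, X, Y, a, b, c) \<in> \<Delta>;
        (A, X, Z, a \<cdot> f, d, e) \<in> \<Delta>\<rbrakk>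
      \<Longrightarrow> \<exists>s \<in> Hom C D Z. \<exists>t \<in> Hom C Z Y.
            s \<cdot> g = d \<cdot> a \<and> e \<cdot> s = h \<and> t \<cdot> d = b \<and> c \<cdot> t = mor F f \<cdot> e \<and>
            (D, Z, Y, s, t, mor F g \<cdot> c) \<in> \<Delta>"

locale triangulated_category = triangle_class + additive_autoequivalence +
  assumes identity_triangle: "\<lbrakk>A \<in> Obj C; zero_object C Z\<rbrakk>
      \<Longrightarrow> (A, A, Z, Id C A, Zero C A Z, Zero C Z (ob F A)) \<in> \<Delta>"
    and rotate_back: "\<lbrakk>(A, B, D, f, g, h) \<in> sextuples C F;
        (B, D, ob F A, g, h, \<ominus>\<^bsub>hom_group C (ob F A) (ob F B)\<^esub> mor F f) \<in> \<Delta>\<rbrakk>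
      \<Longrightarrow> (A, B, D, f, g, h) \<in> \<Delta>"

text \<open>The last term of the right triangle \<open>0 \<rightarrow> A \<rightarrow> A \<rightarrow> 0\<close> is \<open>F Z\<close> for the zero object \<open>Z\<close>
  at its beginning; it is a zero object because \<open>F\<close> is additive.\<close>

locale right_triangulated_category = triangle_class +
  assumes zero_triangle: "\<lbrakk>A \<in> Obj C; zero_object C Z\<rbrakk>
      \<Longrightarrow> (Z, A, A, Zero C Z A, Id C A, Zero C A (ob F Z)) \<in> \<Delta>"

text \<open>For left triangulated categories, \<open>(A, B, D, h, g, f)\<close> stands for \<open>F D \<rightarrow> A \<rightarrow> B \<rightarrow> D\<close>
  with maps \<open>h\<close>, \<open>g\<close>, \<open>f\<close>. An endofunctor of \<open>C\<close> and its opposite have the same underlying data.\<close>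

definition left_sextuples ::
  "('o, 'm, 'z) cat_scheme \<Rightarrow> ('o, 'm) endofunctor \<Rightarrow> ('o, 'm) sextuple set" where
  "left_sextuples C F = {(A, B, D, h, g, f). A \<in> Obj C \<and> B \<in> Obj C \<and> D \<in> Obj C \<and>
     h \<in> Hom C (ob F D) A \<and> g \<in> Hom C A B \<and> f \<in> Hom C B D}"

definition left_sextuple_mor :: "('o, 'm, 'z) cat_scheme \<Rightarrow> ('o, 'm) endofunctor \<Rightarrow>
    ('o, 'm) sextuple \<Rightarrow> ('o, 'm) sextuple \<Rightarrow> 'm \<Rightarrow> 'm \<Rightarrow> 'm \<Rightarrow> bool" where
  "left_sextuple_mor C F s s' \<alpha> \<beta> \<gamma> \<longleftrightarrow> s \<in> left_sextuples C F \<and> s' \<in> left_sextuples C F \<and>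
     (case (s, s') of ((A, B, D, h, g, f), (A', B', D', h', g', f')) \<Rightarrow>
        \<alpha> \<in> Hom C A A' \<and> \<beta> \<in> Hom C B B' \<and> \<gamma> \<in> Hom C D D' \<and>
        \<alpha> \<cdot>\<^bsub>C\<^esub> h = h' \<cdot>\<^bsub>C\<^esub> mor F \<gamma> \<and> \<beta> \<cdot>\<^bsub>C\<^esub> g = g' \<cdot>\<^bsub>C\<^esub> \<alpha> \<and>
        \<gamma> \<cdot>\<^bsub>C\<^esub> f = f' \<cdot>\<^bsub>C\<^esub> \<beta>)"

definition left_sextuple_isomorphic :: "('o, 'm, 'z) cat_scheme \<Rightarrow> ('o, 'm) endofunctor \<Rightarrow>
    ('o, 'm) sextuple \<Rightarrow> ('o, 'm) sextuple \<Rightarrow> bool" where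
  "left_sextuple_isomorphic C F s s' \<longleftrightarrow> (\<exists>\<alpha> \<beta> \<gamma>. left_sextuple_mor C F s s' \<alpha> \<beta> \<gamma> \<and>
     (case (s, s') of ((A, B, D, h, g, f), (A', B', D', h', g', f')) \<Rightarrow>
        isomorphism C A A' \<alpha> \<and> isomorphism C B B' \<beta> \<and> isomorphism C D D' \<gamma>))"

definition op_sextuples :: "('o, 'm) sextuple set \<Rightarrow> ('o, 'm) sextuple set" where
  "op_sextuples \<Delta> = {(D, B, A, f, g, h) | A B D f g h. (A, B, D, h, g, f) \<in> \<Delta>}"

definition left_triangulated_category ::
  "('o, 'm, 'z) cat_scheme \<Rightarrow> ('o, 'm) endofunctor \<Rightarrow> ('o, 'm) sextuple set \<Rightarrow> bool" where
  "left_triangulated_category C F \<Delta> \<longleftrightarrow>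
     right_triangulated_category (op_cat C) F (op_sextuples \<Delta>)"


section \<open>Approximations, relative monomorphisms and epimorphisms\<close>

definition monic_wrt :: "('o, 'm, 'z) cat_scheme \<Rightarrow> 'o set \<Rightarrow> 'o \<Rightarrow> 'o \<Rightarrow> 'm \<Rightarrow> bool" where
  "monic_wrt C \<X> A B f \<longleftrightarrow> f \<in> Hom C A B \<and>
     (\<forall>X \<in> \<X>. (\<lambda>u. u \<cdot>\<^bsub>C\<^esub> f) ` Hom C B X = Hom C A X)"

definition epic_wrt :: "('o, 'm, 'z) cat_scheme \<Rightarrow> 'o set \<Rightarrow> 'o \<Rightarrow> 'o \<Rightarrow> 'm \<Rightarrow> bool" where
  "epic_wrt C \<Y> B D f \<longleftrightarrow> f \<in> Hom C B D \<and>
     (\<forall>Y \<in> \<Y>. (\<lambda>u. f \<cdot>\<^bsub>C\<^esub> u) ` Hom C Y B = Hom C Y D)"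

definition left_approximation ::
  "('o, 'm, 'z) cat_scheme \<Rightarrow> 'o set \<Rightarrow> 'o \<Rightarrow> 'o \<Rightarrow> 'm \<Rightarrow> bool" where
  "left_approximation C \<X> A X\<^sub>A f \<longleftrightarrow> X\<^sub>A \<in> \<X> \<and> f \<in> Hom C A X\<^sub>A \<and>
     (\<forall>X \<in> \<X>. (\<lambda>u. u \<cdot>\<^bsub>C\<^esub> f) ` Hom C X\<^sub>A X = Hom C A X)"

definition right_approximation ::
  "('o, 'm, 'z) cat_scheme \<Rightarrow> 'o set \<Rightarrow> 'o \<Rightarrow> 'o \<Rightarrow> 'm \<Rightarrow> bool" where
  "right_approximation C \<Y> B Y\<^sub>B f \<longleftrightarrow> Y\<^sub>B \<in> \<Y> \<and> f \<in> Hom C Y\<^sub>B B \<and>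
     (\<forall>Y \<in> \<Y>. (\<lambda>u. f \<cdot>\<^bsub>C\<^esub> u) ` Hom C Y Y\<^sub>B = Hom C Y B)"

definition covariantly_finite :: "('o, 'm, 'z) cat_scheme \<Rightarrow> 'o set \<Rightarrow> bool" where
  "covariantly_finite C \<X> \<longleftrightarrow> (\<forall>A \<in> Obj C. \<exists>X f. left_approximation C \<X> A X f)"

definition contravariantly_finite :: "('o, 'm, 'z) cat_scheme \<Rightarrow> 'o set \<Rightarrow> bool" where
  "contravariantly_finite C \<Y> \<longleftrightarrow> (\<forall>B \<in> Obj C. \<exists>Y f. right_approximation C \<Y> B Y f)"

definition monics_have_cones :: "('o, 'm, 'z) cat_scheme \<Rightarrow> ('o, 'm) sextuple set \<Rightarrow>
    'o set \<Rightarrow> 'o set \<Rightarrow> bool" where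
  "monics_have_cones T \<Delta> \<A> \<X> \<longleftrightarrow>
     (\<forall>A \<in> \<A>. \<forall>B \<in> \<A>. \<forall>f. monic_wrt T \<X> A B f \<longrightarrow>
        (\<forall>D g h. (A, B, D, f, g, h) \<in> \<Delta> \<longrightarrow> D \<in> \<A>))"

definition epics_have_cocones :: "('o, 'm, 'z) cat_scheme \<Rightarrow> ('o, 'm) sextuple set \<Rightarrow>
    'o set \<Rightarrow> 'o set \<Rightarrow> bool" where
  "epics_have_cocones T \<Delta> \<A> \<Y> \<longleftrightarrow>
     (\<forall>B \<in> \<A>. \<forall>D \<in> \<A>. \<forall>f. epic_wrt T \<Y> B D f \<longrightarrow>
        (\<forall>K g h. (K, B, D, g, f, h) \<in> \<Delta> \<longrightarrow> K \<in> \<A>))"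


section \<open>The subfactor category\<close>

definition factor_hom :: "('o, 'm, 'z) cat_scheme \<Rightarrow> 'o set \<Rightarrow> 'o \<Rightarrow> 'o \<Rightarrow> 'm set" where
  "factor_hom C \<X> A B = {v \<cdot>\<^bsub>C\<^esub> u | u v X. X \<in> \<X> \<and> u \<in> Hom C A X \<and> v \<in> Hom C X B}"

definition mor_class :: "('o, 'm, 'z) cat_scheme \<Rightarrow> 'o set \<Rightarrow> 'o \<Rightarrow> 'o \<Rightarrow> 'm \<Rightarrow> 'm set" where
  "mor_class C \<X> A B f = factor_hom C \<X> A B +>\<^bsub>hom_group C A B\<^esub> f"

text \<open>The composite of two cosets is written as the union of the classes of the composites of all
  representatives; all these classes coincide.\<close>

definition quotient_cat :: "('o, 'm, 'z) cat_scheme \<Rightarrow> 'o set \<Rightarrow> ('o, 'm set) cat" where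
  "quotient_cat C \<X> =
     \<lparr>Obj = Obj C,
      Hom = (\<lambda>A B. a_rcosets\<^bsub>hom_group C A B\<^esub> (factor_hom C \<X> A B)),
      Id = (\<lambda>A. mor_class C \<X> A A (Id C A)),
      Comp = (\<lambda>\<psi> \<phi>. \<Union>{mor_class C \<X> A D (g \<cdot>\<^bsub>C\<^esub> f) | A B D f g.
         A \<in> Obj C \<and> B \<in> Obj C \<and> D \<in> Obj C \<and>
         f \<in> \<phi> \<inter> Hom C A B \<and> g \<in> \<psi> \<inter> Hom C B D}),
      Add = (\<lambda>\<phi> \<psi>. {Add C f g | f g. f \<in> \<phi> \<and> g \<in> \<psi>}),
      Zero = factor_hom C \<X>\<rparr>"


section \<open>The suspension and loop structures\<close>

text \<open>A choice, for every object \<open>A\<close>, of a triangle. In the right-handed case it is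
  \<open>A \<rightarrow> mid A \<rightarrow> outer A \<rightarrow> A[1]\<close>, with \<open>outer A = \<Sigma> A\<close>; in the left-handed case it is
  \<open>outer A \<rightarrow> mid A \<rightarrow> A \<rightarrow> (outer A)[1]\<close>, with \<open>outer A = \<Omega> A\<close>. The maps are
  \<open>map1 A\<close>, \<open>map2 A\<close>, \<open>map3 A\<close>, in this order.\<close>

record ('o, 'm) triangle_choice =
  mid :: "'o \<Rightarrow> 'o"
  outer :: "'o \<Rightarrow> 'o"
  map1 :: "'o \<Rightarrow> 'm"
  map2 :: "'o \<Rightarrow> 'm"
  map3 :: "'o \<Rightarrow> 'm"

definition right_tri :: "('o, 'm) triangle_choice \<Rightarrow> 'o \<Rightarrow> ('o, 'm) sextuple" where
  "right_tri \<tau> A = (A, mid \<tau> A, outer \<tau> A, map1 \<tau> A, map2 \<tau> A, map3 \<tau> A)"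

definition left_tri :: "('o, 'm) triangle_choice \<Rightarrow> 'o \<Rightarrow> ('o, 'm) sextuple" where
  "left_tri \<tau> A = (outer \<tau> A, mid \<tau> A, A, map1 \<tau> A, map2 \<tau> A, map3 \<tau> A)"

definition right_choice :: "('o, 'm, 'z) cat_scheme \<Rightarrow> ('o, 'm) sextuple set \<Rightarrow>
    'o set \<Rightarrow> 'o set \<Rightarrow> ('o, 'm) triangle_choice \<Rightarrow> bool" where
  "right_choice T \<Delta> \<A> \<X> \<tau> \<longleftrightarrow> (\<forall>A \<in> \<A>. right_tri \<tau> A \<in> \<Delta> \<and>
     left_approximation (full_subcat T \<A>) \<X> A (mid \<tau> A) (map1 \<tau> A))"

definition left_choice :: "('o, 'm, 'z) cat_scheme \<Rightarrow> ('o, 'm) sextuple set \<Rightarrow>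
    'o set \<Rightarrow> 'o set \<Rightarrow> ('o, 'm) triangle_choice \<Rightarrow> bool" where
  "left_choice T \<Delta> \<A> \<Y> \<tau> \<longleftrightarrow> (\<forall>A \<in> \<A>. left_tri \<tau> A \<in> \<Delta> \<and>
     right_approximation (full_subcat T \<A>) \<Y> A (mid \<tau> A) (map2 \<tau> A))"

abbreviation subfactor :: "('o, 'm, 'z) cat_scheme \<Rightarrow> 'o set \<Rightarrow> 'o set \<Rightarrow> ('o, 'm set) cat" where
  "subfactor T \<A> \<X> \<equiv> quotient_cat (full_subcat T \<A>) \<X>"

abbreviation sub_class ::
  "('o, 'm, 'z) cat_scheme \<Rightarrow> 'o set \<Rightarrow> 'o set \<Rightarrow> 'o \<Rightarrow> 'o \<Rightarrow> 'm \<Rightarrow> 'm set" where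
  "sub_class T \<A> \<X> \<equiv> mor_class (full_subcat T \<A>) \<X>"

text \<open>On morphisms, the value is the union of the classes of \<open>h\<close> over all representatives \<open>f\<close> and
  all morphisms of triangles extending \<open>f\<close>. This union is a coset, as required of a functor on the
  subfactor category, only if all these classes coincide, i.e. if the construction does not depend
  on choices.\<close>

definition suspension :: "('o, 'm, 'z) cat_scheme \<Rightarrow> ('o, 'm) endofunctor \<Rightarrow>
    'o set \<Rightarrow> 'o set \<Rightarrow> ('o, 'm) triangle_choice \<Rightarrow> ('o, 'm set) endofunctor" where
  "suspension T S \<A> \<X> \<tau> =
     \<lparr>ob = outer \<tau>,
      mor = (\<lambda>\<phi>. \<Union>{sub_class T \<A> \<X> (outer \<tau> A) (outer \<tau> A') h | A A' f g h.
         A \<in> \<A> \<and> A' \<in> \<A> \<and> f \<in> \<phi> \<and>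
         sextuple_mor T S (right_tri \<tau> A) (right_tri \<tau> A') f g h})\<rparr>"

definition loop :: "('o, 'm, 'z) cat_scheme \<Rightarrow> ('o, 'm) endofunctor \<Rightarrow>
    'o set \<Rightarrow> 'o set \<Rightarrow> ('o, 'm) triangle_choice \<Rightarrow> ('o, 'm set) endofunctor" where
  "loop T S \<A> \<Y> \<tau> =
     \<lparr>ob = outer \<tau>,
      mor = (\<lambda>\<phi>. \<Union>{sub_class T \<A> \<Y> (outer \<tau> A) (outer \<tau> A') h | A A' f g h.
         A \<in> \<A> \<and> A' \<in> \<A> \<and> f \<in> \<phi> \<and>
         sextuple_mor T S (left_tri \<tau> A) (left_tri \<tau> A') h g f})\<rparr>"

definition distinguished_right_triangles :: "('o, 'm, 'z) cat_scheme \<Rightarrow>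
    ('o, 'm) endofunctor \<Rightarrow> ('o, 'm) sextuple set \<Rightarrow> 'o set \<Rightarrow> 'o set \<Rightarrow>
    ('o, 'm) triangle_choice \<Rightarrow> ('o, 'm set) sextuple set" where
  "distinguished_right_triangles T S \<Delta> \<A> \<X> \<tau> =
     {s. \<exists>A \<in> \<A>. \<exists>B \<in> \<A>. \<exists>f \<in> Hom T A B. \<exists>D g h.
        (B, D, outer \<tau> A, g, h, mor S f \<cdot>\<^bsub>T\<^esub> map3 \<tau> A) \<in> \<Delta> \<and>
        sextuple_isomorphic (subfactor T \<A> \<X>) (suspension T S \<A> \<X> \<tau>) s
          (A, B, D, sub_class T \<A> \<X> A B f, sub_class T \<A> \<X> B D g,
           sub_class T \<A> \<X> D (outer \<tau> A) h)}"

definition distinguished_left_triangles :: "('o, 'm, 'z) cat_scheme \<Rightarrow>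
    ('o, 'm) endofunctor \<Rightarrow> ('o, 'm) sextuple set \<Rightarrow> 'o set \<Rightarrow> 'o set \<Rightarrow>
    ('o, 'm) triangle_choice \<Rightarrow> ('o, 'm set) sextuple set" where
  "distinguished_left_triangles T S \<Delta> \<A> \<Y> \<tau> =
     {s. \<exists>B \<in> \<A>. \<exists>D \<in> \<A>. \<exists>f \<in> Hom T B D. \<exists>K h g.
        (outer \<tau> D, K, B, h, g, map3 \<tau> D \<cdot>\<^bsub>T\<^esub> f) \<in> \<Delta> \<and>
        left_sextuple_isomorphic (subfactor T \<A> \<Y>) (loop T S \<A> \<Y> \<tau>) s
          (K, B, D, sub_class T \<A> \<Y> (outer \<tau> D) K h, sub_class T \<A> \<Y> K B g,
           sub_class T \<A> \<Y> B D f)}"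

end

(* Write a triangle A -> B -> D -> A[1] as a pair of maps together with an element e of E(D, A) = Hom(D, A[1]).
   Up to isomorphism in the subfactor category, the distinguished right triangles are exactly the sequences
   A -> B -> D -> Sigma A induced by triangles of T whose first map f is X-monic, with connecting map -k, where
   e = gamma_A k. Every f : A -> B becomes X-monic after replacing B by B + X_A, which is isomorphic to B in the
   subfactor category. On X-monic representatives a square commuting modulo X can be corrected to a
   commuting one, and the octahedron of T can be used directly; lifts of E-elements along gamma_A are unique
   modulo X, which yields all required commutativities. The argument uses only properties of (E, triangles),
   and the opposite category has these properties too, so part (2) is part (1) for the opposite category. *)

theory Submission
  imports Defs
begin

section \<open>Calculus in preadditive categories\<close>

text \<open>Two obstacles shape the development. The shift is only an autoequivalence, so the
  opposite category comes with no shift functor. Connecting maps are therefore treated as elements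
  of E, and E itself carries no addition: its additive content is a zero \<open>N\<close> and the
  rule \<open>L_R_add\<close>, which compares the two actions on sums. Secondly, cones are not
  functorial: fill-ins are not unique, and composites of fill-ins need not be identities. That cones
  are isomorphic is deduced instead from one algebraic fact, the invertibility of 1 + n for n n = 0.
  In the subfactor category this requires that h is a weak cokernel of g, which is therefore proved
  for distinguished triangles before rotation and octahedron. The sign in -k originates in an
  octahedron containing the rotated split triangle on B + X_A; it is the same sign that rotation
  puts on the suspension of f.\<close>

context category
begin

text \<open>Hom sets of different pairs of objects are disjoint, so a morphism knows its ends.
  Typing by \<open>src\<close> and \<open>tgt\<close> turns membership conditions into equations
  that the simplifier decides; outside \<open>arr\<close> both functions are unspecified.\<close>

definition arr :: "'m \<Rightarrow> bool" where
  "arr f \<longleftrightarrow> (\<exists>A \<in> Obj C. \<exists>B \<in> Obj C. f \<in> Hom C A B)"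

definition src :: "'m \<Rightarrow> 'o" where
  "src f = (THE A. A \<in> Obj C \<and> (\<exists>B \<in> Obj C. f \<in> Hom C A B))"

definition tgt :: "'m \<Rightarrow> 'o" where
  "tgt f = (THE B. B \<in> Obj C \<and> (\<exists>A \<in> Obj C. f \<in> Hom C A B))"

lemma in_Hom_iff:
  assumes "A \<in> Obj C" "B \<in> Obj C"
  shows "f \<in> Hom C A B \<longleftrightarrow> arr f \<and> src f = A \<and> tgt f = B"
proof -
  have *: "arr f \<and> src f = A' \<and> tgt f = B'" if "A' \<in> Obj C" "B' \<in> Obj C" "f \<in> Hom C A' B'" for A' B'
    using that Hom_disjoint unfolding arr_def src_def tgt_def by (blast intro!: the_equality)
  then show ?thesis using assms arr_def by metis
qed

lemma arr_ends [simp]: "arr f \<Longrightarrow> src f \<in> Obj C" "arr f \<Longrightarrow> tgt f \<in> Obj C"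
  using in_Hom_iff arr_def by metis+

lemma arr_in_Hom: "arr f \<Longrightarrow> f \<in> Hom C (src f) (tgt f)"
  by (simp add: in_Hom_iff)

lemma arr_Id [simp]:
  assumes "A \<in> Obj C" shows "arr (Id C A)" "src (Id C A) = A" "tgt (Id C A) = A"
  using Id_in[OF assms] assms by (auto simp: in_Hom_iff)

lemma arr_Comp [simp]:
  assumes "arr f" "arr g" "src g = tgt f"
  shows "arr (g \<cdot> f)" "src (g \<cdot> f) = src f" "tgt (g \<cdot> f) = tgt g"
  using Comp_in[of "src f" "tgt f" "tgt g" f g] assms by (auto simp: in_Hom_iff)

lemma comp_Id [simp]: "arr f \<Longrightarrow> src f = A \<Longrightarrow> f \<cdot> Id C A = f"
  using Comp_Id[of "src f" "tgt f" f] by (auto simp: in_Hom_iff)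

lemma Id_comp [simp]: "arr f \<Longrightarrow> tgt f = B \<Longrightarrow> Id C B \<cdot> f = f"
  using Id_Comp[of "src f" "tgt f" f] by (auto simp: in_Hom_iff)

lemma comp_assoc:
  "\<lbrakk>arr f; arr g; arr h; src g = tgt f; src h = tgt g\<rbrakk> \<Longrightarrow> (h \<cdot> g) \<cdot> f = h \<cdot> (g \<cdot> f)"
  using Comp_assoc[of "src f" "tgt f" "tgt g" "tgt h" f g h] by (auto simp: in_Hom_iff)

text \<open>\<open>comp_assoc\<close> nests composites to the right and thereby hides a known
  composite \<open>g \<cdot> f\<close> when another map \<open>x\<close> comes before it; instances
  of this rule recover it during simplification.\<close>

lemma comp_reassoc:
  assumes "g \<cdot> f = k" "arr f" "arr g" "arr x" "src g = tgt f" "src f = tgt x"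
  shows "g \<cdot> (f \<cdot> x) = k \<cdot> x"
  using assms comp_assoc by metis

lemma isomorphismI:
  assumes "arr f" "arr g" "src g = tgt f" "tgt g = src f"
    and "g \<cdot> f = Id C (src f)" "f \<cdot> g = Id C (tgt f)"
  shows "isomorphism C (src f) (tgt f) f"
  unfolding isomorphism_def using assms by (auto simp: in_Hom_iff intro!: bexI[of _ g])

lemma isomorphismE:
  assumes "isomorphism C A B f"
  obtains g where "A \<in> Obj C" "B \<in> Obj C" "arr f" "src f = A" "tgt f = B"
    "arr g" "src g = B" "tgt g = A" "g \<cdot> f = Id C A" "f \<cdot> g = Id C B"
proof -
  obtain g where *: "A \<in> Obj C" "B \<in> Obj C" "f \<in> Hom C A B" "g \<in> Hom C B A"
    "g \<cdot> f = Id C A" "f \<cdot> g = Id C B"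
    using assms unfolding isomorphism_def by blast
  then show thesis by (intro that[of g]) (simp_all add: in_Hom_iff)
qed

lemma isomorphism_Id: "A \<in> Obj C \<Longrightarrow> isomorphism C A A (Id C A)"
  using isomorphismI[of "Id C A" "Id C A"] by simp

lemma isomorphism_Comp:
  assumes "isomorphism C A B f" "isomorphism C B D g"
  shows "isomorphism C A D (g \<cdot> f)"
proof -
  from assms(1) obtain f' where f: "A \<in> Obj C" "B \<in> Obj C" "arr f" "src f = A" "tgt f = B"
    "arr f'" "src f' = B" "tgt f' = A" "f' \<cdot> f = Id C A" "f \<cdot> f' = Id C B"
    by (elim isomorphismE)
  from assms(2) obtain g' where g: "D \<in> Obj C" "arr g" "src g = B" "tgt g = D"
    "arr g'" "src g' = D" "tgt g' = B" "g' \<cdot> g = Id C B" "g \<cdot> g' = Id C D"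
    by (elim isomorphismE)
  have "(f' \<cdot> g') \<cdot> (g \<cdot> f) = Id C A" "(g \<cdot> f) \<cdot> (f' \<cdot> g') = Id C D"
    using f g by (simp_all add: comp_assoc comp_reassoc[of g' g] comp_reassoc[of f f'])
  then show ?thesis using isomorphismI[of "g \<cdot> f" "f' \<cdot> g'"] f g by simp
qed

text \<open>\<open>x \<cdot> g\<close> is a left inverse and \<open>h \<cdot> y\<close> a right
  inverse of \<open>f\<close>, and such inverses coincide. This serves pairs of fill-ins whose
  composites are invertible without being identities.\<close>

lemma isomorphism_if_one_sided:
  assumes "arr f" "src f = A" "tgt f = B"
    and "arr g" "src g = B" "tgt g = A" "isomorphism C A A (g \<cdot> f)"
    and "arr h" "src h = B" "tgt h = A" "isomorphism C B B (f \<cdot> h)"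
  shows "isomorphism C A B f"
proof -
  from assms(7) obtain x where x: "A \<in> Obj C" "arr x" "src x = A" "tgt x = A" "x \<cdot> (g \<cdot> f) = Id C A"
    by (elim isomorphismE)
  from assms(11) obtain y where y: "B \<in> Obj C" "arr y" "src y = B" "tgt y = B" "(f \<cdot> h) \<cdot> y = Id C B"
    by (elim isomorphismE)
  have "x \<cdot> g = (x \<cdot> g) \<cdot> ((f \<cdot> h) \<cdot> y)" using y x assms by simp
  also have "\<dots> = (x \<cdot> (g \<cdot> f)) \<cdot> (h \<cdot> y)"
    using x(1-4) y(1-4) assms by (simp add: comp_assoc)
  also have "\<dots> = h \<cdot> y" using x y assms by simp
  finally have "f \<cdot> (x \<cdot> g) = Id C B" using x y assms by (simp add: comp_assoc)
  moreover have "(x \<cdot> g) \<cdot> f = Id C A" using x assms by (simp add: comp_assoc)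
  ultimately show ?thesis using isomorphismI[of f "x \<cdot> g"] x y assms by simp
qed

end

section \<open>Signs, zero morphisms, unipotent endomorphisms and direct sums\<close>

context preadditive_category
begin

abbreviation add (infixl "\<boxplus>" 65) where
  "f \<boxplus> g \<equiv> Add C f g"

text \<open>The ends of \<open>f\<close> recover its hom group, so negation needs no index.\<close>

definition neg where
  "neg f = \<ominus>\<^bsub>hom_group C (src f) (tgt f)\<^esub> f"

lemma hom_group_simps [simp]:
  "carrier (hom_group C A B) = Hom C A B" "zero (hom_group C A B) = Zero C A B"
  "ring.add (hom_group C A B) = Add C"
  by (simp_all add: hom_group_def)

lemma a_inv_eq_neg:
  "A \<in> Obj C \<Longrightarrow> B \<in> Obj C \<Longrightarrow> f \<in> Hom C A B \<Longrightarrow> \<ominus>\<^bsub>hom_group C A B\<^esub> f = neg f"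
  by (simp add: neg_def in_Hom_iff)

lemma arr_Add [simp]:
  assumes "arr f" "arr g" "src g = src f" "tgt g = tgt f"
  shows "arr (f \<boxplus> g)" "src (f \<boxplus> g) = src f" "tgt (f \<boxplus> g) = tgt f"
proof -
  interpret abelian_group "hom_group C (src f) (tgt f)" using assms by (simp add: Hom_abelian_group)
  have "f \<boxplus> g \<in> Hom C (src f) (tgt f)"
    using a_closed[of f g] assms by (simp add: in_Hom_iff)
  then show "arr (f \<boxplus> g)" "src (f \<boxplus> g) = src f" "tgt (f \<boxplus> g) = tgt f"
    using assms by (simp_all add: in_Hom_iff)
qed

lemma arr_Zero [simp]:
  assumes "A \<in> Obj C" "B \<in> Obj C"
  shows "arr (Zero C A B)" "src (Zero C A B) = A" "tgt (Zero C A B) = B"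
proof -
  interpret abelian_group "hom_group C A B" using assms by (simp add: Hom_abelian_group)
  show "arr (Zero C A B)" "src (Zero C A B) = A" "tgt (Zero C A B) = B"
    using zero_closed assms by (simp_all add: in_Hom_iff)
qed

lemma arr_neg [simp]:
  assumes "arr f"
  shows "arr (neg f)" "src (neg f) = src f" "tgt (neg f) = tgt f"
proof -
  interpret abelian_group "hom_group C (src f) (tgt f)" using assms by (simp add: Hom_abelian_group)
  show "arr (neg f)" "src (neg f) = src f" "tgt (neg f) = tgt f"
    using a_inv_closed[of f] assms by (simp_all add: in_Hom_iff neg_def)
qed

lemma add_assoc:
  assumes "arr f" "arr g" "arr h" "src g = src f" "tgt g = tgt f" "src h = src f" "tgt h = tgt f"
  shows "(f \<boxplus> g) \<boxplus> h = f \<boxplus> (g \<boxplus> h)"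
proof -
  interpret abelian_group "hom_group C (src f) (tgt f)" using assms by (simp add: Hom_abelian_group)
  show ?thesis using a_assoc[of f g h] assms by (simp add: in_Hom_iff)
qed

lemma add_commute:
  assumes "arr f" "arr g" "src g = src f" "tgt g = tgt f"
  shows "f \<boxplus> g = g \<boxplus> f"
proof -
  interpret abelian_group "hom_group C (src f) (tgt f)" using assms by (simp add: Hom_abelian_group)
  show ?thesis using a_comm[of f g] assms by (simp add: in_Hom_iff)
qed

lemma add_left_commute:
  assumes "arr f" "arr g" "arr h" "src g = src f" "tgt g = tgt f" "src h = src f" "tgt h = tgt f"
  shows "f \<boxplus> (g \<boxplus> h) = g \<boxplus> (f \<boxplus> h)"
  using add_assoc[of f g h] add_assoc[of g f h] unfolding add_commute[OF assms(1,2,4,5)]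
  using assms by simp

lemmas add_ac = add_assoc add_commute add_left_commute

lemma add_Zero [simp]:
  assumes "arr f" "src f = A" "tgt f = B"
  shows "f \<boxplus> Zero C A B = f" "Zero C A B \<boxplus> f = f"
proof -
  interpret abelian_group "hom_group C A B" using assms by (auto simp: Hom_abelian_group)
  show "f \<boxplus> Zero C A B = f" "Zero C A B \<boxplus> f = f"
    using r_zero[of f] l_zero[of f] arr_in_Hom[of f] assms by auto
qed

lemma add_neg [simp]:
  assumes "arr f"
  shows "f \<boxplus> neg f = Zero C (src f) (tgt f)" "neg f \<boxplus> f = Zero C (src f) (tgt f)"
proof -
  interpret abelian_group "hom_group C (src f) (tgt f)" using assms by (simp add: Hom_abelian_group)
  show "f \<boxplus> neg f = Zero C (src f) (tgt f)" "neg f \<boxplus> f = Zero C (src f) (tgt f)"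
    using r_neg[of f] l_neg[of f] assms by (simp_all add: in_Hom_iff neg_def)
qed

lemma add_left_cancel:
  assumes "arr f" "arr g" "arr h" "src g = src f" "tgt g = tgt f" "src h = src f" "tgt h = tgt f"
  shows "f \<boxplus> g = f \<boxplus> h \<longleftrightarrow> g = h"
proof
  assume "f \<boxplus> g = f \<boxplus> h"
  then have "neg f \<boxplus> (f \<boxplus> g) = neg f \<boxplus> (f \<boxplus> h)" by simp
  then show "g = h" using assms by (simp flip: add_assoc)
qed simp

lemma add_neg_cancel [simp]:
  assumes "arr f" "arr g" "src g = src f" "tgt g = tgt f"
  shows "f \<boxplus> (neg f \<boxplus> g) = g" "neg f \<boxplus> (f \<boxplus> g) = g"
  using assms add_assoc[of f "neg f" g] add_assoc[of "neg f" f g] by simp_all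

lemma neg_unique:
  assumes "arr f" "arr g" "src g = src f" "tgt g = tgt f" "f \<boxplus> g = Zero C (src f) (tgt f)"
  shows "g = neg f"
  using add_left_cancel[of f g "neg f"] assms by simp

lemma neg_neg [simp]: "arr f \<Longrightarrow> neg (neg f) = f"
  using neg_unique[of "neg f" f] by simp

lemma neg_Zero [simp]: "A \<in> Obj C \<Longrightarrow> B \<in> Obj C \<Longrightarrow> neg (Zero C A B) = Zero C A B"
  using neg_unique[of "Zero C A B" "Zero C A B"] by simp

lemma neg_add:
  assumes "arr f" "arr g" "src g = src f" "tgt g = tgt f"
  shows "neg (f \<boxplus> g) = neg f \<boxplus> neg g"
proof -
  have "(f \<boxplus> g) \<boxplus> (neg f \<boxplus> neg g) = (f \<boxplus> neg f) \<boxplus> (g \<boxplus> neg g)"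
    using assms by (simp add: add_ac del: add_neg add_neg_cancel)
  then show ?thesis using neg_unique[of "f \<boxplus> g" "neg f \<boxplus> neg g"] assms by simp
qed

lemma comp_add_right:
  "\<lbrakk>arr f; arr f'; arr g; src f' = src f; tgt f' = tgt f; src g = tgt f\<rbrakk>
    \<Longrightarrow> g \<cdot> (f \<boxplus> f') = g \<cdot> f \<boxplus> g \<cdot> f'"
  using Comp_Add_right[of "src f" "tgt f" "tgt g" f f' g] by (simp add: in_Hom_iff)

lemma comp_add_left:
  "\<lbrakk>arr f; arr g; arr g'; src g' = src g; tgt g' = tgt g; src g = tgt f\<rbrakk>
    \<Longrightarrow> (g \<boxplus> g') \<cdot> f = g \<cdot> f \<boxplus> g' \<cdot> f"
  using Comp_Add_left[of "src f" "tgt f" "tgt g" f g g'] by (simp add: in_Hom_iff)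

lemma add_self_eq: "arr f \<Longrightarrow> f \<boxplus> f = f \<Longrightarrow> f = Zero C (src f) (tgt f)"
  using add_left_cancel[of f f "Zero C (src f) (tgt f)"] by simp

lemma comp_Zero [simp]:
  assumes "arr g" "A \<in> Obj C" "src g = B" shows "g \<cdot> Zero C A B = Zero C A (tgt g)"
proof -
  have "B \<in> Obj C" using assms by auto
  then show ?thesis
    using add_self_eq[of "g \<cdot> Zero C A B"] comp_add_right[of "Zero C A B" "Zero C A B" g] assms by simp
qed

lemma Zero_comp [simp]:
  assumes "arr f" "B \<in> Obj C" "tgt f = A" shows "Zero C A B \<cdot> f = Zero C (src f) B"
proof -
  have "A \<in> Obj C" using assms by auto
  then show ?thesis
    using add_self_eq[of "Zero C A B \<cdot> f"] comp_add_left[of f "Zero C A B" "Zero C A B"] assms by simp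
qed

lemma comp_neg [simp]: "arr f \<Longrightarrow> arr g \<Longrightarrow> src g = tgt f \<Longrightarrow> g \<cdot> neg f = neg (g \<cdot> f)"
  using neg_unique[of "g \<cdot> f" "g \<cdot> neg f"] comp_add_right[of f "neg f" g] by simp

lemma neg_comp [simp]: "arr f \<Longrightarrow> arr g \<Longrightarrow> src g = tgt f \<Longrightarrow> neg g \<cdot> f = neg (g \<cdot> f)"
  using neg_unique[of "g \<cdot> f" "neg g \<cdot> f"] comp_add_left[of f g "neg g"] by simp

lemma eq_add_iff:
  assumes "arr f" "arr g" "arr h" "src g = src f" "tgt g = tgt f" "src h = src f" "tgt h = tgt f"
  shows "f = g \<boxplus> h \<longleftrightarrow> f \<boxplus> neg g = h"
proof -
  have "g \<boxplus> (f \<boxplus> neg g) = f \<boxplus> (g \<boxplus> neg g)" using assms by (simp add: add_ac del: add_neg add_neg_cancel)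
  then have "g \<boxplus> (f \<boxplus> neg g) = f" using assms by simp
  then show ?thesis using add_left_cancel[of g "f \<boxplus> neg g" h] assms by auto
qed

lemma diff_eq_Zero_iff:
  assumes "arr f" "arr g" "src g = src f" "tgt g = tgt f"
  shows "f \<boxplus> neg g = Zero C (src f) (tgt f) \<longleftrightarrow> f = g"
  using eq_add_iff[of f g "Zero C (src f) (tgt f)"] assms by auto

lemma neg_eq_iff [simp]: "arr f \<Longrightarrow> arr g \<Longrightarrow> neg f = neg g \<longleftrightarrow> f = g"
  using neg_neg by metis

lemma isomorphism_neg_Id: "A \<in> Obj C \<Longrightarrow> isomorphism C A A (neg (Id C A))"
  using isomorphismI[of "neg (Id C A)" "neg (Id C A)"] by simp

text \<open>The inverse is \<open>Id C A \<boxplus> neg n\<close>, because the square of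
  \<open>n\<close> vanishes.\<close>

lemma isomorphism_unipotent:
  assumes "arr f" "src f = A" "tgt f = A" "arr n" "src n = A" "tgt n = A"
    and "f = Id C A \<boxplus> n" "n \<cdot> n = Zero C A A"
  shows "isomorphism C A A f"
proof -
  have A: "A \<in> Obj C" using assms arr_ends by metis
  have "f \<cdot> (Id C A \<boxplus> neg n) = Id C A" "(Id C A \<boxplus> neg n) \<cdot> f = Id C A"
    using A assms(1-6,8) unfolding assms(7) by (simp_all add: comp_add_right comp_add_left add_assoc)
  then show ?thesis using isomorphismI[of f "Id C A \<boxplus> neg n"] A assms by simp
qed

text \<open>The five lemma for a sequence \<open>B \<rightarrow> D \<rightarrow> E\<close> with maps \<open>g\<close>, \<open>h\<close> and the identity of \<open>B\<close>, \<open>E\<close>: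
  an endomorphism of \<open>D\<close> differing from the identity by a map which factors through one of
  \<open>g\<close>, \<open>h\<close> and is annihilated by it is unipotent.\<close>

lemma isomorphism_if_fixes_left:
  assumes "arr f" "src f = D" "tgt f = D" "arr g" "tgt g = D" "arr v" "src v = D" "tgt v = src g"
    and "f \<cdot> g = g" "f = Id C D \<boxplus> g \<cdot> v"
  shows "isomorphism C D D f"
proof -
  have D: "D \<in> Obj C" using assms arr_ends by metis
  let ?n = "g \<cdot> v"
  have "g \<boxplus> ?n \<cdot> g = g \<boxplus> Zero C (src g) D"
    using assms(9) unfolding assms(10) using D assms(1-8) by (simp add: comp_add_left)
  then have "?n \<cdot> g = Zero C (src g) D"
    using add_left_cancel[of g "?n \<cdot> g" "Zero C (src g) D"] assms(1-8) D by simp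
  then have "?n \<cdot> ?n = Zero C D D"
    using assms(1-8) D by (simp add: comp_assoc[of v g "g \<cdot> v", symmetric])
  then show ?thesis using isomorphism_unipotent[of f D ?n] assms D by simp
qed

lemma isomorphism_if_fixes_right:
  assumes "arr f" "src f = D" "tgt f = D" "arr h" "src h = D" "arr m" "tgt m = D" "src m = tgt h"
    and "h \<cdot> f = h" "f = Id C D \<boxplus> m \<cdot> h"
  shows "isomorphism C D D f"
proof -
  have D: "D \<in> Obj C" using assms arr_ends by metis
  let ?n = "m \<cdot> h"
  have "h \<boxplus> h \<cdot> ?n = h \<boxplus> Zero C D (tgt h)"
    using assms(9) unfolding assms(10) using D assms(1-8) by (simp add: comp_add_right)
  then have "h \<cdot> ?n = Zero C D (tgt h)"
    using add_left_cancel[of h "h \<cdot> ?n" "Zero C D (tgt h)"] assms(1-8) D by simp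
  then have "?n \<cdot> ?n = Zero C D D"
    using assms(1-8) D by (simp add: comp_assoc[of "m \<cdot> h" h m])
  then show ?thesis using isomorphism_unipotent[of f D ?n] assms D by simp
qed

lemma zero_object_arr:
  assumes "zero_object C Z" "arr f" "src f = Z \<or> tgt f = Z"
  shows "f = Zero C (src f) (tgt f)"
  using assms arr_in_Hom[of f] arr_in_Hom[of "Zero C (src f) (tgt f)"]
  unfolding zero_object_def by (auto; metis arr_Zero arr_ends)

lemma direct_sumE:
  assumes "direct_sum C A B D"
  obtains i j p q where "A \<in> Obj C" "B \<in> Obj C" "D \<in> Obj C"
    "arr i" "src i = A" "tgt i = D" "arr j" "src j = B" "tgt j = D"
    "arr p" "src p = D" "tgt p = A" "arr q" "src q = D" "tgt q = B"
    "p \<cdot> i = Id C A" "q \<cdot> j = Id C B" "q \<cdot> i = Zero C A B" "p \<cdot> j = Zero C B A"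
    "i \<cdot> p \<boxplus> j \<cdot> q = Id C D"
  using assms unfolding direct_sum_def by (auto simp: in_Hom_iff)

lemma direct_sumI:
  assumes "A \<in> Obj C" "B \<in> Obj C" "D \<in> Obj C"
    "arr i" "src i = A" "tgt i = D" "arr j" "src j = B" "tgt j = D"
    "arr p" "src p = D" "tgt p = A" "arr q" "src q = D" "tgt q = B"
    "p \<cdot> i = Id C A" "q \<cdot> j = Id C B" "q \<cdot> i = Zero C A B" "p \<cdot> j = Zero C B A"
    "i \<cdot> p \<boxplus> j \<cdot> q = Id C D"
  shows "direct_sum C A B D"
  using assms unfolding direct_sum_def
  by (intro conjI bexI[of _ i] bexI[of _ j] bexI[of _ p] bexI[of _ q]) (simp_all add: in_Hom_iff)

end


section \<open>Endofunctors and sextuples\<close>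

context additive_endofunctor
begin

lemma ob_Obj [simp]: "A \<in> Obj C \<Longrightarrow> ob F A \<in> Obj C"
  by (rule ob_in)

lemma arr_mor [simp]:
  assumes "arr f"
  shows "arr (mor F f)" "src (mor F f) = ob F (src f)" "tgt (mor F f) = ob F (tgt f)"
  using mor_in[of "src f" "tgt f" f] assms by (auto simp: in_Hom_iff)

lemma mor_of_Id [simp]: "A \<in> Obj C \<Longrightarrow> mor F (Id C A) = Id C (ob F A)"
  by (rule mor_Id)

lemma mor_comp:
  "arr f \<Longrightarrow> arr g \<Longrightarrow> src g = tgt f \<Longrightarrow> mor F (g \<cdot> f) = mor F g \<cdot> mor F f"
  using mor_Comp[of "src f" "tgt f" "tgt g" f g] by (simp add: in_Hom_iff)

lemma mor_add:
  "arr f \<Longrightarrow> arr g \<Longrightarrow> src g = src f \<Longrightarrow> tgt g = tgt f \<Longrightarrow> mor F (f \<boxplus> g) = mor F f \<boxplus> mor F g"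
  using mor_Add[of "src f" "tgt f" f g] by (simp add: in_Hom_iff)

lemma mor_Zero [simp]:
  "A \<in> Obj C \<Longrightarrow> B \<in> Obj C \<Longrightarrow> mor F (Zero C A B) = Zero C (ob F A) (ob F B)"
  using add_self_eq[of "mor F (Zero C A B)"] mor_add[of "Zero C A B" "Zero C A B"] by simp

lemma mor_neg [simp]: "arr f \<Longrightarrow> mor F (neg f) = neg (mor F f)"
  using neg_unique[of "mor F f" "mor F (neg f)"] mor_add[of f "neg f"] by simp

lemma isomorphism_mor:
  assumes "isomorphism C A B f" shows "isomorphism C (ob F A) (ob F B) (mor F f)"
proof -
  obtain g where g: "A \<in> Obj C" "B \<in> Obj C" "arr f" "src f = A" "tgt f = B"
    "arr g" "src g = B" "tgt g = A" "g \<cdot> f = Id C A" "f \<cdot> g = Id C B"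
    using assms by (elim isomorphismE)
  then show ?thesis
    using isomorphismI[of "mor F f" "mor F g"] mor_comp[of f g] mor_comp[of g f] by simp
qed

text \<open>The identity of \<open>ob F Z\<close> is the image of a zero map, hence zero, so every
  morphism into or out of \<open>ob F Z\<close> is zero.\<close>

lemma zero_object_ob: assumes "zero_object C Z" shows "zero_object C (ob F Z)"
proof -
  have Z: "Z \<in> Obj C" using assms unfolding zero_object_def by simp
  have "Id C Z = Zero C Z Z" using zero_object_arr[OF assms, of "Id C Z"] Z by simp
  then have *: "Id C (ob F Z) = Zero C (ob F Z) (ob F Z)"
    using mor_of_Id[OF Z] mor_Zero[OF Z Z] by simp
  have "f \<in> Hom C (ob F Z) A \<longleftrightarrow> f = Zero C (ob F Z) A" if "A \<in> Obj C" for f A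
    using comp_Id[of f "ob F Z"] that Z unfolding * by (auto simp: in_Hom_iff)
  moreover have "f \<in> Hom C A (ob F Z) \<longleftrightarrow> f = Zero C A (ob F Z)" if "A \<in> Obj C" for f A
    using Id_comp[of f "ob F Z"] that Z unfolding * by (auto simp: in_Hom_iff)
  ultimately show ?thesis
    unfolding zero_object_def using Z by simp
qed

lemma sextuples_iff:
  "(A, B, D, f, g, h) \<in> sextuples C F \<longleftrightarrow> A \<in> Obj C \<and> B \<in> Obj C \<and> D \<in> Obj C \<and>
     arr f \<and> src f = A \<and> tgt f = B \<and> arr g \<and> src g = B \<and> tgt g = D \<and>
     arr h \<and> src h = D \<and> tgt h = ob F A"
  by (auto simp: sextuples_def in_Hom_iff)

lemma sextuple_mor_iff:
  "sextuple_mor C F (A, B, D, f, g, h) (A', B', D', f', g', h') a b c \<longleftrightarrow>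
     (A, B, D, f, g, h) \<in> sextuples C F \<and> (A', B', D', f', g', h') \<in> sextuples C F \<and>
     arr a \<and> src a = A \<and> tgt a = A' \<and> arr b \<and> src b = B \<and> tgt b = B' \<and>
     arr c \<and> src c = D \<and> tgt c = D' \<and>
     b \<cdot> f = f' \<cdot> a \<and> c \<cdot> g = g' \<cdot> b \<and> mor F a \<cdot> h = h' \<cdot> c"
  unfolding sextuple_mor_def by (auto simp: sextuples_iff in_Hom_iff)

lemma sextuple_isomorphic_iff:
  "sextuple_isomorphic C F (A, B, D, f, g, h) (A', B', D', f', g', h') \<longleftrightarrow>
     (\<exists>a b c. sextuple_mor C F (A, B, D, f, g, h) (A', B', D', f', g', h') a b c \<and>
       isomorphism C A A' a \<and> isomorphism C B B' b \<and> isomorphism C D D' c)"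
  unfolding sextuple_isomorphic_def by simp

lemma sextuple_mor_Comp:
  assumes "sextuple_mor C F (A, B, D, f, g, h) (A', B', D', f', g', h') a b c"
    and "sextuple_mor C F (A', B', D', f', g', h') (A'', B'', D'', f'', g'', h'') a' b' c'"
  shows "sextuple_mor C F (A, B, D, f, g, h) (A'', B'', D'', f'', g'', h'') (a' \<cdot> a) (b' \<cdot> b) (c' \<cdot> c)"
proof -
  note 1 = assms[unfolded sextuple_mor_iff sextuples_iff]
  have "(b' \<cdot> b) \<cdot> f = f'' \<cdot> (a' \<cdot> a)" "(c' \<cdot> c) \<cdot> g = g'' \<cdot> (b' \<cdot> b)"
    "mor F (a' \<cdot> a) \<cdot> h = h'' \<cdot> (c' \<cdot> c)"
  proof -
    have "(b' \<cdot> b) \<cdot> f = b' \<cdot> (f' \<cdot> a)" using 1 by (simp add: comp_assoc)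
    also have "\<dots> = (b' \<cdot> f') \<cdot> a" using 1 by (simp flip: comp_assoc)
    also have "\<dots> = f'' \<cdot> (a' \<cdot> a)" using 1 by (simp add: comp_assoc)
    finally show "(b' \<cdot> b) \<cdot> f = f'' \<cdot> (a' \<cdot> a)" .
    have "(c' \<cdot> c) \<cdot> g = c' \<cdot> (g' \<cdot> b)" using 1 by (simp add: comp_assoc)
    also have "\<dots> = (c' \<cdot> g') \<cdot> b" using 1 by (simp flip: comp_assoc)
    also have "\<dots> = g'' \<cdot> (b' \<cdot> b)" using 1 by (simp add: comp_assoc)
    finally show "(c' \<cdot> c) \<cdot> g = g'' \<cdot> (b' \<cdot> b)" .
    have "mor F (a' \<cdot> a) \<cdot> h = mor F a' \<cdot> (h' \<cdot> c)" using 1 by (simp add: mor_comp comp_assoc)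
    also have "\<dots> = (mor F a' \<cdot> h') \<cdot> c" using 1 by (simp flip: comp_assoc)
    also have "\<dots> = h'' \<cdot> (c' \<cdot> c)" using 1 by (simp add: comp_assoc)
    finally show "mor F (a' \<cdot> a) \<cdot> h = h'' \<cdot> (c' \<cdot> c)" .
  qed
  then show ?thesis using 1 unfolding sextuple_mor_iff sextuples_iff by simp
qed

text \<open>Insert \<open>x \<cdot> x'\<close> next to \<open>f'\<close>, move \<open>x\<close>
  across the square and cancel \<open>y' \<cdot> y\<close>. A right inverse of \<open>x\<close> and
  a left inverse of \<open>y\<close> suffice.\<close>

lemma square_inverse:
  assumes "y \<cdot> f = f' \<cdot> x" "arr f" "arr f'" "arr x" "arr y" "arr x'" "arr y'"
    and "src y = tgt f" "src x = src f" "tgt x = src f'" "tgt y = tgt f'"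
    and "src x' = tgt x" "tgt x' = src x" "src y' = tgt y" "tgt y' = src y"
    and "x \<cdot> x' = Id C (tgt x)" "y' \<cdot> y = Id C (src y)"
  shows "y' \<cdot> f' = f \<cdot> x'"
proof -
  have "y' \<cdot> f' = y' \<cdot> (f' \<cdot> (x \<cdot> x'))" using assms by simp
  also have "\<dots> = y' \<cdot> ((f' \<cdot> x) \<cdot> x')" using assms(2-15) by (simp add: comp_assoc)
  also have "\<dots> = y' \<cdot> ((y \<cdot> f) \<cdot> x')" using assms by simp
  also have "\<dots> = (y' \<cdot> y) \<cdot> (f \<cdot> x')" using assms(2-15) by (simp add: comp_assoc)
  also have "\<dots> = f \<cdot> x'" using assms(2-15,17) by simp
  finally show ?thesis .
qed

lemma sextuple_isomorphic_refl:
  assumes "s \<in> sextuples C F" shows "sextuple_isomorphic C F s s"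
proof -
  obtain A B D f g h where s: "s = (A, B, D, f, g, h)" by (cases s)
  show ?thesis
    unfolding s sextuple_isomorphic_iff
    by (rule exI[of _ "Id C A"], rule exI[of _ "Id C B"], rule exI[of _ "Id C D"])
      (use assms[unfolded s] in \<open>auto simp: sextuple_mor_iff sextuples_iff isomorphism_Id\<close>)
qed

lemma sextuple_mor_inverse:
  assumes "sextuple_mor C F (A, B, D, f, g, h) (A', B', D', f', g', h') a b c"
    and "isomorphism C A A' a" "isomorphism C B B' b" "isomorphism C D D' c"
  shows "sextuple_isomorphic C F (A', B', D', f', g', h') (A, B, D, f, g, h)"
proof -
  obtain a' where a: "arr a" "src a = A" "tgt a = A'"
    "arr a'" "src a' = A'" "tgt a' = A" "a' \<cdot> a = Id C A" "a \<cdot> a' = Id C A'"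
    using assms(2) by (elim isomorphismE)
  obtain b' where b: "arr b" "src b = B" "tgt b = B'"
    "arr b'" "src b' = B'" "tgt b' = B" "b' \<cdot> b = Id C B" "b \<cdot> b' = Id C B'"
    using assms(3) by (elim isomorphismE)
  obtain c' where c: "arr c" "src c = D" "tgt c = D'"
    "arr c'" "src c' = D'" "tgt c' = D" "c' \<cdot> c = Id C D" "c \<cdot> c' = Id C D'"
    using assms(4) by (elim isomorphismE)
  note 1 = assms(1)[unfolded sextuple_mor_iff sextuples_iff]
  have "b' \<cdot> f' = f \<cdot> a'"
    using square_inverse[of b f f' a a' b'] 1 a b by simp
  moreover have "c' \<cdot> g' = g \<cdot> b'"
    using square_inverse[of c g g' b b' c'] 1 b c by simp
  moreover have "mor F a' \<cdot> h' = h \<cdot> c'"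
    using square_inverse[of "mor F a" h h' c c' "mor F a'"] 1 a c mor_comp[of a a'] by simp
  moreover have "isomorphism C A' A a'" "isomorphism C B' B b'" "isomorphism C D' D c'"
    using isomorphismI[of a' a] isomorphismI[of b' b] isomorphismI[of c' c] a b c by simp_all
  ultimately show ?thesis
    unfolding sextuple_isomorphic_iff sextuple_mor_iff sextuples_iff
    using 1 a b c by blast
qed

lemma sextuple_isomorphic_sym:
  assumes "sextuple_isomorphic C F s s'" shows "sextuple_isomorphic C F s' s"
proof -
  obtain A B D f g h A' B' D' f' g' h' where s: "s = (A, B, D, f, g, h)" "s' = (A', B', D', f', g', h')"
    by (cases s, cases s')
  show ?thesis using assms sextuple_mor_inverse unfolding s sextuple_isomorphic_iff by blast
qed

lemma sextuple_isomorphic_trans: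
  assumes "sextuple_isomorphic C F s s'" "sextuple_isomorphic C F s' s''"
  shows "sextuple_isomorphic C F s s''"
proof -
  obtain A B D f g h A' B' D' f' g' h' A'' B'' D'' f'' g'' h''
    where s: "s = (A, B, D, f, g, h)" "s' = (A', B', D', f', g', h')"
      "s'' = (A'', B'', D'', f'', g'', h'')"
    by (cases s, cases s', cases s'')
  show ?thesis
    using assms sextuple_mor_Comp isomorphism_Comp unfolding s sextuple_isomorphic_iff by meson
qed

end


section \<open>Transfer of the octahedron\<close>

text \<open>These properties are what the comparison of cones and octahedra needs. They are isolated
  because for the subfactor category they are available before rotation and octahedron, whose proofs
  use the comparison.\<close>

locale weak_right_triangles = additive_endofunctor C F
  for C :: "('o, 'm, 'z) cat_scheme" (structure) and F :: "('o, 'm) endofunctor"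
    and \<Delta> :: "('o, 'm) sextuple set" +
  assumes tri_sextuples: "\<Delta> \<subseteq> sextuples C F"
    and tri_iso_closed: "\<lbrakk>s \<in> \<Delta>; sextuple_isomorphic C F s s'\<rbrakk> \<Longrightarrow> s' \<in> \<Delta>"
    and tri_fill: "\<lbrakk>(A, B, D, f, g, h) \<in> \<Delta>; (A', B', D', f', g', h') \<in> \<Delta>;
        a \<in> Hom C A A'; b \<in> Hom C B B'; b \<cdot> f = f' \<cdot> a\<rbrakk>
      \<Longrightarrow> \<exists>c. sextuple_mor C F (A, B, D, f, g, h) (A', B', D', f', g', h') a b c"
    and weak_cokernel: "\<lbrakk>(A, B, D, f, g, h) \<in> \<Delta>; arr u; src u = D; u \<cdot> g = Zero C B (tgt u)\<rbrakk>
      \<Longrightarrow> \<exists>m. arr m \<and> src m = ob F A \<and> tgt m = tgt u \<and> u = m \<cdot> h"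
begin

lemma tri_iff: "(A, B, D, f, g, h) \<in> \<Delta> \<Longrightarrow> A \<in> Obj C \<and> B \<in> Obj C \<and> D \<in> Obj C \<and>
     arr f \<and> src f = A \<and> tgt f = B \<and> arr g \<and> src g = B \<and> tgt g = D \<and>
     arr h \<and> src h = D \<and> tgt h = ob F A"
  using tri_sextuples sextuples_iff by blast

text \<open>\<open>c\<close> minus the identity kills \<open>g\<close>, so it equals some
  \<open>m \<cdot> h\<close> by the weak cokernel property; with \<open>h \<cdot> c = h\<close> this
  difference has square zero.\<close>

lemma endomorphism_iso:
  assumes t: "(A, B, D, f, g, h) \<in> \<Delta>" and "arr c" "src c = D" "tgt c = D" "c \<cdot> g = g" "h \<cdot> c = h"
  shows "isomorphism C D D c"
proof -
  note 1 = tri_iff[OF t]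
  have "(c \<boxplus> neg (Id C D)) \<cdot> g = Zero C B D" using 1 assms(2-6) by (simp add: comp_add_left)
  then obtain m where m: "arr m" "src m = ob F A" "tgt m = D" "c \<boxplus> neg (Id C D) = m \<cdot> h"
    using weak_cokernel[OF t, of "c \<boxplus> neg (Id C D)"] 1 assms by auto
  then have "c = Id C D \<boxplus> m \<cdot> h" using eq_add_iff[of c "Id C D" "m \<cdot> h"] 1 assms(2-4) by simp
  then show ?thesis using isomorphism_if_fixes_right[of c D h m] m 1 assms by simp
qed

text \<open>A fill-in \<open>c'\<close> over the inverses of \<open>a\<close> and \<open>b\<close>
  need not invert \<open>c\<close>, but both composites are endomorphisms over identities, hence
  invertible by \<open>endomorphism_iso\<close>.\<close>

lemma third_iso:
  assumes t: "(A, B, D, f, g, h) \<in> \<Delta>" and t': "(A', B', D', f', g', h') \<in> \<Delta>"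
    and c: "sextuple_mor C F (A, B, D, f, g, h) (A', B', D', f', g', h') a b c"
    and a: "isomorphism C A A' a" and b: "isomorphism C B B' b"
  shows "isomorphism C D D' c"
proof -
  obtain a' where a: "arr a" "src a = A" "tgt a = A'"
    "arr a'" "src a' = A'" "tgt a' = A" "a' \<cdot> a = Id C A" "a \<cdot> a' = Id C A'"
    using a by (elim isomorphismE)
  obtain b' where b: "arr b" "src b = B" "tgt b = B'"
    "arr b'" "src b' = B'" "tgt b' = B" "b' \<cdot> b = Id C B" "b \<cdot> b' = Id C B'"
    using b by (elim isomorphismE)
  note 1 = c[unfolded sextuple_mor_iff sextuples_iff]
  have "b' \<cdot> f' = f \<cdot> a'" using square_inverse[of b f f' a a' b'] 1 a b by simp
  then obtain c' where c': "sextuple_mor C F (A', B', D', f', g', h') (A, B, D, f, g, h) a' b' c'"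
    using tri_fill[OF t' t, of a' b'] 1 a b by (auto simp: in_Hom_iff)
  note 2 = c'[unfolded sextuple_mor_iff sextuples_iff]
  have "isomorphism C D D (c' \<cdot> c)"
    using endomorphism_iso[OF t, of "c' \<cdot> c"] sextuple_mor_Comp[OF c c'] a b 1 2
    unfolding sextuple_mor_iff by simp
  moreover have "isomorphism C D' D' (c \<cdot> c')"
    using endomorphism_iso[OF t', of "c \<cdot> c'"] sextuple_mor_Comp[OF c' c] a b 1 2
    unfolding sextuple_mor_iff by simp
  ultimately show ?thesis using isomorphism_if_one_sided[of c D D' c' c'] 1 2 by simp
qed

text \<open>Fill-ins along \<open>v\<close> and \<open>w\<close> identify the three cones with those
  of the primed triangles, and \<open>s'\<close>, \<open>t'\<close> are conjugated back. So it is
  enough to produce an octahedron on convenient representatives.\<close>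

lemma octahedron_transfer:
  assumes t1: "(A, B, D, f, g, h) \<in> \<Delta>" and t2: "(B, X, Y, a, b, c) \<in> \<Delta>"
    and t3: "(A, X, Z, a \<cdot> f, d, e) \<in> \<Delta>"
    and u1: "(A, B', D', f', g', h') \<in> \<Delta>" and u2: "(B', X', Y', a', b', c') \<in> \<Delta>"
    and u3: "(A, X', Z', a' \<cdot> f', d', e') \<in> \<Delta>"
    and v: "isomorphism C B B' v" "isomorphism C X X' w" "v \<cdot> f = f'" "w \<cdot> a = a' \<cdot> v"
    and st: "arr s'" "src s' = D'" "tgt s' = Z'" "arr t'" "src t' = Z'" "tgt t' = Y'"
      "s' \<cdot> g' = d' \<cdot> a'" "e' \<cdot> s' = h'" "t' \<cdot> d' = b'" "c' \<cdot> t' = mor F f' \<cdot> e'"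
      "(D', Z', Y', s', t', mor F g' \<cdot> c') \<in> \<Delta>"
  shows "\<exists>s \<in> Hom C D Z. \<exists>t \<in> Hom C Z Y.
            s \<cdot> g = d \<cdot> a \<and> e \<cdot> s = h \<and> t \<cdot> d = b \<and> c \<cdot> t = mor F f \<cdot> e \<and>
            (D, Z, Y, s, t, mor F g \<cdot> c) \<in> \<Delta>"
proof -
  note T = tri_iff[OF t1] tri_iff[OF t2] tri_iff[OF t3] tri_iff[OF u1] tri_iff[OF u2] tri_iff[OF u3]
  obtain v' where v': "arr v" "src v = B" "tgt v = B'"
    "arr v'" "src v' = B'" "tgt v' = B" "v' \<cdot> v = Id C B" "v \<cdot> v' = Id C B'"
    using v(1) by (elim isomorphismE)
  obtain w' where w': "arr w" "src w = X" "tgt w = X'"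
    "arr w'" "src w' = X'" "tgt w' = X" "w' \<cdot> w = Id C X" "w \<cdot> w' = Id C X'"
    using v(2) by (elim isomorphismE)
  have "w \<cdot> (a \<cdot> f) = (a' \<cdot> v) \<cdot> f" using v(4) T w' by (simp flip: comp_assoc)
  also have "\<dots> = a' \<cdot> f'" unfolding v(3)[symmetric] using T v' by (simp add: comp_assoc)
  finally have waf: "w \<cdot> (a \<cdot> f) = a' \<cdot> f'" .
  obtain x where x: "sextuple_mor C F (A, B, D, f, g, h) (A, B', D', f', g', h') (Id C A) v x"
    using tri_fill[OF t1 u1, of "Id C A" v] T v v' by (auto simp: in_Hom_iff)
  obtain y where y: "sextuple_mor C F (B, X, Y, a, b, c) (B', X', Y', a', b', c') v w y"
    using tri_fill[OF t2 u2, of v w] T v v' w' by (auto simp: in_Hom_iff)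
  obtain z where z: "sextuple_mor C F (A, X, Z, a \<cdot> f, d, e) (A, X', Z', a' \<cdot> f', d', e') (Id C A) w z"
    using tri_fill[OF t3 u3, of "Id C A" w] T v v' w' waf by (auto simp: in_Hom_iff)
  note 1 = x[unfolded sextuple_mor_iff] y[unfolded sextuple_mor_iff] z[unfolded sextuple_mor_iff]
  have ix: "isomorphism C D D' x" and iy: "isomorphism C Y Y' y" and iz: "isomorphism C Z Z' z"
    using third_iso[OF t1 u1 x] third_iso[OF t2 u2 y] third_iso[OF t3 u3 z] T v by (simp_all add: isomorphism_Id)
  obtain y' where y': "arr y'" "src y' = Y'" "tgt y' = Y" "y' \<cdot> y = Id C Y" "y \<cdot> y' = Id C Y'"
    using iy by (elim isomorphismE)
  obtain z' where z': "arr z'" "src z' = Z'" "tgt z' = Z" "z' \<cdot> z = Id C Z" "z \<cdot> z' = Id C Z'"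
    using iz by (elim isomorphismE)
  have eqx: "x \<cdot> g = g' \<cdot> v" "h = h' \<cdot> x" and eqy: "y \<cdot> b = b' \<cdot> w" "mor F v \<cdot> c = c' \<cdot> y"
    and eqz: "z \<cdot> d = d' \<cdot> w" "e = e' \<cdot> z"
    using 1 T by auto
  define s where "s = z' \<cdot> (s' \<cdot> x)"
  define t where "t = y' \<cdot> (t' \<cdot> z)"
  have ty: "arr x" "src x = D" "tgt x = D'" "arr y" "src y = Y" "tgt y = Y'" "arr z" "src z = Z" "tgt z = Z'"
    using 1 by auto
  have s: "arr s" "src s = D" "tgt s = Z" and t: "arr t" "src t = Z" "tgt t = Y"
    unfolding s_def t_def using ty y' z' st(1-6) by simp_all
  have zs: "z \<cdot> s = s' \<cdot> x"
    unfolding s_def using ty z' st(1-6) by (simp flip: comp_assoc)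
  have yt: "y \<cdot> t = t' \<cdot> z"
    unfolding t_def using ty y' st(1-6) by (simp flip: comp_assoc)
  have cancel_z: "p = q" if "z \<cdot> p = z \<cdot> q" "arr p" "arr q" "tgt p = Z" "tgt q = Z" for p q
    using comp_assoc[of p z z'] comp_assoc[of q z z'] that z' ty by simp
  have cancel_y: "p = q" if "y \<cdot> p = y \<cdot> q" "arr p" "arr q" "tgt p = Y" "tgt q = Y" for p q
    using comp_assoc[of p y y'] comp_assoc[of q y y'] that y' ty by simp
  have "z \<cdot> (s \<cdot> g) = (s' \<cdot> x) \<cdot> g" using zs s ty T by (simp flip: comp_assoc)
  also have "\<dots> = s' \<cdot> (g' \<cdot> v)" using eqx s ty T st(1-6) by (simp add: comp_assoc)
  also have "\<dots> = (d' \<cdot> a') \<cdot> v" using st T v' by (simp flip: comp_assoc)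
  also have "\<dots> = d' \<cdot> (w \<cdot> a)" using T v v' by (simp add: comp_assoc)
  also have "\<dots> = (z \<cdot> d) \<cdot> a" using eqz T v w' by (simp add: comp_assoc)
  also have "\<dots> = z \<cdot> (d \<cdot> a)" using T v w' ty by (simp add: comp_assoc)
  finally have r1: "s \<cdot> g = d \<cdot> a" using cancel_z[of "s \<cdot> g" "d \<cdot> a"] T s by simp
  have "e \<cdot> s = e' \<cdot> (z \<cdot> s)" unfolding eqz(2) using T s ty by (simp add: comp_assoc)
  also have "\<dots> = (e' \<cdot> s') \<cdot> x" unfolding zs using T ty st(1-6) by (simp add: comp_assoc)
  also have "\<dots> = h" using st eqx by simp
  finally have r2: "e \<cdot> s = h" .
  have "y \<cdot> (t \<cdot> d) = (t' \<cdot> z) \<cdot> d" using yt t ty T by (simp flip: comp_assoc)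
  also have "\<dots> = t' \<cdot> (d' \<cdot> w)" using eqz t ty T st(1-6) by (simp add: comp_assoc)
  also have "\<dots> = b' \<cdot> w" using st T w' by (simp flip: comp_assoc)
  also have "\<dots> = y \<cdot> b" using eqy by simp
  finally have r3: "t \<cdot> d = b" using cancel_y[of "t \<cdot> d" b] T t by simp
  \<comment> \<open>The fill-in \<open>y\<close> controls \<open>c\<close> only after composition
    with \<open>mor F v\<close>; the relation is checked there, and the invertible
    \<open>mor F v\<close> is cancelled afterwards.\<close>
  have Fv: "mor F v \<cdot> (c \<cdot> t) = mor F v \<cdot> (mor F f \<cdot> e)"
  proof -
    have "mor F v \<cdot> (c \<cdot> t) = (mor F v \<cdot> c) \<cdot> t" using T v' t by (simp add: comp_assoc)
    also have "\<dots> = c' \<cdot> (y \<cdot> t)" unfolding eqy using T t ty by (simp add: comp_assoc)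
    also have "\<dots> = (c' \<cdot> t') \<cdot> z" unfolding yt using T ty st(1-6) by (simp add: comp_assoc)
    also have "\<dots> = mor F f' \<cdot> e" unfolding st(10) using T eqz ty by (simp add: comp_assoc)
    also have "\<dots> = mor F v \<cdot> (mor F f \<cdot> e)"
      unfolding v(3)[symmetric] using T v' by (simp add: mor_comp comp_assoc)
    finally show ?thesis .
  qed
  have "mor F v' \<cdot> mor F v = Id C (ob F B)" using mor_comp[of v v'] v' T by simp
  then have "mor F v' \<cdot> (mor F v \<cdot> p) = p" if "arr p" "tgt p = ob F B" for p
    using comp_assoc[of p "mor F v" "mor F v'"] v' that by simp
  then have r4: "c \<cdot> t = mor F f \<cdot> e" using Fv T t by (metis arr_Comp arr_mor)
  have "mor F x \<cdot> (mor F g \<cdot> c) = mor F (x \<cdot> g) \<cdot> c" using T ty by (simp add: mor_comp comp_assoc)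
  also have "\<dots> = mor F g' \<cdot> (mor F v \<cdot> c)" unfolding eqx using T v' by (simp add: mor_comp comp_assoc)
  also have "\<dots> = (mor F g' \<cdot> c') \<cdot> y" unfolding eqy using T ty by (simp add: comp_assoc)
  finally have "sextuple_mor C F (D, Z, Y, s, t, mor F g \<cdot> c) (D', Z', Y', s', t', mor F g' \<cdot> c') x z y"
    unfolding sextuple_mor_iff sextuples_iff using T ty s t st zs yt by simp
  then have "(D, Z, Y, s, t, mor F g \<cdot> c) \<in> \<Delta>"
    using tri_iso_closed[OF st(11)] sextuple_mor_inverse ix iy iz by blast
  then show ?thesis
    using r1 r2 r3 r4 s t T by (intro bexI[of _ s] bexI[of _ t] conjI) (simp_all add: in_Hom_iff)
qed

end


section \<open>The subfactor category is additive\<close>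

lemma full_subcat_simps [simp]:
  "Obj (full_subcat C \<A>) = \<A>" "Hom (full_subcat C \<A>) = Hom C" "Id (full_subcat C \<A>) = Id C"
  "Comp (full_subcat C \<A>) = Comp C" "Add (full_subcat C \<A>) = Add C"
  "Zero (full_subcat C \<A>) = Zero C"
  by (simp_all add: full_subcat_def)

lemma hom_group_full_subcat [simp]: "hom_group (full_subcat C \<A>) = hom_group C"
  by (simp add: hom_group_def fun_eq_iff)

text \<open>Operations on classes are defined as unions over all representatives; once the classes
  are known to agree, this collapses the union to a single class.\<close>

lemma Union_singleton_class: "S \<noteq> {} \<Longrightarrow> (\<And>x. x \<in> S \<Longrightarrow> x = c) \<Longrightarrow> \<Union>S = c"
  by blast

locale subfactor_category = additive_category C
  for C :: "('o, 'm, 'z) cat_scheme" (structure) +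
  fixes \<A> \<X> :: "'o set"
  assumes \<A>_subcategory: "subcategory C \<A>"
    and \<X>_subcategory: "subcategory (full_subcat C \<A>) \<X>"
begin

abbreviation Q where "Q \<equiv> subfactor C \<A> \<X>"

lemma \<A>_Obj [simp]: "A \<in> \<A> \<Longrightarrow> A \<in> Obj C"
  using \<A>_subcategory unfolding subcategory_def by blast

lemma \<X>_\<A>: "X \<in> \<X> \<Longrightarrow> X \<in> \<A>"
  using \<X>_subcategory unfolding subcategory_def full_subcat_simps by (elim conjE) (rule subsetD)

lemma \<X>_Obj [simp]: "X \<in> \<X> \<Longrightarrow> X \<in> Obj C"
  using \<X>_\<A> by simp

lemma \<A>_iso: "A \<in> \<A> \<Longrightarrow> isomorphism C A B f \<Longrightarrow> B \<in> \<A>"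
  using \<A>_subcategory unfolding subcategory_def isomorphic_def by blast

lemma zero_object_\<A>: "zero_object C Z \<Longrightarrow> Z \<in> \<A>"
  using \<A>_subcategory unfolding subcategory_def by blast

lemma zero_object_\<X>: assumes "zero_object C Z" shows "Z \<in> \<X>"
proof -
  have "zero_object (full_subcat C \<A>) Z"
    using zero_object_\<A>[OF assms] assms unfolding zero_object_def by simp
  then show ?thesis using \<X>_subcategory unfolding subcategory_def by blast
qed

lemma direct_sum_\<A>: "direct_sum C A B D \<Longrightarrow> A \<in> \<A> \<Longrightarrow> B \<in> \<A> \<Longrightarrow> D \<in> \<A>"
  using \<A>_subcategory unfolding subcategory_def by blast

lemma direct_sum_\<X>: assumes "direct_sum C A B D" "A \<in> \<X>" "B \<in> \<X>" shows "D \<in> \<X>"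
proof -
  have "direct_sum (full_subcat C \<A>) A B D"
    using direct_sum_\<A>[OF assms(1)] assms \<X>_\<A> unfolding direct_sum_def by simp
  then show ?thesis using \<X>_subcategory assms unfolding subcategory_def by blast
qed

text \<open>The ideal that is divided out, stated for a morphism with its own ends so that no
  objects have to be carried along.\<close>

definition null :: "'m \<Rightarrow> bool" where
  "null f \<longleftrightarrow> arr f \<and> (\<exists>u v. arr u \<and> arr v \<and> tgt u \<in> \<X> \<and> src v = tgt u \<and> f = v \<cdot> u)"

definition cl :: "'m \<Rightarrow> 'm set" where
  "cl f = sub_class C \<A> \<X> (src f) (tgt f) f"

lemma nullI: "arr u \<Longrightarrow> arr v \<Longrightarrow> tgt u \<in> \<X> \<Longrightarrow> src v = tgt u \<Longrightarrow> null (v \<cdot> u)"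
  unfolding null_def by auto

lemma nullE:
  assumes "null f"
  obtains u v where "arr u" "arr v" "src u = src f" "tgt u \<in> \<X>" "src v = tgt u" "tgt v = tgt f" "f = v \<cdot> u"
  using assms that unfolding null_def by auto

lemma null_arr: "null f \<Longrightarrow> arr f"
  unfolding null_def by simp

lemma factor_hom_iff:
  assumes "A \<in> Obj C" "B \<in> Obj C"
  shows "f \<in> factor_hom (full_subcat C \<A>) \<X> A B \<longleftrightarrow> null f \<and> src f = A \<and> tgt f = B"
proof
  assume "f \<in> factor_hom (full_subcat C \<A>) \<X> A B"
  then obtain u v X where X: "X \<in> \<X>" "u \<in> Hom C A X" "v \<in> Hom C X B" "f = v \<cdot> u"
    unfolding factor_hom_def by auto
  moreover have "X \<in> Obj C" using X by simp
  ultimately show "null f \<and> src f = A \<and> tgt f = B" using assms nullI[of u v] by (auto simp: in_Hom_iff)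
next
  assume "null f \<and> src f = A \<and> tgt f = B"
  then have f: "null f" "src f = A" "tgt f = B" by simp_all
  from f(1) obtain u v where u: "arr u" "arr v" "src u = src f" "tgt u \<in> \<X>" "src v = tgt u" "tgt v = tgt f"
    "f = v \<cdot> u"
    by (rule nullE)
  then have "u \<in> Hom C A (tgt u)" "v \<in> Hom C (tgt u) B" using arr_in_Hom[of u] arr_in_Hom[of v] f by metis+
  then show "f \<in> factor_hom (full_subcat C \<A>) \<X> A B"
    unfolding factor_hom_def using u(4,7) by auto
qed

lemma null_Zero [simp]: assumes "A \<in> Obj C" "B \<in> Obj C" shows "null (Zero C A B)"
proof -
  obtain Z where Z: "zero_object C Z" using ex_zero_object by blast
  then have "Z \<in> \<X>" by (rule zero_object_\<X>)
  then show ?thesis using nullI[of "Zero C A Z" "Zero C Z B"] assms by simp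
qed

lemma null_Comp_left: assumes "null f" "arr g" "src g = tgt f" shows "null (g \<cdot> f)"
proof -
  obtain u v where u: "arr u" "arr v" "src u = src f" "tgt u \<in> \<X>" "src v = tgt u" "tgt v = tgt f" "f = v \<cdot> u"
    using assms(1) by (elim nullE)
  have "g \<cdot> f = (g \<cdot> v) \<cdot> u" unfolding u(7) using u(1-6) assms(2,3) by (simp add: comp_assoc)
  then show ?thesis using nullI[of u "g \<cdot> v"] u(1-6) assms(2,3) by simp
qed

lemma null_Comp_right: assumes "null f" "arr g" "src f = tgt g" shows "null (f \<cdot> g)"
proof -
  obtain u v where u: "arr u" "arr v" "src u = src f" "tgt u \<in> \<X>" "src v = tgt u" "tgt v = tgt f" "f = v \<cdot> u"
    using assms(1) by (elim nullE)
  have "f \<cdot> g = v \<cdot> (u \<cdot> g)" unfolding u(7) using u(1-6) assms(2,3) by (simp add: comp_assoc)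
  then show ?thesis using nullI[of "u \<cdot> g" v] u(1-6) assms(2,3) by simp
qed

lemma null_neg: assumes "null f" shows "null (neg f)"
proof -
  have "neg f = neg (Id C (tgt f)) \<cdot> f" using null_arr[OF assms] by simp
  then show ?thesis using null_Comp_left[OF assms, of "neg (Id C (tgt f))"] null_arr[OF assms] by simp
qed

text \<open>Two maps through objects of \<X> add up to a map through the direct sum of these
  objects, which again lies in \<X>.\<close>

lemma null_add: assumes "null f" "null g" "src g = src f" "tgt g = tgt f" shows "null (f \<boxplus> g)"
proof -
  obtain u v where u: "arr u" "arr v" "src u = src f" "tgt u \<in> \<X>" "src v = tgt u" "tgt v = tgt f" "f = v \<cdot> u"
    using assms(1) by (elim nullE)
  obtain u' v' where u': "arr u'" "arr v'" "src u' = src g" "tgt u' \<in> \<X>" "src v' = tgt u'" "tgt v' = tgt g"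
    "g = v' \<cdot> u'"
    using assms(2) by (elim nullE)
  obtain D where D: "direct_sum C (tgt u) (tgt u') D" using ex_direct_sum u u' by force
  then obtain i j p q where d: "D \<in> Obj C"
    "arr i" "src i = tgt u" "tgt i = D" "arr j" "src j = tgt u'" "tgt j = D"
    "arr p" "src p = D" "tgt p = tgt u" "arr q" "src q = D" "tgt q = tgt u'"
    "p \<cdot> i = Id C (tgt u)" "q \<cdot> j = Id C (tgt u')" "q \<cdot> i = Zero C (tgt u) (tgt u')"
    "p \<cdot> j = Zero C (tgt u') (tgt u)"
    by (elim direct_sumE)
  have "src f \<in> Obj C" using null_arr[OF assms(1)] by simp
  then have "(v \<cdot> p \<boxplus> v' \<cdot> q) \<cdot> (i \<cdot> u \<boxplus> j \<cdot> u') = v \<cdot> u \<boxplus> v' \<cdot> u'"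
    using d u(1-6) u'(1-6) assms(3,4)
    by (simp add: comp_add_left comp_add_right comp_assoc comp_reassoc[OF d(14)] comp_reassoc[OF d(15)]
        comp_reassoc[OF d(16)] comp_reassoc[OF d(17)])
  moreover have "null ((v \<cdot> p \<boxplus> v' \<cdot> q) \<cdot> (i \<cdot> u \<boxplus> j \<cdot> u'))"
    using nullI[of "i \<cdot> u \<boxplus> j \<cdot> u'" "v \<cdot> p \<boxplus> v' \<cdot> q"] direct_sum_\<X>[OF D] d u(1-6) u'(1-6) assms(3,4) by simp
  ultimately show ?thesis unfolding u(7) u'(7) by simp
qed

lemma mem_cl:
  assumes "arr f"
  shows "g \<in> cl f \<longleftrightarrow> arr g \<and> src g = src f \<and> tgt g = tgt f \<and> null (g \<boxplus> neg f)"
proof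
  assume "g \<in> cl f"
  then obtain n where n: "null n" "src n = src f" "tgt n = tgt f" "g = n \<boxplus> f"
    unfolding cl_def mor_class_def a_r_coset_def' using assms by (auto simp: factor_hom_iff)
  then have "g \<boxplus> neg f = n" using null_arr[OF n(1)] assms by (simp add: add_assoc)
  then show "arr g \<and> src g = src f \<and> tgt g = tgt f \<and> null (g \<boxplus> neg f)"
    using n null_arr[OF n(1)] assms by simp
next
  assume *: "arr g \<and> src g = src f \<and> tgt g = tgt f \<and> null (g \<boxplus> neg f)"
  then have "g = (g \<boxplus> neg f) \<boxplus> f" using assms by (simp add: add_assoc)
  then show "g \<in> cl f"
    unfolding cl_def mor_class_def a_r_coset_def' using * assms
    by (auto simp: factor_hom_iff intro!: exI[of _ "g \<boxplus> neg f"])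
qed

lemma cl_self: "arr f \<Longrightarrow> f \<in> cl f"
  by (simp add: mem_cl)

lemma cl_eq_iff:
  assumes "arr f" "arr g"
  shows "cl f = cl g \<longleftrightarrow> src f = src g \<and> tgt f = tgt g \<and> null (f \<boxplus> neg g)"
proof
  assume "cl f = cl g"
  then show "src f = src g \<and> tgt f = tgt g \<and> null (f \<boxplus> neg g)"
    using cl_self[OF assms(1)] mem_cl[OF assms(2)] by simp
next
  assume *: "src f = src g \<and> tgt f = tgt g \<and> null (f \<boxplus> neg g)"
  have "null (x \<boxplus> neg f) \<longleftrightarrow> null (x \<boxplus> neg g)" if x: "arr x" "src x = src g" "tgt x = tgt g" for x
  proof
    have eq: "x \<boxplus> neg g = (x \<boxplus> neg f) \<boxplus> (f \<boxplus> neg g)"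
    proof -
      have "(x \<boxplus> neg f) \<boxplus> (f \<boxplus> neg g) = x \<boxplus> ((neg f \<boxplus> f) \<boxplus> neg g)"
        using x * assms by (simp add: add_assoc del: add_neg add_neg_cancel)
      then show ?thesis using x * assms by simp
    qed
    have eq': "x \<boxplus> neg f = (x \<boxplus> neg g) \<boxplus> neg (f \<boxplus> neg g)"
    proof -
      have "(x \<boxplus> neg g) \<boxplus> neg (f \<boxplus> neg g) = x \<boxplus> (neg f \<boxplus> (g \<boxplus> neg g))"
        using x * assms by (simp add: neg_add add_ac del: add_neg add_neg_cancel)
      then show ?thesis using x * assms by simp
    qed
    show "null (x \<boxplus> neg g)" if "null (x \<boxplus> neg f)"
      unfolding eq using that * assms x by (simp add: null_add )
    show "null (x \<boxplus> neg f)" if "null (x \<boxplus> neg g)"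
      unfolding eq' using that * assms x by (simp add: null_add null_neg)
  qed
  then show "cl f = cl g" using * assms by (auto simp: mem_cl)
qed

lemma cl_eqI:
  "arr f \<Longrightarrow> arr g \<Longrightarrow> src f = src g \<Longrightarrow> tgt f = tgt g \<Longrightarrow> null n \<Longrightarrow> f = g \<boxplus> n \<Longrightarrow> src n = src f
    \<Longrightarrow> tgt n = tgt f \<Longrightarrow> cl f = cl g"
  using eq_add_iff[of f g n] null_arr[of n] by (simp add: cl_eq_iff)

lemma cl_eqE:
  assumes "cl f = cl g" "arr f" "arr g"
  obtains n where "null n" "src n = src g" "tgt n = tgt g" "f = g \<boxplus> n" "src f = src g" "tgt f = tgt g"
proof (rule that[of "f \<boxplus> neg g"])
  have *: "src f = src g" "tgt f = tgt g" "null (f \<boxplus> neg g)" using cl_eq_iff[OF assms(2,3)] assms(1) by simp_all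
  then show "null (f \<boxplus> neg g)" "src (f \<boxplus> neg g) = src g" "tgt (f \<boxplus> neg g) = tgt g"
    "src f = src g" "tgt f = tgt g"
    using assms(2,3) by simp_all
  show "f = g \<boxplus> (f \<boxplus> neg g)" using assms(2,3) * by (simp add: add_ac)
qed

lemma Obj_Q [simp]: "Obj Q = \<A>"
  by (simp add: quotient_cat_def)

lemma Hom_Q:
  assumes "A \<in> \<A>" "B \<in> \<A>"
  shows "Hom Q A B = {cl f | f. arr f \<and> src f = A \<and> tgt f = B}"
  using assms
  by (auto simp: quotient_cat_def A_RCOSETS_def' cl_def mor_class_def in_Hom_iff)

lemma cl_in_Hom_Q: "arr f \<Longrightarrow> src f = A \<Longrightarrow> tgt f = B \<Longrightarrow> A \<in> \<A> \<Longrightarrow> B \<in> \<A> \<Longrightarrow> cl f \<in> Hom Q A B"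
  by (auto simp: Hom_Q)

lemma Id_Q [simp]: "A \<in> \<A> \<Longrightarrow> Id Q A = cl (Id C A)"
  by (simp add: quotient_cat_def cl_def)

lemma Zero_Q [simp]: assumes "A \<in> \<A>" "B \<in> \<A>" shows "Zero Q A B = cl (Zero C A B)"
  using assms by (auto simp: quotient_cat_def mem_cl factor_hom_iff null_arr)

lemma cl_Comp_cong:
  assumes "arr f" "arr g" "src g = tgt f" "cl f' = cl f" "cl g' = cl g" "arr f'" "arr g'"
  shows "cl (g' \<cdot> f') = cl (g \<cdot> f)"
proof -
  obtain m where m: "null m" "src m = src f" "tgt m = tgt f" "f' = f \<boxplus> m" "src f' = src f" "tgt f' = tgt f"
    using cl_eqE[OF assms(4,6,1)] .
  obtain n where n: "null n" "src n = src g" "tgt n = tgt g" "g' = g \<boxplus> n" "src g' = src g" "tgt g' = tgt g"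
    using cl_eqE[OF assms(5,7,2)] .
  note ar = null_arr[OF m(1)] null_arr[OF n(1)]
  have "g' \<cdot> f' = g \<cdot> f' \<boxplus> n \<cdot> f'" using n(1-4) assms m ar by (simp add: comp_add_left)
  also have "\<dots> = g \<cdot> f \<boxplus> (g \<cdot> m \<boxplus> n \<cdot> f')"
    using n(1-3) assms m(1-3,5,6) ar by (subst m(4)) (simp add: comp_add_right add_assoc)
  finally have *: "g' \<cdot> f' = g \<cdot> f \<boxplus> (g \<cdot> m \<boxplus> n \<cdot> f')" .
  have "null (g \<cdot> m \<boxplus> n \<cdot> f')"
    using m n assms ar by (intro null_add null_Comp_left null_Comp_right) simp_all
  then show ?thesis using cl_eqI[OF _ _ _ _ _ *] n(2,3,5,6) m(2,3,5,6) assms ar by simp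
qed

text \<open>By \<open>cl_Comp_cong\<close> all members of the union that defines composition are the
  same class, so composites can be computed on any representatives.\<close>

lemma Comp_Q:
  assumes "arr f" "arr g" "src g = tgt f" "src f \<in> \<A>" "tgt f \<in> \<A>" "tgt g \<in> \<A>"
  shows "cl g \<cdot>\<^bsub>Q\<^esub> cl f = cl (g \<cdot> f)"
proof -
  have "cl g \<cdot>\<^bsub>Q\<^esub> cl f = \<Union>{sub_class C \<A> \<X> A D (g' \<cdot> f') | A B D f' g'.
         A \<in> \<A> \<and> B \<in> \<A> \<and> D \<in> \<A> \<and> f' \<in> cl f \<inter> Hom C A B \<and> g' \<in> cl g \<inter> Hom C B D}"
    by (simp add: quotient_cat_def)
  also have "\<dots> = cl (g \<cdot> f)"
  proof (rule Union_singleton_class)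
    show "{sub_class C \<A> \<X> A D (g' \<cdot> f') | A B D f' g'.
         A \<in> \<A> \<and> B \<in> \<A> \<and> D \<in> \<A> \<and> f' \<in> cl f \<inter> Hom C A B \<and> g' \<in> cl g \<inter> Hom C B D} \<noteq> {}"
    proof -
      have "f \<in> cl f \<inter> Hom C (src f) (tgt f)" "g \<in> cl g \<inter> Hom C (tgt f) (tgt g)"
        using assms arr_in_Hom[of f] arr_in_Hom[of g] cl_self by auto
      then show ?thesis using assms(4-6) by blast
    qed
    fix x assume "x \<in> {sub_class C \<A> \<X> A D (g' \<cdot> f') | A B D f' g'.
         A \<in> \<A> \<and> B \<in> \<A> \<and> D \<in> \<A> \<and> f' \<in> cl f \<inter> Hom C A B \<and> g' \<in> cl g \<inter> Hom C B D}"
    then obtain A B D f' g' where x: "x = sub_class C \<A> \<X> A D (g' \<cdot> f')" "A \<in> \<A>" "B \<in> \<A>" "D \<in> \<A>"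
      "f' \<in> cl f" "g' \<in> cl g" "f' \<in> Hom C A B" "g' \<in> Hom C B D"
      by blast
    have *: "arr f'" "src f' = A" "tgt f' = B" "arr g'" "src g' = B" "tgt g' = D"
      using x(2-4,7,8) by (simp_all add: in_Hom_iff)
    then have "cl f' = cl f" "cl g' = cl g" using x(5,6) assms by (simp_all add: mem_cl cl_eq_iff)
    then have "cl (g' \<cdot> f') = cl (g \<cdot> f)" using cl_Comp_cong[of f g f' g'] assms * by simp
    then show "x = cl (g \<cdot> f)" using * x(1) by (simp add: cl_def)
  qed
  finally show ?thesis .
qed

lemma Add_Q:
  assumes "arr f" "arr g" "src g = src f" "tgt g = tgt f"
  shows "Add Q (cl f) (cl g) = cl (f \<boxplus> g)"
proof -
  have "x \<in> cl (f \<boxplus> g)" if "x = f' \<boxplus> g'" "f' \<in> cl f" "g' \<in> cl g" for x f' g'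
  proof -
    have *: "arr f'" "src f' = src f" "tgt f' = tgt f" "arr g'" "src g' = src f" "tgt g' = tgt f"
      "null (f' \<boxplus> neg f)" "null (g' \<boxplus> neg g)"
      using that assms by (simp_all add: mem_cl)
    have "(f' \<boxplus> g') \<boxplus> neg (f \<boxplus> g) = (f' \<boxplus> neg f) \<boxplus> (g' \<boxplus> neg g)"
      using * assms by (simp add: neg_add add_ac)
    moreover have "null \<dots>" using * assms by (simp add: null_add)
    ultimately show ?thesis using that * assms by (simp add: mem_cl)
  qed
  moreover have "\<exists>f' g'. x = f' \<boxplus> g' \<and> f' \<in> cl f \<and> g' \<in> cl g" if "x \<in> cl (f \<boxplus> g)" for x
  proof -
    have x: "arr x" "src x = src f" "tgt x = tgt f" "null (x \<boxplus> neg (f \<boxplus> g))"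
      using that assms by (simp_all add: mem_cl)
    \<comment> \<open>The whole deviation of \<open>x\<close> from \<open>f \<boxplus> g\<close> is
      put into the first summand; the second is \<open>g\<close> itself.\<close>
    let ?f = "x \<boxplus> neg g"
    have "?f \<boxplus> g = x" "?f \<boxplus> neg f = x \<boxplus> neg (f \<boxplus> g)"
      using x assms by (simp_all add: add_assoc neg_add) (simp add: add_ac)
    then show ?thesis using x assms by (intro exI[of _ ?f] exI[of _ g]) (simp add: mem_cl)
  qed
  ultimately show ?thesis by (auto simp: quotient_cat_def)
qed

lemma Q_homE:
  assumes "\<phi> \<in> Hom Q A B" "A \<in> \<A>" "B \<in> \<A>"
  obtains f where "arr f" "src f = A" "tgt f = B" "\<phi> = cl f"
  using assms by (auto simp: Hom_Q)

lemma category_Q: "category Q"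
proof
  fix A assume "A \<in> Obj Q"
  then show "Id Q A \<in> Hom Q A A" by (simp add: cl_in_Hom_Q)
next
  fix A B D \<phi> \<psi> assume *: "A \<in> Obj Q" "B \<in> Obj Q" "D \<in> Obj Q" "\<phi> \<in> Hom Q A B" "\<psi> \<in> Hom Q B D"
  then obtain f where "arr f" "src f = A" "tgt f = B" "\<phi> = cl f" by (auto elim: Q_homE)
  moreover obtain g where "arr g" "src g = B" "tgt g = D" "\<psi> = cl g" using * by (auto elim: Q_homE)
  ultimately show "\<psi> \<cdot>\<^bsub>Q\<^esub> \<phi> \<in> Hom Q A D" using * by (simp add: Comp_Q cl_in_Hom_Q)
next
  fix A B \<phi> assume *: "A \<in> Obj Q" "B \<in> Obj Q" "\<phi> \<in> Hom Q A B"
  then obtain f where "arr f" "src f = A" "tgt f = B" "\<phi> = cl f" by (auto elim: Q_homE)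
  then show "\<phi> \<cdot>\<^bsub>Q\<^esub> Id Q A = \<phi>" "Id Q B \<cdot>\<^bsub>Q\<^esub> \<phi> = \<phi>" using * by (simp_all add: Comp_Q)
next
  fix A B D E \<phi> \<psi> \<chi>
  assume *: "A \<in> Obj Q" "B \<in> Obj Q" "D \<in> Obj Q" "E \<in> Obj Q"
    "\<phi> \<in> Hom Q A B" "\<psi> \<in> Hom Q B D" "\<chi> \<in> Hom Q D E"
  then obtain f where "arr f" "src f = A" "tgt f = B" "\<phi> = cl f" by (auto elim: Q_homE)
  moreover obtain g where "arr g" "src g = B" "tgt g = D" "\<psi> = cl g" using * by (auto elim: Q_homE)
  moreover obtain h where "arr h" "src h = D" "tgt h = E" "\<chi> = cl h" using * by (auto elim: Q_homE)
  ultimately show "(\<chi> \<cdot>\<^bsub>Q\<^esub> \<psi>) \<cdot>\<^bsub>Q\<^esub> \<phi> = \<chi> \<cdot>\<^bsub>Q\<^esub> (\<psi> \<cdot>\<^bsub>Q\<^esub> \<phi>)"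
    using * by (simp add: Comp_Q comp_assoc)
next
  fix A B A' B' \<phi>
  assume *: "A \<in> Obj Q" "B \<in> Obj Q" "A' \<in> Obj Q" "B' \<in> Obj Q" "\<phi> \<in> Hom Q A B" "\<phi> \<in> Hom Q A' B'"
  then obtain f where f: "arr f" "src f = A" "tgt f = B" "\<phi> = cl f" by (auto elim: Q_homE)
  obtain f' where f': "arr f'" "src f' = A'" "tgt f' = B'" "\<phi> = cl f'" using * by (auto elim: Q_homE)
  show "A = A' \<and> B = B'" using cl_eq_iff[of f f'] f f' by simp
qed

lemma preadditive_Q: "preadditive_category Q"
proof -
  show ?thesis
  proof (intro preadditive_category.intro preadditive_category_axioms.intro category_Q)
    fix A B assume AB: "A \<in> Obj Q" "B \<in> Obj Q"
    let ?G = "hom_group Q A B"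
    have G: "carrier ?G = Hom Q A B" "zero ?G = cl (Zero C A B)" "ring.add ?G = Add Q"
      using AB by (simp_all add: hom_group_def)
    show "abelian_group ?G"
    proof (rule abelian_groupI; unfold G)
      show "cl (Zero C A B) \<in> Hom Q A B" using AB by (simp add: cl_in_Hom_Q)
    next
      fix \<phi> \<psi> assume *: "\<phi> \<in> Hom Q A B" "\<psi> \<in> Hom Q A B"
      then obtain f where f: "arr f" "src f = A" "tgt f = B" "\<phi> = cl f" using AB by (auto elim: Q_homE)
      obtain g where g: "arr g" "src g = A" "tgt g = B" "\<psi> = cl g" using * AB by (auto elim: Q_homE)
      show "Add Q \<phi> \<psi> \<in> Hom Q A B" using f g AB by (simp add: Add_Q cl_in_Hom_Q)
      show "Add Q \<phi> \<psi> = Add Q \<psi> \<phi>" using f g add_commute[of f g] by (simp add: Add_Q)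
    next
      fix \<phi> \<psi> \<chi> assume *: "\<phi> \<in> Hom Q A B" "\<psi> \<in> Hom Q A B" "\<chi> \<in> Hom Q A B"
      obtain f where f: "arr f" "src f = A" "tgt f = B" "\<phi> = cl f" using * AB by (auto elim: Q_homE)
      obtain g where g: "arr g" "src g = A" "tgt g = B" "\<psi> = cl g" using * AB by (auto elim: Q_homE)
      obtain h where "arr h" "src h = A" "tgt h = B" "\<chi> = cl h" using * AB by (auto elim: Q_homE)
      then show "Add Q (Add Q \<phi> \<psi>) \<chi> = Add Q \<phi> (Add Q \<psi> \<chi>)" using f g by (simp add: Add_Q add_assoc)
    next
      fix \<phi> assume "\<phi> \<in> Hom Q A B"
      then obtain f where f: "arr f" "src f = A" "tgt f = B" "\<phi> = cl f" using AB by (auto elim: Q_homE)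
      then show "Add Q (cl (Zero C A B)) \<phi> = \<phi>" using AB by (simp add: Add_Q)
      have "cl (neg f) \<in> Hom Q A B" "Add Q (cl (neg f)) \<phi> = cl (Zero C A B)"
        using f AB by (simp_all add: cl_in_Hom_Q Add_Q)
      then show "\<exists>\<psi> \<in> Hom Q A B. Add Q \<psi> \<phi> = cl (Zero C A B)" by blast
    qed
  next
    fix A B D \<phi> \<phi>' \<psi>
    assume *: "A \<in> Obj Q" "B \<in> Obj Q" "D \<in> Obj Q"
      "\<phi> \<in> Hom Q A B" "\<phi>' \<in> Hom Q A B" "\<psi> \<in> Hom Q B D"
    then obtain f where "arr f" "src f = A" "tgt f = B" "\<phi> = cl f" by (auto elim: Q_homE)
    moreover obtain f' where "arr f'" "src f' = A" "tgt f' = B" "\<phi>' = cl f'" using * by (auto elim: Q_homE)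
    moreover obtain g where "arr g" "src g = B" "tgt g = D" "\<psi> = cl g" using * by (auto elim: Q_homE)
    ultimately show "\<psi> \<cdot>\<^bsub>Q\<^esub> Add Q \<phi> \<phi>' = Add Q (\<psi> \<cdot>\<^bsub>Q\<^esub> \<phi>) (\<psi> \<cdot>\<^bsub>Q\<^esub> \<phi>')"
      using * by (simp add: Comp_Q Add_Q comp_add_right)
  next
    fix A B D \<phi> \<psi> \<psi>'
    assume *: "A \<in> Obj Q" "B \<in> Obj Q" "D \<in> Obj Q"
      "\<phi> \<in> Hom Q A B" "\<psi> \<in> Hom Q B D" "\<psi>' \<in> Hom Q B D"
    then obtain f where "arr f" "src f = A" "tgt f = B" "\<phi> = cl f" by (auto elim: Q_homE)
    moreover obtain g' where "arr g'" "src g' = B" "tgt g' = D" "\<psi>' = cl g'" using * by (auto elim: Q_homE)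
    moreover obtain g where "arr g" "src g = B" "tgt g = D" "\<psi> = cl g" using * by (auto elim: Q_homE)
    ultimately show "Add Q \<psi> \<psi>' \<cdot>\<^bsub>Q\<^esub> \<phi> = Add Q (\<psi> \<cdot>\<^bsub>Q\<^esub> \<phi>) (\<psi>' \<cdot>\<^bsub>Q\<^esub> \<phi>)"
      using * by (simp add: Comp_Q Add_Q comp_add_left)
  qed
qed

end

sublocale subfactor_category \<subseteq> Q: preadditive_category "subfactor C \<A> \<X>"
  by (rule preadditive_Q)

context subfactor_category
begin

lemma Q_arr_cl [simp]:
  assumes "arr f" "src f \<in> \<A>" "tgt f \<in> \<A>"
  shows "Q.arr (cl f)" "Q.src (cl f) = src f" "Q.tgt (cl f) = tgt f"
  using cl_in_Hom_Q[OF assms(1) refl refl] Q.in_Hom_iff[of "src f" "tgt f" "cl f"] assms by simp_all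

lemma Q_arrE:
  assumes "Q.arr \<phi>"
  obtains f where "arr f" "src f = Q.src \<phi>" "tgt f = Q.tgt \<phi>" "\<phi> = cl f" "src f \<in> \<A>" "tgt f \<in> \<A>"
proof -
  have "Q.src \<phi> \<in> \<A>" "Q.tgt \<phi> \<in> \<A>" using Q.arr_ends[OF assms] by simp_all
  with Q.arr_in_Hom[OF assms] that show thesis by (metis Q_homE)
qed

lemma neg_Q [simp]:
  assumes "arr f" "src f \<in> \<A>" "tgt f \<in> \<A>" shows "Q.neg (cl f) = cl (neg f)"
  using Q.neg_unique[of "cl f" "cl (neg f)"] assms by (simp add: Add_Q)

lemma Q_zero_object: assumes "zero_object C Z" shows "zero_object Q Z"
proof -
  have Z: "Z \<in> \<A>" by (rule zero_object_\<A>[OF assms])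
  have "\<phi> \<in> Hom Q Z A \<longleftrightarrow> \<phi> = cl (Zero C Z A)" if "A \<in> \<A>" for A \<phi>
    unfolding Hom_Q[OF Z that] using zero_object_arr[OF assms] Z that by auto
  moreover have "\<phi> \<in> Hom Q A Z \<longleftrightarrow> \<phi> = cl (Zero C A Z)" if "A \<in> \<A>" for A \<phi>
    unfolding Hom_Q[OF that Z] using zero_object_arr[OF assms] Z that by auto
  ultimately show ?thesis using Z unfolding zero_object_def by simp
qed

lemma additive_Q: "additive_category Q"
proof
  show "\<exists>Z. zero_object Q Z" using ex_zero_object Q_zero_object by blast
  fix A B assume AB: "A \<in> Obj Q" "B \<in> Obj Q"
  then obtain D where D: "direct_sum C A B D" using ex_direct_sum by force
  then obtain i j p q where d: "D \<in> Obj C"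
    "arr i" "src i = A" "tgt i = D" "arr j" "src j = B" "tgt j = D"
    "arr p" "src p = D" "tgt p = A" "arr q" "src q = D" "tgt q = B"
    "p \<cdot> i = Id C A" "q \<cdot> j = Id C B" "q \<cdot> i = Zero C A B" "p \<cdot> j = Zero C B A"
    "i \<cdot> p \<boxplus> j \<cdot> q = Id C D"
    by (elim direct_sumE)
  have "D \<in> \<A>" using direct_sum_\<A>[OF D] AB by simp
  then have "direct_sum Q A B D"
    using d AB by (intro Q.direct_sumI[of A B D "cl i" "cl j" "cl p" "cl q"]) (simp_all add: Comp_Q Add_Q)
  then show "\<exists>D. direct_sum Q A B D" by blast
qed

lemma cl_isomorphism:
  assumes "isomorphism C A B f" "A \<in> \<A>" shows "isomorphism Q A B (cl f)"
proof -
  obtain g where g: "A \<in> Obj C" "B \<in> Obj C" "arr f" "src f = A" "tgt f = B"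
    "arr g" "src g = B" "tgt g = A" "g \<cdot> f = Id C A" "f \<cdot> g = Id C B"
    using assms by (elim isomorphismE)
  have "B \<in> \<A>" using \<A>_iso assms by blast
  then show ?thesis using Q.isomorphismI[of "cl f" "cl g"] g assms by (simp add: Comp_Q)
qed

end


section \<open>Right triangles in a subfactor category\<close>

text \<open>Triangles \<open>A \<rightarrow> B \<rightarrow> D\<close> with maps \<open>f\<close>, \<open>g\<close> carry an element \<open>e\<close> of a bimodule \<open>E D A\<close>, which for
  a triangulated category is \<open>Hom D (A[1])\<close>; the two actions are \<open>L u e = u[1] \<cdot> e\<close> and \<open>R e v = e \<cdot> v\<close>.
  In contrast to the shift, which need not be invertible, this presentation is self-dual: in the
  opposite category \<open>E\<close> has its arguments swapped, \<open>L\<close> and \<open>R\<close> are exchanged, and triangles are reversed.\<close>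

locale cone_category = additive_category C
  for C :: "('o, 'm, 'z) cat_scheme" (structure) +
  fixes E :: "'o \<Rightarrow> 'o \<Rightarrow> 'm set" and L R :: "'m \<Rightarrow> 'm \<Rightarrow> 'm" and N :: "'o \<Rightarrow> 'o \<Rightarrow> 'm"
    and \<Delta> :: "('o, 'm) sextuple set"
  assumes tri_iff: "(A, B, D, f, g, e) \<in> \<Delta> \<Longrightarrow> A \<in> Obj C \<and> B \<in> Obj C \<and> D \<in> Obj C \<and>
      arr f \<and> src f = A \<and> tgt f = B \<and> arr g \<and> src g = B \<and> tgt g = D \<and> e \<in> E D A"
    and L_in: "\<lbrakk>arr u; D \<in> Obj C; e \<in> E D (src u)\<rbrakk> \<Longrightarrow> L u e \<in> E D (tgt u)"
    and R_in: "\<lbrakk>arr v; A \<in> Obj C; e \<in> E (tgt v) A\<rbrakk> \<Longrightarrow> R e v \<in> E (src v) A"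
    and L_Id: "\<lbrakk>A \<in> Obj C; D \<in> Obj C; e \<in> E D A\<rbrakk> \<Longrightarrow> L (Id C A) e = e"
    and R_Id: "\<lbrakk>A \<in> Obj C; D \<in> Obj C; e \<in> E D A\<rbrakk> \<Longrightarrow> R e (Id C D) = e"
    and L_Comp: "\<lbrakk>arr u; arr u'; src u' = tgt u; D \<in> Obj C; e \<in> E D (src u)\<rbrakk>
      \<Longrightarrow> L (u' \<cdot> u) e = L u' (L u e)"
    and R_Comp: "\<lbrakk>arr v; arr v'; src v = tgt v'; A \<in> Obj C; e \<in> E (tgt v) A\<rbrakk>
      \<Longrightarrow> R e (v \<cdot> v') = R (R e v) v'"
    and L_R: "\<lbrakk>arr u; arr v; e \<in> E (tgt v) (src u)\<rbrakk> \<Longrightarrow> L u (R e v) = R (L u e) v"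
    and L_R_add: "\<lbrakk>arr u; arr u'; src u' = src u; tgt u' = tgt u; arr v; arr v'; src v' = src v; tgt v' = tgt v;
        e \<in> E (src v) (src u); e' \<in> E (tgt v) (tgt u); L u e = R e' v; L u' e = R e' v'\<rbrakk>
      \<Longrightarrow> L (u \<boxplus> u') e = R e' (v \<boxplus> v')"
    and R_Zero: "\<lbrakk>A \<in> Obj C; D \<in> Obj C; D' \<in> Obj C; e \<in> E D A\<rbrakk> \<Longrightarrow> R e (Zero C D' D) = N D' A"
    and tri_embed: "arr f \<Longrightarrow> \<exists>D g e. (src f, tgt f, D, f, g, e) \<in> \<Delta>"
    and tri_fill: "\<lbrakk>(A, B, D, f, g, e) \<in> \<Delta>; (A', B', D', f', g', e') \<in> \<Delta>;
        arr a; src a = A; tgt a = A'; arr b; src b = B; tgt b = B'; b \<cdot> f = f' \<cdot> a\<rbrakk>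
      \<Longrightarrow> \<exists>c. arr c \<and> src c = D \<and> tgt c = D' \<and> c \<cdot> g = g' \<cdot> b \<and> L a e = R e' c"
    and tri_middle: "\<lbrakk>(A, B, D, f, g, e) \<in> \<Delta>; (A, B', D, f', g', e) \<in> \<Delta>\<rbrakk>
      \<Longrightarrow> \<exists>b. arr b \<and> src b = B \<and> tgt b = B' \<and> b \<cdot> f = f' \<and> g' \<cdot> b = g"
    and tri_split: "\<lbrakk>A \<in> Obj C; B \<in> Obj C; D \<in> Obj C;
        arr i; src i = A; tgt i = D; arr j; src j = B; tgt j = D;
        arr p; src p = D; tgt p = A; arr q; src q = D; tgt q = B;
        p \<cdot> i = Id C A; q \<cdot> j = Id C B; q \<cdot> i = Zero C A B; p \<cdot> j = Zero C B A;
        i \<cdot> p \<boxplus> j \<cdot> q = Id C D\<rbrakk> \<Longrightarrow> \<exists>e. (A, D, B, i, q, e) \<in> \<Delta>"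
    and tri_exact_middle: "\<lbrakk>(A, B, D, f, g, e) \<in> \<Delta>; arr u; tgt u = B; g \<cdot> u = Zero C (src u) D\<rbrakk>
      \<Longrightarrow> \<exists>v. arr v \<and> src v = src u \<and> tgt v = A \<and> u = f \<cdot> v"
    and tri_coexact_middle: "\<lbrakk>(A, B, D, f, g, e) \<in> \<Delta>; arr u; src u = B; u \<cdot> f = Zero C A (tgt u)\<rbrakk>
      \<Longrightarrow> \<exists>v. arr v \<and> src v = D \<and> tgt v = tgt u \<and> u = v \<cdot> g"
    and tri_exact_right: "\<lbrakk>(A, B, D, f, g, e) \<in> \<Delta>; arr u; arr u'; tgt u = D; tgt u' = D; src u' = src u;
        R e u = R e u'\<rbrakk>
      \<Longrightarrow> \<exists>v. arr v \<and> src v = src u \<and> tgt v = B \<and> u = u' \<boxplus> g \<cdot> v"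
    and tri_coexact_left: "\<lbrakk>(A, B, D, f, g, e) \<in> \<Delta>; arr u; src u = A\<rbrakk>
      \<Longrightarrow> L u e = N D (tgt u) \<longleftrightarrow> (\<exists>v. arr v \<and> src v = B \<and> tgt v = tgt u \<and> u = v \<cdot> f)"
    and tri_octahedron: "\<lbrakk>(A, B, D, f, g, e) \<in> \<Delta>; (B, X, Y, a, b, e') \<in> \<Delta>; (A, X, Z, a \<cdot> f, d, e'') \<in> \<Delta>\<rbrakk>
      \<Longrightarrow> \<exists>s t. arr s \<and> src s = D \<and> tgt s = Z \<and> arr t \<and> src t = Z \<and> tgt t = Y \<and>
            s \<cdot> g = d \<cdot> a \<and> R e'' s = e \<and> t \<cdot> d = b \<and> R e' t = L f e'' \<and>
            (D, Z, Y, s, t, L g e') \<in> \<Delta>"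
    and tri_octahedron': "\<lbrakk>(A, M, D, f, g, e) \<in> \<Delta>; (B, M, X, i, q, e') \<in> \<Delta>; (A, X, Z, q \<cdot> f, d, e'') \<in> \<Delta>\<rbrakk>
      \<Longrightarrow> \<exists>k \<epsilon>. arr k \<and> src k = D \<and> tgt k = Z \<and> k \<cdot> g = d \<cdot> q \<and> R e'' k = e \<and> L i \<epsilon> = L f e'' \<and>
            (B, D, Z, g \<cdot> i, neg k, \<epsilon>) \<in> \<Delta>"
begin

text \<open>Middle maps exist in both directions. Their composites fix the two outer maps, so by
  exactness they differ from the identity by a map through the first one and are unipotent.\<close>

lemma tri_middle_iso:
  assumes t: "(A, B, D, f, g, e) \<in> \<Delta>" and t': "(A, B', D, f', g', e) \<in> \<Delta>"
  shows "\<exists>b. isomorphism C B B' b \<and> b \<cdot> f = f' \<and> g' \<cdot> b = g"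
proof -
  have endo: "isomorphism C B B b"
    if t: "(A, B, D, f, g, e) \<in> \<Delta>" and b: "arr b" "src b = B" "tgt b = B" "b \<cdot> f = f" "g \<cdot> b = g"
    for B f g b
  proof -
    have "g \<cdot> (b \<boxplus> neg (Id C B)) = Zero C B D"
      using tri_iff[OF t] b by (simp add: comp_add_right)
    then obtain v where v: "arr v" "src v = B" "tgt v = A" "b \<boxplus> neg (Id C B) = f \<cdot> v"
      using tri_exact_middle[OF t, of "b \<boxplus> neg (Id C B)"] tri_iff[OF t] b by auto
    then have "b = Id C B \<boxplus> f \<cdot> v" using eq_add_iff[of b "Id C B" "f \<cdot> v"] tri_iff[OF t] b(1-3) by simp
    then show ?thesis using isomorphism_if_fixes_left[of b B f v] tri_iff[OF t] b v by simp
  qed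
  obtain b where b: "arr b" "src b = B" "tgt b = B'" "b \<cdot> f = f'" "g' \<cdot> b = g"
    using tri_middle[OF t t'] by blast
  obtain b' where b': "arr b'" "src b' = B'" "tgt b' = B" "b' \<cdot> f' = f" "g \<cdot> b' = g'"
    using tri_middle[OF t' t] by blast
  have "isomorphism C B B (b' \<cdot> b)" "isomorphism C B' B' (b \<cdot> b')"
    using endo[OF t, of "b' \<cdot> b"] endo[OF t', of "b \<cdot> b'"] tri_iff[OF t] tri_iff[OF t'] b b'
    by (simp_all add: comp_assoc comp_reassoc[OF b(5)] comp_reassoc[OF b'(5)])
  then show ?thesis using isomorphism_if_one_sided[of b B B' b' b'] b b' by blast
qed

text \<open>A morphism of triangles whose last square is expressed in E. For a triangulated category
  \<open>L a e = R e' c\<close> is the usual compatibility of connecting maps, and this form also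
  makes sense in the opposite category.\<close>

definition ext_mor :: "('o, 'm) sextuple \<Rightarrow> ('o, 'm) sextuple \<Rightarrow> 'm \<Rightarrow> 'm \<Rightarrow> 'm \<Rightarrow> bool" where
  "ext_mor s s' a b c \<longleftrightarrow> (case (s, s') of ((A, B, D, f, g, e), (A', B', D', f', g', e')) \<Rightarrow>
     a \<in> Hom C A A' \<and> b \<in> Hom C B B' \<and> c \<in> Hom C D D' \<and>
     b \<cdot> f = f' \<cdot> a \<and> c \<cdot> g = g' \<cdot> b \<and> L a e = R e' c)"

end

section \<open>Approximation triangles, relative monics and the suspension functor\<close>

locale suspended_category = cone_category C E L R N \<Delta> + subfactor_category C \<A> \<X>
  for C :: "('o, 'm, 'z) cat_scheme" (structure) and E L R N \<Delta> \<A> \<X> +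
  fixes \<tau> :: "('o, 'm) triangle_choice"
  assumes cones_\<A>: "monics_have_cones C \<Delta> \<A> \<X>"
    and choice: "right_choice C \<Delta> \<A> \<X> \<tau>"
begin

abbreviation "\<Sigma> \<equiv> outer \<tau>"
abbreviation "\<alpha> \<equiv> map1 \<tau>"
abbreviation "\<beta> \<equiv> map2 \<tau>"
abbreviation "\<gamma> \<equiv> map3 \<tau>"

definition monic :: "'m \<Rightarrow> bool" where
  "monic f \<longleftrightarrow> arr f \<and> (\<forall>u. arr u \<and> src u = src f \<and> tgt u \<in> \<X> \<longrightarrow>
     (\<exists>v. arr v \<and> src v = tgt f \<and> tgt v = tgt u \<and> u = v \<cdot> f))"

lemma monicD:
  assumes "monic f" "arr u" "src u = src f" "tgt u \<in> \<X>"
  shows "\<exists>v. arr v \<and> src v = tgt f \<and> tgt v = tgt u \<and> u = v \<cdot> f"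
  using assms unfolding monic_def by blast

lemma monic_iff_monic_wrt:
  assumes "A \<in> Obj C" "B \<in> Obj C" "f \<in> Hom C A B"
  shows "monic_wrt C \<X> A B f \<longleftrightarrow> monic f"
proof -
  have f: "arr f" "src f = A" "tgt f = B" using assms by (simp_all add: in_Hom_iff)
  have eq: "(\<lambda>u. u \<cdot> f) ` Hom C B X = Hom C A X \<longleftrightarrow>
      (\<forall>u. arr u \<and> src u = A \<and> tgt u = X \<longrightarrow> (\<exists>v. arr v \<and> src v = B \<and> tgt v = X \<and> u = v \<cdot> f))"
    if "X \<in> \<X>" for X
  proof -
    have X: "X \<in> Obj C" using that by simp
    have "(\<lambda>u. u \<cdot> f) ` Hom C B X \<subseteq> Hom C A X" using f assms X by (auto simp: in_Hom_iff)
    then have "(\<lambda>u. u \<cdot> f) ` Hom C B X = Hom C A X \<longleftrightarrow> (\<forall>u \<in> Hom C A X. \<exists>v \<in> Hom C B X. u = v \<cdot> f)"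
      by blast
    then show ?thesis using assms X in_Hom_iff[of A X] in_Hom_iff[of B X] by (metis (full_types))
  qed
  show ?thesis
    unfolding monic_wrt_def monic_def using assms(3) f by (simp add: eq cong: ball_cong) blast
qed

lemma choice_facts:
  assumes "A \<in> \<A>"
  shows choice_tri: "(A, mid \<tau> A, \<Sigma> A, \<alpha> A, \<beta> A, \<gamma> A) \<in> \<Delta>"
    and mid_\<X> [simp]: "mid \<tau> A \<in> \<X>"
    and monic_\<alpha>: "monic (\<alpha> A)"
proof -
  show t: "(A, mid \<tau> A, \<Sigma> A, \<alpha> A, \<beta> A, \<gamma> A) \<in> \<Delta>" and X: "mid \<tau> A \<in> \<X>"
    using choice assms unfolding right_choice_def right_tri_def left_approximation_def by simp_all
  have "monic_wrt C \<X> A (mid \<tau> A) (\<alpha> A)"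
    using choice assms unfolding right_choice_def left_approximation_def monic_wrt_def by simp
  then show "monic (\<alpha> A)"
    using monic_iff_monic_wrt[of A "mid \<tau> A" "\<alpha> A"] tri_iff[OF t] by (simp add: in_Hom_iff)
qed

lemma cone_in_\<A>:
  assumes "(A, B, D, f, g, e) \<in> \<Delta>" "monic f" "A \<in> \<A>" "B \<in> \<A>" shows "D \<in> \<A>"
proof -
  have "monic_wrt C \<X> A B f"
    using monic_iff_monic_wrt[of A B f] tri_iff[OF assms(1)] assms by (simp add: in_Hom_iff)
  then show ?thesis using cones_\<A> assms unfolding monics_have_cones_def by blast
qed

lemma choice_typing [simp]:
  assumes "A \<in> \<A>"
  shows "mid \<tau> A \<in> \<A>" "\<Sigma> A \<in> \<A>" "arr (\<alpha> A)" "src (\<alpha> A) = A" "tgt (\<alpha> A) = mid \<tau> A"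
    "arr (\<beta> A)" "src (\<beta> A) = mid \<tau> A" "tgt (\<beta> A) = \<Sigma> A" "\<gamma> A \<in> E (\<Sigma> A) A"
  using tri_iff[OF choice_tri[OF assms]] cone_in_\<A>[OF choice_tri monic_\<alpha>] assms
  by (simp_all add: \<X>_\<A>)

text \<open>By exactness at \<open>\<Sigma> A\<close>, maps with the same effect on
  \<open>\<gamma> A\<close> differ by a map through \<open>mid \<tau> A\<close>, an object of
  \<X>.\<close>

lemma cl_eq_if_R_eq:
  assumes "arr h" "arr h'" "src h' = src h" "A \<in> \<A>" "tgt h = \<Sigma> A" "tgt h' = \<Sigma> A"
    "R (\<gamma> A) h = R (\<gamma> A) h'"
  shows "cl h = cl h'"
proof -
  obtain v where v: "arr v" "src v = src h" "tgt v = mid \<tau> A" "h = h' \<boxplus> \<beta> A \<cdot> v"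
    using tri_exact_right[OF choice_tri[OF assms(4)] assms(1,2,5,6,3,7)] by blast
  show ?thesis
    by (rule cl_eqI[OF assms(1,2) _ _ nullI v(4)]) (use v(1-3) assms in simp_all)
qed

text \<open>The first factor of \<open>n\<close> ends in \<X>, so it extends along the approximation
  \<open>\<alpha> A\<close>. Then \<open>n\<close> itself extends along \<open>\<alpha> A\<close>,
  and coexactness sends \<open>\<gamma> A\<close> to the zero \<open>N\<close> of E.\<close>

lemma L_null:
  assumes "null n" "src n = A" "A \<in> \<A>" shows "L n (\<gamma> A) = N (\<Sigma> A) (tgt n)"
proof -
  obtain u v where u: "arr u" "arr v" "src u = src n" "tgt u \<in> \<X>" "src v = tgt u" "tgt v = tgt n" "n = v \<cdot> u"
    using assms(1) by (rule nullE)
  obtain w where w: "arr w" "src w = mid \<tau> A" "tgt w = tgt u" "u = w \<cdot> \<alpha> A"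
    using monicD[OF monic_\<alpha>[OF assms(3)], of u] u(1-6) assms(2,3) by auto
  have "n = (v \<cdot> w) \<cdot> \<alpha> A" unfolding u(7) w(4) using u(1-6) w(1-3) assms by (simp add: comp_assoc)
  moreover have "arr (v \<cdot> w)" "src (v \<cdot> w) = mid \<tau> A" "tgt (v \<cdot> w) = tgt n"
    using u(1-6) w(1-3) by simp_all
  ultimately show ?thesis
    using tri_coexact_left[OF choice_tri[OF assms(3)] null_arr[OF assms(1)] assms(2)] by blast
qed

lemma suspension_exists:
  assumes "arr f" "src f = A" "tgt f = A'" "A \<in> \<A>" "A' \<in> \<A>"
  shows "\<exists>g h. arr g \<and> src g = mid \<tau> A \<and> tgt g = mid \<tau> A' \<and> arr h \<and> src h = \<Sigma> A \<and> tgt h = \<Sigma> A' \<and>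
    g \<cdot> \<alpha> A = \<alpha> A' \<cdot> f \<and> h \<cdot> \<beta> A = \<beta> A' \<cdot> g \<and> L f (\<gamma> A) = R (\<gamma> A') h"
proof -
  obtain g where g: "arr g" "src g = mid \<tau> A" "tgt g = mid \<tau> A'" "\<alpha> A' \<cdot> f = g \<cdot> \<alpha> A"
    using monicD[OF monic_\<alpha>[OF assms(4)], of "\<alpha> A' \<cdot> f"] assms by auto
  then show ?thesis
    using tri_fill[OF choice_tri[OF assms(4)] choice_tri[OF assms(5)] assms(1-3) g(1-3)] by auto
qed

text \<open>Null maps act as zero on \<open>\<gamma> A\<close>. By \<open>L_R_add\<close>,
  \<open>h'\<close> plus a zero map is therefore a lift for \<open>f\<close> as well, so
  \<open>h\<close> and \<open>h'\<close> lift the same element along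
  \<open>\<gamma> A'\<close>.\<close>

lemma suspension_cong:
  assumes "cl f = cl f'" "arr f" "arr f'" "src f = A" "tgt f = A'" "A \<in> \<A>" "A' \<in> \<A>"
    and "arr h" "src h = \<Sigma> A" "tgt h = \<Sigma> A'" "L f (\<gamma> A) = R (\<gamma> A') h"
    and "arr h'" "src h' = \<Sigma> A" "tgt h' = \<Sigma> A'" "L f' (\<gamma> A) = R (\<gamma> A') h'"
  shows "cl h = cl h'"
proof -
  obtain n where n: "null n" "src n = src f'" "tgt n = tgt f'" "f = f' \<boxplus> n" "src f = src f'" "tgt f = tgt f'"
    using assms(1-3) by (rule cl_eqE)
  have "L n (\<gamma> A) = R (\<gamma> A') (Zero C (\<Sigma> A) (\<Sigma> A'))"
    using L_null[OF n(1), of A] n(2,3,5,6) assms R_Zero[of A' "\<Sigma> A'" "\<Sigma> A" "\<gamma> A'"] by simp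
  then have "L (f' \<boxplus> n) (\<gamma> A) = R (\<gamma> A') (h' \<boxplus> Zero C (\<Sigma> A) (\<Sigma> A'))"
    using L_R_add[of f' n h' "Zero C (\<Sigma> A) (\<Sigma> A')" "\<gamma> A" "\<gamma> A'"] n(1-3,5,6) null_arr[OF n(1)] assms
    by simp
  then have "R (\<gamma> A') h = R (\<gamma> A') h'" using assms unfolding n(4)[symmetric] by simp
  then show ?thesis using cl_eq_if_R_eq[of h h' A'] assms by simp
qed

text \<open>A copy of \<open>suspension\<close> with \<open>ext_mor\<close> in place of
  \<open>sextuple_mor\<close>, so that the formula keeps its meaning in the opposite category, where
  no shift functor is at hand.\<close>

definition susp :: "('o, 'm set) endofunctor" where
  "susp = \<lparr>ob = \<Sigma>,
      mor = (\<lambda>\<phi>. \<Union>{sub_class C \<A> \<X> (\<Sigma> A) (\<Sigma> A') h | A A' f g h.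
         A \<in> \<A> \<and> A' \<in> \<A> \<and> f \<in> \<phi> \<and> ext_mor (right_tri \<tau> A) (right_tri \<tau> A') f g h})\<rparr>"

lemma ob_susp [simp]: "ob susp = \<Sigma>"
  by (simp add: susp_def)

lemma ext_mor_choice:
  assumes "A \<in> \<A>" "A' \<in> \<A>"
  shows "ext_mor (right_tri \<tau> A) (right_tri \<tau> A') f g h \<longleftrightarrow>
    arr f \<and> src f = A \<and> tgt f = A' \<and> arr g \<and> src g = mid \<tau> A \<and> tgt g = mid \<tau> A' \<and>
    arr h \<and> src h = \<Sigma> A \<and> tgt h = \<Sigma> A' \<and>
    g \<cdot> \<alpha> A = \<alpha> A' \<cdot> f \<and> h \<cdot> \<beta> A = \<beta> A' \<cdot> g \<and> L f (\<gamma> A) = R (\<gamma> A') h"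
  using assms by (auto simp: ext_mor_def right_tri_def in_Hom_iff)

text \<open>Nothing is asked of a middle map: any \<open>h\<close> with
  \<open>L f (\<gamma> A) = R (\<gamma> A') h\<close> represents the suspension of \<open>f\<close>,
  because such lifts agree modulo \<X>.\<close>

lemma mor_susp:
  assumes "arr f" "src f = A" "tgt f = A'" "A \<in> \<A>" "A' \<in> \<A>"
    and "arr h" "src h = \<Sigma> A" "tgt h = \<Sigma> A'" "L f (\<gamma> A) = R (\<gamma> A') h"
  shows "mor susp (cl f) = cl h"
proof -
  let ?S = "{sub_class C \<A> \<X> (\<Sigma> A) (\<Sigma> A') h | A A' f' g h.
         A \<in> \<A> \<and> A' \<in> \<A> \<and> f' \<in> cl f \<and> ext_mor (right_tri \<tau> A) (right_tri \<tau> A') f' g h}"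
  have "\<Union>?S = cl h"
  proof (rule Union_singleton_class)
    obtain g0 h0 where "ext_mor (right_tri \<tau> A) (right_tri \<tau> A') f g0 h0"
      using suspension_exists[OF assms(1-5)] ext_mor_choice assms by blast
    then show "?S \<noteq> {}" using assms cl_self[of f] by blast
    fix x assume "x \<in> ?S"
    then obtain B B' f' g' h' where x: "x = sub_class C \<A> \<X> (\<Sigma> B) (\<Sigma> B') h'" "B \<in> \<A>" "B' \<in> \<A>"
      "f' \<in> cl f" "ext_mor (right_tri \<tau> B) (right_tri \<tau> B') f' g' h'"
      by blast
    note m = x(5)[unfolded ext_mor_choice[OF x(2,3)]]
    have f': "arr f'" "src f' = A" "tgt f' = A'" "cl f' = cl f"
      using x(4) assms by (simp_all add: mem_cl cl_eq_iff)
    with m have "B = A" "B' = A'" by simp_all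
    with m f' have "cl h' = cl h" "src h' = \<Sigma> A" "tgt h' = \<Sigma> A'"
      using suspension_cong[of f' f A A' h' h] assms by simp_all
    then show "x = cl h" using x(1) \<open>B = A\<close> \<open>B' = A'\<close> by (simp add: cl_def)
  qed
  then show ?thesis by (simp add: susp_def)
qed

lemma mor_suspE:
  assumes "arr f" "src f = A" "tgt f = A'" "A \<in> \<A>" "A' \<in> \<A>"
  obtains h where "arr h" "src h = \<Sigma> A" "tgt h = \<Sigma> A'" "L f (\<gamma> A) = R (\<gamma> A') h" "mor susp (cl f) = cl h"
  using suspension_exists[OF assms] mor_susp[OF assms] by blast

text \<open>Thanks to \<open>mor_susp\<close>, the functor laws only need suitable lifts: an
  identity, \<open>k \<cdot> h\<close> and \<open>h \<boxplus> k\<close> in turn.\<close>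

lemma susp_functor: "additive_endofunctor Q susp"
proof (intro additive_endofunctor.intro additive_endofunctor_axioms.intro preadditive_Q)
  show "ob susp A \<in> Obj Q" if "A \<in> Obj Q" for A using that by simp
next
  fix A B \<phi> assume AB: "A \<in> Obj Q" "B \<in> Obj Q" "\<phi> \<in> Hom Q A B"
  then obtain f where f: "arr f" "src f = A" "tgt f = B" "\<phi> = cl f" by (auto elim: Q_homE)
  obtain h where "arr h" "src h = \<Sigma> A" "tgt h = \<Sigma> B" "L f (\<gamma> A) = R (\<gamma> B) h" "mor susp (cl f) = cl h"
    using mor_suspE[of f A B] f AB by auto
  then show "mor susp \<phi> \<in> Hom Q (ob susp A) (ob susp B)" using f AB by (simp add: cl_in_Hom_Q)
next
  fix A assume "A \<in> Obj Q"
  then show "mor susp (Id Q A) = Id Q (ob susp A)"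
    using mor_susp[of "Id C A" A A "Id C (\<Sigma> A)"] by (simp add: L_Id[of A "\<Sigma> A"] R_Id[of A "\<Sigma> A"])
next
  fix A B D \<phi> \<psi> assume *: "A \<in> Obj Q" "B \<in> Obj Q" "D \<in> Obj Q" "\<phi> \<in> Hom Q A B" "\<psi> \<in> Hom Q B D"
  then obtain f where f: "arr f" "src f = A" "tgt f = B" "\<phi> = cl f" by (auto elim: Q_homE)
  obtain g where g: "arr g" "src g = B" "tgt g = D" "\<psi> = cl g" using * by (auto elim: Q_homE)
  obtain h where h: "arr h" "src h = \<Sigma> A" "tgt h = \<Sigma> B" "L f (\<gamma> A) = R (\<gamma> B) h" "mor susp (cl f) = cl h"
    using mor_suspE[of f A B] f * by auto
  obtain k where k: "arr k" "src k = \<Sigma> B" "tgt k = \<Sigma> D" "L g (\<gamma> B) = R (\<gamma> D) k" "mor susp (cl g) = cl k"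
    using mor_suspE[of g B D] g * by auto
  have "L (g \<cdot> f) (\<gamma> A) = L g (R (\<gamma> B) h)" using f g h * L_Comp[of f g "\<Sigma> A" "\<gamma> A"] by simp
  also have "\<dots> = R (\<gamma> D) (k \<cdot> h)"
    using f g h k * L_R[of g h "\<gamma> B"] R_Comp[of k h D "\<gamma> D"] by simp
  finally show "mor susp (\<psi> \<cdot>\<^bsub>Q\<^esub> \<phi>) = mor susp \<psi> \<cdot>\<^bsub>Q\<^esub> mor susp \<phi>"
    using f g h k * mor_susp[of "g \<cdot> f" A D "k \<cdot> h"] by (simp add: Comp_Q)
next
  fix A B \<phi> \<psi> assume *: "A \<in> Obj Q" "B \<in> Obj Q" "\<phi> \<in> Hom Q A B" "\<psi> \<in> Hom Q A B"
  then obtain f where f: "arr f" "src f = A" "tgt f = B" "\<phi> = cl f" by (auto elim: Q_homE)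
  obtain g where g: "arr g" "src g = A" "tgt g = B" "\<psi> = cl g" using * by (auto elim: Q_homE)
  obtain h where h: "arr h" "src h = \<Sigma> A" "tgt h = \<Sigma> B" "L f (\<gamma> A) = R (\<gamma> B) h" "mor susp (cl f) = cl h"
    using mor_suspE[of f A B] f * by auto
  obtain k where k: "arr k" "src k = \<Sigma> A" "tgt k = \<Sigma> B" "L g (\<gamma> A) = R (\<gamma> B) k" "mor susp (cl g) = cl k"
    using mor_suspE[of g A B] g * by auto
  show "mor susp (Add Q \<phi> \<psi>) = Add Q (mor susp \<phi>) (mor susp \<psi>)"
    using f g h k * mor_susp[of "f \<boxplus> g" A B "h \<boxplus> k"] L_R_add[of f g h k "\<gamma> A" "\<gamma> B"]
    by (simp add: Add_Q)
qed

definition dist :: "('o, 'm set) sextuple set" where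
  "dist = {s. \<exists>A \<in> \<A>. \<exists>B \<in> \<A>. \<exists>f \<in> Hom C A B. \<exists>D g h.
        (B, D, \<Sigma> A, g, h, L f (\<gamma> A)) \<in> \<Delta> \<and>
        sextuple_isomorphic Q susp s
          (A, B, D, sub_class C \<A> \<X> A B f, sub_class C \<A> \<X> B D g, sub_class C \<A> \<X> D (\<Sigma> A) h)}"

end

sublocale suspended_category \<subseteq> Q: additive_endofunctor "subfactor C \<A> \<X>" susp
  by (rule susp_functor)

section \<open>Standard triangles, triangles on monic maps, and their comparison\<close>

context suspended_category
begin

text \<open>Up to isomorphism in the subfactor category, the distinguished right triangles are those induced
  by triangles whose first map \<open>f\<close> is \<open>\<X>\<close>-monic; the sign is the usual one of homotopy pushouts.\<close>

definition mtri :: "'o \<Rightarrow> 'o \<Rightarrow> 'o \<Rightarrow> 'm \<Rightarrow> 'm \<Rightarrow> 'm \<Rightarrow> bool" where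
  "mtri A B D f g k \<longleftrightarrow> A \<in> \<A> \<and> B \<in> \<A> \<and> D \<in> \<A> \<and> monic f \<and>
     arr f \<and> src f = A \<and> tgt f = B \<and> arr g \<and> src g = B \<and> tgt g = D \<and>
     arr k \<and> src k = D \<and> tgt k = \<Sigma> A \<and> (A, B, D, f, g, R (\<gamma> A) k) \<in> \<Delta>"

text \<open>The generating sequences of \<open>dist\<close>, before passing to isomorphic copies.
  Membership of \<open>D\<close> in \<A> is not built in, since it has to be proved; see
  \<open>std_in_\<A>\<close>.\<close>

definition std :: "'o \<Rightarrow> 'o \<Rightarrow> 'o \<Rightarrow> 'm \<Rightarrow> 'm \<Rightarrow> 'm \<Rightarrow> bool" where
  "std A B D f g h \<longleftrightarrow> A \<in> \<A> \<and> B \<in> \<A> \<and>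
     arr f \<and> src f = A \<and> tgt f = B \<and> arr g \<and> src g = B \<and> tgt g = D \<and>
     arr h \<and> src h = D \<and> tgt h = \<Sigma> A \<and> (B, D, \<Sigma> A, g, h, L f (\<gamma> A)) \<in> \<Delta>"

lemma stdI:
  assumes "(B, D, \<Sigma> A, g, h, L f (\<gamma> A)) \<in> \<Delta>" "A \<in> \<A>" "B \<in> \<A>" "arr f" "src f = A" "tgt f = B"
  shows "std A B D f g h"
  using tri_iff[OF assms(1)] assms unfolding std_def by simp

text \<open>As \<open>f\<close> is monic, \<open>\<alpha> A\<close> extends along it. So the
  identity of \<open>A\<close> extends to a morphism into the chosen triangle, and its third
  component is the lift \<open>k\<close>.\<close>

lemma mtriI:
  assumes "(A, B, D, f, g, e) \<in> \<Delta>" "monic f" "A \<in> \<A>" "B \<in> \<A>"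
  shows "\<exists>k. e = R (\<gamma> A) k \<and> mtri A B D f g k"
proof -
  note t = tri_iff[OF assms(1)]
  obtain u where u: "arr u" "src u = B" "tgt u = mid \<tau> A" "\<alpha> A = u \<cdot> f"
    using monicD[OF assms(2), of "\<alpha> A"] t assms by auto
  have "u \<cdot> f = \<alpha> A \<cdot> Id C A" using u(4)[symmetric] assms(3) by simp
  then obtain k where k: "arr k" "src k = D" "tgt k = \<Sigma> A" "L (Id C A) e = R (\<gamma> A) k"
    using tri_fill[OF assms(1) choice_tri[OF assms(3)], of "Id C A" u] u(1-3) t by auto
  then have "e = R (\<gamma> A) k" using L_Id[of A D e] t by simp
  then show ?thesis using k t assms cone_in_\<A> unfolding mtri_def by blast
qed

lemma mtri_exists:
  assumes "monic f" "src f = A" "tgt f = B" "A \<in> \<A>" "B \<in> \<A>"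
  obtains D g k where "mtri A B D f g k"
  using tri_embed[of f] mtriI assms unfolding monic_def by blast

lemma mtri_sextuple: "mtri A B D f g k \<Longrightarrow> (A, B, D, cl f, cl g, cl (neg k)) \<in> sextuples Q susp"
  unfolding mtri_def by (simp add: Q.sextuples_iff)

text \<open>The defect of the square factors through \<X>, and as \<open>f\<close> is monic it
  extends from \<open>A\<close> to \<open>B\<close>. Subtracting the extension from \<open>b\<close>
  makes the square commute in C without changing the class of \<open>b\<close>.\<close>

lemma mtri_fill:
  assumes t: "mtri A B D f g k" and t': "mtri A' B' D' f' g' k'"
    and ab: "arr a" "src a = A" "tgt a = A'" "arr b" "src b = B" "tgt b = B'" "cl (b \<cdot> f) = cl (f' \<cdot> a)"
  shows "\<exists>c. arr c \<and> src c = D \<and> tgt c = D' \<and>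
    sextuple_mor Q susp (A, B, D, cl f, cl g, cl (neg k)) (A', B', D', cl f', cl g', cl (neg k'))
      (cl a) (cl b) (cl c)"
proof -
  note 1 = t[unfolded mtri_def] t'[unfolded mtri_def]
  obtain n where n: "null n" "src n = src (f' \<cdot> a)" "tgt n = tgt (f' \<cdot> a)" "b \<cdot> f = (f' \<cdot> a) \<boxplus> n"
    using cl_eqE[OF ab(7)] 1 ab by auto
  obtain u v where u: "arr u" "arr v" "src u = src n" "tgt u \<in> \<X>" "src v = tgt u" "tgt v = tgt n" "n = v \<cdot> u"
    using n(1) by (rule nullE)
  obtain w where w: "arr w" "src w = B" "tgt w = tgt u" "u = w \<cdot> f"
    using monicD[of f u] 1 u(1-6) n(2) ab by auto
  have ty: "src u = A" "tgt v = B'" using u(3,6) n(2,3) 1 ab by simp_all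
  let ?n = "v \<cdot> w"
  have vw: "arr ?n" "src ?n = B" "tgt ?n = B'" "null ?n"
    using u(1,2,4,5) ty w(1-3) nullI[of w v] by simp_all
  have "?n \<cdot> f = n" unfolding u(7) w(4) using 1 u(1,2,5) w(1-3) by (simp add: comp_assoc)
  then have *: "(b \<boxplus> neg ?n) \<cdot> f = f' \<cdot> a"
    using n(2-4) null_arr[OF n(1)] vw 1 ab by (simp add: comp_add_left add_assoc)
  have clb: "cl (b \<boxplus> neg ?n) = cl b"
    by (rule cl_eqI[OF _ _ _ _ null_neg[OF vw(4)] refl]) (use vw ab in simp_all)
  let ?b = "b \<boxplus> neg ?n"
  obtain c where c: "arr c" "src c = D" "tgt c = D'" "c \<cdot> g = g' \<cdot> ?b" "L a (R (\<gamma> A) k) = R (R (\<gamma> A') k') c"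
    using tri_fill[of A B D f g "R (\<gamma> A) k" A' B' D' f' g' "R (\<gamma> A') k'" a ?b] 1 vw ab * by auto
  have "cl c \<cdot>\<^bsub>Q\<^esub> cl g = cl g' \<cdot>\<^bsub>Q\<^esub> cl b"
    using c 1 ab vw clb[symmetric] by (simp add: Comp_Q)
  moreover have "cl b \<cdot>\<^bsub>Q\<^esub> cl f = cl f' \<cdot>\<^bsub>Q\<^esub> cl a" using 1 ab by (simp add: Comp_Q)
  moreover have "mor susp (cl a) \<cdot>\<^bsub>Q\<^esub> cl (neg k) = cl (neg k') \<cdot>\<^bsub>Q\<^esub> cl c"
  proof -
    obtain h where h: "arr h" "src h = \<Sigma> A" "tgt h = \<Sigma> A'" "L a (\<gamma> A) = R (\<gamma> A') h" "mor susp (cl a) = cl h"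
      using mor_suspE[of a A A'] 1 ab by auto
    \<comment> \<open>\<open>h \<cdot> k\<close> and \<open>k' \<cdot> c\<close> turn out to lift
      the same element along \<open>\<gamma> A'\<close>, so they agree modulo \<X>; both sides then
      receive the same sign.\<close>
    have "R (\<gamma> A') (h \<cdot> k) = R (L a (\<gamma> A)) k"
      using h 1 R_Comp[of h k A' "\<gamma> A'"] by simp
    also have "\<dots> = R (\<gamma> A') (k' \<cdot> c)"
      using c 1 ab L_R[of a k "\<gamma> A"] R_Comp[of k' c A' "\<gamma> A'"] by simp
    finally have "cl (h \<cdot> k) = cl (k' \<cdot> c)" using cl_eq_if_R_eq[of "h \<cdot> k" "k' \<cdot> c" A'] h c 1 by simp
    then have "cl (neg (h \<cdot> k)) = cl (neg (k' \<cdot> c))"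
      using h c 1 neg_Q[of "h \<cdot> k"] neg_Q[of "k' \<cdot> c"] by simp
    then show ?thesis using h c 1 by (simp add: Comp_Q)
  qed
  ultimately show ?thesis
    using c(1-3) mtri_sextuple[OF t] mtri_sextuple[OF t'] 1 ab
    unfolding Q.sextuple_mor_iff by (intro exI[of _ c]) simp
qed

text \<open>The component \<open>\<alpha> A\<close> alone does the work: a map from \<open>A\<close>
  to \<X> extends along \<open>\<alpha> A\<close>, and \<open>q\<close> carries this extension to
  the direct sum.\<close>

lemma monic_direct_sum:
  assumes "arr f" "src f = A" "tgt f = B" "A \<in> \<A>"
    and "arr i" "src i = B" "tgt i = S" "arr j" "src j = mid \<tau> A" "tgt j = S"
    and "arr q" "src q = S" "tgt q = mid \<tau> A"
    and "q \<cdot> j = Id C (mid \<tau> A)" "q \<cdot> i = Zero C B (mid \<tau> A)"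
  shows "q \<cdot> (i \<cdot> f \<boxplus> j \<cdot> \<alpha> A) = \<alpha> A" "monic (i \<cdot> f \<boxplus> j \<cdot> \<alpha> A)"
proof -
  show *: "q \<cdot> (i \<cdot> f \<boxplus> j \<cdot> \<alpha> A) = \<alpha> A"
    using assms by (simp add: comp_add_right comp_reassoc[OF assms(14)] comp_reassoc[OF assms(15)])
  show "monic (i \<cdot> f \<boxplus> j \<cdot> \<alpha> A)"
    unfolding monic_def
  proof (intro conjI allI impI)
    show "arr (i \<cdot> f \<boxplus> j \<cdot> \<alpha> A)" using assms by simp
    fix u assume u: "arr u \<and> src u = src (i \<cdot> f \<boxplus> j \<cdot> \<alpha> A) \<and> tgt u \<in> \<X>"
    then obtain v where v: "arr v" "src v = mid \<tau> A" "tgt v = tgt u" "u = v \<cdot> \<alpha> A"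
      using monicD[OF monic_\<alpha>[OF assms(4)], of u] assms by auto
    have "u = (v \<cdot> q) \<cdot> (i \<cdot> f \<boxplus> j \<cdot> \<alpha> A)"
      using v(1-3) assms(1-13) * by (subst v(4)) (simp add: comp_assoc)
    then show "\<exists>v. arr v \<and> src v = tgt (i \<cdot> f \<boxplus> j \<cdot> \<alpha> A) \<and> tgt v = tgt u \<and> u = v \<cdot> (i \<cdot> f \<boxplus> j \<cdot> \<alpha> A)"
      using v(1-3) assms(1-13) by (intro exI[of _ "v \<cdot> q"]) simp
  qed
qed

text \<open>The projection \<open>q\<close> takes the map with components \<open>f\<close> and
  \<open>\<alpha> A\<close> back to \<open>\<alpha> A\<close>. The rotated octahedron compares its
  cone \<open>D\<close> with \<open>\<Sigma> A\<close>: it yields the lift \<open>k\<close> and, on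
  the same object \<open>D\<close>, the standard triangle of \<open>f\<close>. This is the homotopy
  pushout of \<open>f\<close> and \<open>\<alpha> A\<close>.\<close>

lemma std_model:
  assumes f: "arr f" "src f = A" "tgt f = B" and AB: "A \<in> \<A>" "B \<in> \<A>"
  obtains S D i j p q g k where "S \<in> \<A>"
    "arr i" "src i = B" "tgt i = S" "arr j" "src j = mid \<tau> A" "tgt j = S"
    "arr p" "src p = S" "tgt p = B" "arr q" "src q = S" "tgt q = mid \<tau> A"
    "p \<cdot> i = Id C B" "p \<cdot> j = Zero C (mid \<tau> A) B" "i \<cdot> p \<boxplus> j \<cdot> q = Id C S"
    "mtri A S D (i \<cdot> f \<boxplus> j \<cdot> \<alpha> A) g k" "std A B D f (g \<cdot> i) (neg k)"
proof -
  have "B \<in> Obj C" "mid \<tau> A \<in> Obj C" using AB by simp_all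
  then obtain S where S: "direct_sum C B (mid \<tau> A) S" using ex_direct_sum by blast
  then obtain i j p q where d: "B \<in> Obj C" "mid \<tau> A \<in> Obj C" "S \<in> Obj C"
    "arr i" "src i = B" "tgt i = S" "arr j" "src j = mid \<tau> A" "tgt j = S"
    "arr p" "src p = S" "tgt p = B" "arr q" "src q = S" "tgt q = mid \<tau> A"
    "p \<cdot> i = Id C B" "q \<cdot> j = Id C (mid \<tau> A)" "q \<cdot> i = Zero C B (mid \<tau> A)"
    "p \<cdot> j = Zero C (mid \<tau> A) B" "i \<cdot> p \<boxplus> j \<cdot> q = Id C S"
    by (elim direct_sumE)
  have SA: "S \<in> \<A>" using direct_sum_\<A>[OF S] AB by simp
  let ?f = "i \<cdot> f \<boxplus> j \<cdot> \<alpha> A"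
  have qf: "q \<cdot> ?f = \<alpha> A" and mf: "monic ?f" using monic_direct_sum[of f A B i S j q] f AB d by simp_all
  have tf: "src ?f = A" "tgt ?f = S" "arr ?f" using f AB d by simp_all
  have pf: "p \<cdot> ?f = f"
    using f AB d by (simp add: comp_add_right comp_reassoc[OF d(16)] comp_reassoc[OF d(19)])
  obtain D g e where t: "(A, S, D, ?f, g, e) \<in> \<Delta>" using tri_embed[OF tf(3)] unfolding tf by blast
  obtain e' where sp: "(B, S, mid \<tau> A, i, q, e') \<in> \<Delta>" using tri_split[OF d] by blast
  have tA: "(A, mid \<tau> A, \<Sigma> A, q \<cdot> ?f, \<beta> A, \<gamma> A) \<in> \<Delta>" unfolding qf by (rule choice_tri[OF AB(1)])
  obtain k \<epsilon> where k: "arr k" "src k = D" "tgt k = \<Sigma> A" "R (\<gamma> A) k = e" "L i \<epsilon> = L ?f (\<gamma> A)"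
    "(B, D, \<Sigma> A, g \<cdot> i, neg k, \<epsilon>) \<in> \<Delta>"
    using tri_octahedron'[OF t sp tA] by blast
  have \<epsilon>: "\<epsilon> \<in> E (\<Sigma> A) B" using tri_iff[OF k(6)] by simp
  \<comment> \<open>The octahedron describes \<epsilon> only after the action of \<open>i\<close>;
    applying the retraction \<open>p\<close> identifies it with
    \<open>L f (\<gamma> A)\<close>.\<close>
  have "\<epsilon> = L (p \<cdot> i) \<epsilon>" using d \<epsilon> AB by (simp add: L_Id[of B "\<Sigma> A"])
  also have "\<dots> = L p (L ?f (\<gamma> A))" using d \<epsilon> AB k(5) L_Comp[of i p "\<Sigma> A" \<epsilon>] by simp
  also have "\<dots> = L f (\<gamma> A)" using L_Comp[of ?f p "\<Sigma> A" "\<gamma> A"] tf d(10-12) AB unfolding pf by simp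
  finally have "\<epsilon> = L f (\<gamma> A)" .
  then have "std A B D f (g \<cdot> i) (neg k)" using stdI k(6) f AB by blast
  moreover have "mtri A S D ?f g k"
    using cone_in_\<A>[OF t mf AB(1) SA] t k tri_iff[OF t] mf AB SA unfolding mtri_def by simp
  ultimately show thesis using that[of S i j p q D g k] SA d by blast
qed

text \<open>Both triangles have the connecting element \<open>L f (\<gamma> A)\<close>, so
  \<open>tri_middle_iso\<close> compares \<open>D\<close> and \<open>D'\<close> over the identities
  of \<open>B\<close> and \<open>\<Sigma> A\<close>.\<close>

lemma std_iso_model:
  assumes "std A B D f g h" "std A B D' f g' h'" "D' \<in> \<A>"
  shows "D \<in> \<A>"
    "sextuple_isomorphic Q susp (A, B, D, cl f, cl g, cl h) (A, B, D', cl f, cl g', cl h')"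
proof -
  note 1 = assms(1,2)[unfolded std_def]
  obtain b where b: "isomorphism C D D' b" "b \<cdot> g = g'" "h' \<cdot> b = h"
    using tri_middle_iso 1 by blast
  obtain b' where b': "D \<in> Obj C" "D' \<in> Obj C" "arr b" "src b = D" "tgt b = D'"
    "arr b'" "src b' = D'" "tgt b' = D" "b' \<cdot> b = Id C D" "b \<cdot> b' = Id C D'"
    using b(1) by (elim isomorphismE)
  then have "isomorphism C D' D b'" using isomorphismI[of b' b] by simp
  then show D: "D \<in> \<A>" using \<A>_iso assms(3) by blast
  show "sextuple_isomorphic Q susp (A, B, D, cl f, cl g, cl h) (A, B, D', cl f, cl g', cl h')"
    unfolding Q.sextuple_isomorphic_iff Q.sextuple_mor_iff Q.sextuples_iff
    using 1 b b' D assms(3) Q.isomorphism_Id[of A] Q.isomorphism_Id[of B] cl_isomorphism[OF b(1) D]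
    by (intro exI[of _ "cl (Id C A)"] exI[of _ "cl (Id C B)"] exI[of _ "cl b"])
      (simp add: Comp_Q Q.mor_of_Id[of A, simplified])
qed

text \<open>\<open>D\<close> is not presented as the cone of a monic map, but it is isomorphic to
  the third object in \<open>std_model\<close>, which is such a cone.\<close>

lemma std_in_\<A>: assumes "std A B D f g h" shows "D \<in> \<A>"
proof -
  note 1 = assms[unfolded std_def]
  obtain S D' i j g' k where "mtri A S D' (i \<cdot> f \<boxplus> j \<cdot> \<alpha> A) g' k" "std A B D' f (g' \<cdot> i) (neg k)"
    using std_model[of f A B] 1 by metis
  then show ?thesis using std_iso_model(1)[OF assms] unfolding mtri_def by blast
qed

lemma dist_iff:
  "s \<in> dist \<longleftrightarrow> (\<exists>A B D f g h. std A B D f g h \<and>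
     sextuple_isomorphic Q susp s (A, B, D, cl f, cl g, cl h))"
proof
  assume "s \<in> dist"
  then obtain A B f D g h where *: "A \<in> \<A>" "B \<in> \<A>" "f \<in> Hom C A B" "(B, D, \<Sigma> A, g, h, L f (\<gamma> A)) \<in> \<Delta>"
    "sextuple_isomorphic Q susp s
          (A, B, D, sub_class C \<A> \<X> A B f, sub_class C \<A> \<X> B D g, sub_class C \<A> \<X> D (\<Sigma> A) h)"
    unfolding dist_def by blast
  have f: "arr f" "src f = A" "tgt f = B" using * by (simp_all add: in_Hom_iff)
  have t: "std A B D f g h" using stdI * f by blast
  have "sub_class C \<A> \<X> A B f = cl f" "sub_class C \<A> \<X> B D g = cl g"
    "sub_class C \<A> \<X> D (\<Sigma> A) h = cl h"
    using t unfolding std_def by (simp_all add: cl_def)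
  with *(5) have "sextuple_isomorphic Q susp s (A, B, D, cl f, cl g, cl h)" by simp
  with t show "\<exists>A B D f g h. std A B D f g h \<and>
     sextuple_isomorphic Q susp s (A, B, D, cl f, cl g, cl h)"
    by blast
next
  assume "\<exists>A B D f g h. std A B D f g h \<and>
     sextuple_isomorphic Q susp s (A, B, D, cl f, cl g, cl h)"
  then obtain A B D f g h where *: "std A B D f g h" "sextuple_isomorphic Q susp s (A, B, D, cl f, cl g, cl h)"
    by blast
  note 1 = *(1)[unfolded std_def]
  have f: "f \<in> Hom C A B" using 1 by (simp add: in_Hom_iff)
  have "sub_class C \<A> \<X> A B f = cl f" "sub_class C \<A> \<X> B D g = cl g"
    "sub_class C \<A> \<X> D (\<Sigma> A) h = cl h"
    using 1 by (simp_all add: cl_def)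
  with *(2) have "sextuple_isomorphic Q susp s
      (A, B, D, sub_class C \<A> \<X> A B f, sub_class C \<A> \<X> B D g, sub_class C \<A> \<X> D (\<Sigma> A) h)"
    by simp
  then show "s \<in> dist" unfolding dist_def using 1 f by blast
qed

lemma std_sextuple: "std A B D f g h \<Longrightarrow> (A, B, D, cl f, cl g, cl h) \<in> sextuples Q susp"
  using std_in_\<A>[of A B D f g h] unfolding std_def by (simp add: Q.sextuples_iff)

lemma std_in_dist: "std A B D f g h \<Longrightarrow> (A, B, D, cl f, cl g, cl h) \<in> dist"
  unfolding dist_iff using Q.sextuple_isomorphic_refl[OF std_sextuple] by blast

lemma dist_iso_closed: "s \<in> dist \<Longrightarrow> sextuple_isomorphic Q susp s' s \<Longrightarrow> s' \<in> dist"
  unfolding dist_iff using Q.sextuple_isomorphic_trans by blast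

text \<open>For a map \<open>u\<close> from \<open>B\<close> to \<X> the composite
  \<open>u \<cdot> f\<close> is null, so \<open>u\<close> kills \<open>L f (\<gamma> A)\<close>.
  This is the connecting element of the triangle starting with \<open>g\<close>, hence
  \<open>u\<close> extends along \<open>g\<close>.\<close>

lemma std_monic: assumes "std A B D f g h" shows "monic g"
  unfolding monic_def
proof (intro conjI allI impI)
  note 1 = assms[unfolded std_def]
  show "arr g" using 1 by simp
  fix u assume u: "arr u \<and> src u = src g \<and> tgt u \<in> \<X>"
  then have "null (u \<cdot> f)" using 1 null_Comp_right[of u f] nullI[of u "Id C (tgt u)"] by simp
  then have "L (u \<cdot> f) (\<gamma> A) = N (\<Sigma> A) (tgt u)" using L_null[of "u \<cdot> f" A] 1 u by simp
  then have "L u (L f (\<gamma> A)) = N (\<Sigma> A) (tgt u)" using L_Comp[of f u "\<Sigma> A" "\<gamma> A"] 1 u by simp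
  then show "\<exists>v. arr v \<and> src v = tgt g \<and> tgt v = tgt u \<and> u = v \<cdot> g"
    using tri_coexact_left[of B D "\<Sigma> A" g h "L f (\<gamma> A)" u] 1 u by simp
qed

text \<open>Since \<open>g\<close> is monic, the null map \<open>u \<cdot> g\<close> extends to a
  null map on \<open>D\<close>. After subtracting it, \<open>u\<close> kills \<open>g\<close>
  already in C and factors through \<open>h\<close>.\<close>

lemma std_weak_cokernel:
  assumes t: "std A B D f g h" and u: "arr u" "src u = D" "tgt u \<in> \<A>" "null (u \<cdot> g)"
  shows "\<exists>m. arr m \<and> src m = \<Sigma> A \<and> tgt m = tgt u \<and> cl u = cl (m \<cdot> h)"
proof -
  note 1 = t[unfolded std_def]
  obtain w v where w: "arr w" "arr v" "src w = src (u \<cdot> g)" "tgt w \<in> \<X>" "src v = tgt w" "tgt v = tgt (u \<cdot> g)"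
    "u \<cdot> g = v \<cdot> w"
    using u(4) by (rule nullE)
  have ty: "src w = B" "tgt v = tgt u" using w(3,6) 1 u by simp_all
  obtain x where x: "arr x" "src x = D" "tgt x = tgt w" "w = x \<cdot> g"
    using monicD[OF std_monic[OF t], of w] w(1,4) ty 1 by auto
  let ?n = "v \<cdot> x"
  have n: "arr ?n" "src ?n = D" "tgt ?n = tgt u" "null ?n"
    using w(2,4,5) ty x(1-3) nullI[of x v] by simp_all
  have "?n \<cdot> g = u \<cdot> g" unfolding w(7) x(4) using 1 w(2,5) x(1-3) by (simp add: comp_assoc)
  then have "(u \<boxplus> neg ?n) \<cdot> g = Zero C B (tgt u)" using n 1 u by (simp add: comp_add_left)
  then obtain m where m: "arr m" "src m = \<Sigma> A" "tgt m = tgt u" "u \<boxplus> neg ?n = m \<cdot> h"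
    using tri_coexact_middle[of B D "\<Sigma> A" g h "L f (\<gamma> A)" "u \<boxplus> neg ?n"] 1 n u by auto
  have "u = ?n \<boxplus> m \<cdot> h" by (rule iffD2[OF eq_add_iff]) (use n u(1-3) 1 m in simp_all)
  also have "\<dots> = m \<cdot> h \<boxplus> ?n" by (rule add_commute) (use n u(1-3) 1 m(1-3) in simp_all)
  finally have u': "u = m \<cdot> h \<boxplus> ?n" .
  have "cl u = cl (m \<cdot> h)"
    by (rule cl_eqI[OF u(1) _ _ _ n(4) u']) (use n(1-3) u(2,3) 1 m(1-3) in simp_all)
  then show ?thesis using m by blast
qed

text \<open>\<open>j \<cdot> q\<close> passes through \<X>, so modulo \<X> the idempotent
  \<open>i \<cdot> p\<close> is the identity and the summand in \<X> disappears.\<close>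

lemma cl_summand:
  assumes "arr i" "src i = B" "tgt i = S" "arr j" "src j \<in> \<X>" "tgt j = S"
    "arr p" "src p = S" "tgt p = B" "arr q" "src q = S" "tgt q = src j"
    "p \<cdot> i = Id C B" "i \<cdot> p \<boxplus> j \<cdot> q = Id C S" "B \<in> \<A>" "S \<in> \<A>"
  shows "isomorphism Q B S (cl i)" "cl (i \<cdot> p) = cl (Id C S)"
proof -
  have "cl (Id C S) = cl (i \<cdot> p)"
    by (rule cl_eqI[OF _ _ _ _ nullI assms(14)[symmetric]]) (use assms(1-13,15,16) in simp_all)
  then show "cl (i \<cdot> p) = cl (Id C S)" "isomorphism Q B S (cl i)"
    using Q.isomorphismI[of "cl i" "cl p"] assms by (simp_all add: Comp_Q)
qed

text \<open>In \<open>std_model\<close> the standard and the monic triangle share their third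
  object; as the added summand vanishes modulo \<X>, \<open>cl i\<close> carries one to the
  other.\<close>

lemma std_iso_mtri:
  assumes t: "std A B D f g h"
  shows "\<exists>S D' f' g' k. mtri A S D' f' g' k \<and>
    sextuple_isomorphic Q susp (A, B, D, cl f, cl g, cl h) (A, S, D', cl f', cl g', cl (neg k))"
proof -
  note 1 = t[unfolded std_def]
  obtain S D' i j p q g' k where d: "S \<in> \<A>"
    "arr i" "src i = B" "tgt i = S" "arr j" "src j = mid \<tau> A" "tgt j = S"
    "arr p" "src p = S" "tgt p = B" "arr q" "src q = S" "tgt q = mid \<tau> A"
    "p \<cdot> i = Id C B" "p \<cdot> j = Zero C (mid \<tau> A) B" "i \<cdot> p \<boxplus> j \<cdot> q = Id C S"
    and m: "mtri A S D' (i \<cdot> f \<boxplus> j \<cdot> \<alpha> A) g' k" and s: "std A B D' f (g' \<cdot> i) (neg k)"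
    using std_model[of f A B] 1 by metis
  note 2 = m[unfolded mtri_def]
  have i: "isomorphism Q B S (cl i)" using cl_summand(1)[of i B S j p q] d 1 by simp
  have "cl (i \<cdot> f \<boxplus> j \<cdot> \<alpha> A) = cl (i \<cdot> f)"
    by (rule cl_eqI[OF _ _ _ _ nullI refl]) (use d 1 in simp_all)
  then have "sextuple_isomorphic Q susp (A, B, D', cl f, cl (g' \<cdot> i), cl (neg k))
      (A, S, D', cl (i \<cdot> f \<boxplus> j \<cdot> \<alpha> A), cl g', cl (neg k))"
    unfolding Q.sextuple_isomorphic_iff Q.sextuple_mor_iff Q.sextuples_iff
    using 1 2 d i Q.isomorphism_Id[of A] Q.isomorphism_Id[of D']
    by (intro exI[of _ "cl (Id C A)"] exI[of _ "cl i"] exI[of _ "cl (Id C D')"])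
      (simp add: Comp_Q Q.mor_of_Id[of A, simplified])
  then show ?thesis
    using std_iso_model(2)[OF t s] 2 m Q.sextuple_isomorphic_trans by blast
qed

lemma dist_iso_mtri:
  assumes "s \<in> dist"
  shows "\<exists>A B D f g k. mtri A B D f g k \<and> sextuple_isomorphic Q susp s (A, B, D, cl f, cl g, cl (neg k))"
  using assms std_iso_mtri Q.sextuple_isomorphic_trans unfolding dist_iff by meson

text \<open>Fill-ins are constructed on monic triangles and weak cokernels on standard ones; both
  are carried to arbitrary members of \<open>dist\<close> by conjugating with isomorphisms of
  sextuples.\<close>

lemma weak_right_triangles_dist: "weak_right_triangles Q susp dist"
proof (intro weak_right_triangles.intro weak_right_triangles_axioms.intro susp_functor)
  show "dist \<subseteq> sextuples Q susp"
    unfolding dist_iff subset_iff sextuple_isomorphic_def sextuple_mor_def by blast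
  show "s' \<in> dist" if "s \<in> dist" "sextuple_isomorphic Q susp s s'" for s s'
    using dist_iso_closed[OF that(1)] Q.sextuple_isomorphic_sym[OF that(2)] by blast
next
  fix A B D f g h A' B' D' f' g' h' a b
  assume s: "(A, B, D, f, g, h) \<in> dist" and s': "(A', B', D', f', g', h') \<in> dist"
    and ab: "a \<in> Hom Q A A'" "b \<in> Hom Q B B'" "b \<cdot>\<^bsub>Q\<^esub> f = f' \<cdot>\<^bsub>Q\<^esub> a"
  obtain A1 B1 D1 f1 g1 k1 where t: "mtri A1 B1 D1 f1 g1 k1"
    "sextuple_isomorphic Q susp (A, B, D, f, g, h) (A1, B1, D1, cl f1, cl g1, cl (neg k1))"
    using dist_iso_mtri[OF s] by blast
  obtain A2 B2 D2 f2 g2 k2 where t': "mtri A2 B2 D2 f2 g2 k2"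
    "sextuple_isomorphic Q susp (A', B', D', f', g', h') (A2, B2, D2, cl f2, cl g2, cl (neg k2))"
    using dist_iso_mtri[OF s'] by blast
  obtain x1 y1 z1 where m1: "sextuple_mor Q susp (A, B, D, f, g, h) (A1, B1, D1, cl f1, cl g1, cl (neg k1)) x1 y1 z1"
    "isomorphism Q A A1 x1" "isomorphism Q B B1 y1"
    using t(2) unfolding Q.sextuple_isomorphic_iff by blast
  obtain x2 y2 z2 where m2: "sextuple_mor Q susp (A2, B2, D2, cl f2, cl g2, cl (neg k2)) (A', B', D', f', g', h') x2 y2 z2"
    "isomorphism Q A2 A' x2" "isomorphism Q B2 B' y2"
    using Q.sextuple_isomorphic_sym[OF t'(2)] unfolding Q.sextuple_isomorphic_iff by blast
  note 1 = m1(1)[unfolded Q.sextuple_mor_iff Q.sextuples_iff]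
  note 2 = m2(1)[unfolded Q.sextuple_mor_iff Q.sextuples_iff]
  obtain x1' where x1: "Q.arr x1'" "Q.src x1' = A1" "Q.tgt x1' = A" "x1' \<cdot>\<^bsub>Q\<^esub> x1 = Id Q A" "x1 \<cdot>\<^bsub>Q\<^esub> x1' = Id Q A1"
    using m1(2) by (elim Q.isomorphismE)
  obtain y1' where y1: "Q.arr y1'" "Q.src y1' = B1" "Q.tgt y1' = B" "y1' \<cdot>\<^bsub>Q\<^esub> y1 = Id Q B" "y1 \<cdot>\<^bsub>Q\<^esub> y1' = Id Q B1"
    using m1(3) by (elim Q.isomorphismE)
  obtain x2' where x2: "Q.arr x2'" "Q.src x2' = A'" "Q.tgt x2' = A2" "x2' \<cdot>\<^bsub>Q\<^esub> x2 = Id Q A2" "x2 \<cdot>\<^bsub>Q\<^esub> x2' = Id Q A'"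
    using m2(2) by (elim Q.isomorphismE)
  obtain y2' where y2: "Q.arr y2'" "Q.src y2' = B'" "Q.tgt y2' = B2" "y2' \<cdot>\<^bsub>Q\<^esub> y2 = Id Q B2" "y2 \<cdot>\<^bsub>Q\<^esub> y2' = Id Q B'"
    using m2(3) by (elim Q.isomorphismE)
  have a: "Q.arr a" "Q.src a = A" "Q.tgt a = A'" and b: "Q.arr b" "Q.src b = B" "Q.tgt b = B'"
    using ab 1 2 Q.in_Hom_iff by auto
  define a1 where "a1 = (x2' \<cdot>\<^bsub>Q\<^esub> a) \<cdot>\<^bsub>Q\<^esub> x1'"
  define b1 where "b1 = (y2' \<cdot>\<^bsub>Q\<^esub> b) \<cdot>\<^bsub>Q\<^esub> y1'"
  have ta: "Q.arr a1" "Q.src a1 = A1" "Q.tgt a1 = A2" and tb: "Q.arr b1" "Q.src b1 = B1" "Q.tgt b1 = B2"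
    unfolding a1_def b1_def using a b x1 y1 x2 y2 by simp_all
  have e1: "y1' \<cdot>\<^bsub>Q\<^esub> cl f1 = f \<cdot>\<^bsub>Q\<^esub> x1'"
    using Q.square_inverse[of y1 f "cl f1" x1 x1' y1'] 1 x1 y1 by simp
  have e2: "y2' \<cdot>\<^bsub>Q\<^esub> f' = cl f2 \<cdot>\<^bsub>Q\<^esub> x2'"
    using Q.square_inverse[of y2 "cl f2" f' x2 x2' y2'] 2 x2 y2 by simp
  have "b1 \<cdot>\<^bsub>Q\<^esub> cl f1 = (y2' \<cdot>\<^bsub>Q\<^esub> b) \<cdot>\<^bsub>Q\<^esub> (f \<cdot>\<^bsub>Q\<^esub> x1')"
    unfolding b1_def e1[symmetric] using b 1 y1 y2 by (simp add: Q.comp_assoc)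
  also have "\<dots> = y2' \<cdot>\<^bsub>Q\<^esub> ((b \<cdot>\<^bsub>Q\<^esub> f) \<cdot>\<^bsub>Q\<^esub> x1')" using b 1 y2 x1 by (simp add: Q.comp_assoc del: Obj_Q)
  also have "\<dots> = (y2' \<cdot>\<^bsub>Q\<^esub> f') \<cdot>\<^bsub>Q\<^esub> (a \<cdot>\<^bsub>Q\<^esub> x1')" unfolding ab(3) using a 2 y2 x1 by (simp add: Q.comp_assoc)
  also have "\<dots> = cl f2 \<cdot>\<^bsub>Q\<^esub> a1" unfolding e2 a1_def using a 2 x2 x1 by (simp add: Q.comp_assoc)
  finally have sq: "b1 \<cdot>\<^bsub>Q\<^esub> cl f1 = cl f2 \<cdot>\<^bsub>Q\<^esub> a1" .
  obtain a0 where a0: "arr a0" "src a0 = A1" "tgt a0 = A2" "a1 = cl a0" using ta by (metis Q_arrE)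
  obtain b0 where b0: "arr b0" "src b0 = B1" "tgt b0 = B2" "b1 = cl b0" using tb by (metis Q_arrE)
  note T = t(1)[unfolded mtri_def] t'(1)[unfolded mtri_def]
  have "cl (b0 \<cdot> f1) = cl (f2 \<cdot> a0)" using sq unfolding a0(4) b0(4) using a0 b0 T by (simp add: Comp_Q)
  then obtain c where "sextuple_mor Q susp (A1, B1, D1, cl f1, cl g1, cl (neg k1))
      (A2, B2, D2, cl f2, cl g2, cl (neg k2)) a1 b1 (cl c)"
    using mtri_fill[OF t(1) t'(1), of a0 b0] a0 b0 by auto
  from Q.sextuple_mor_Comp[OF Q.sextuple_mor_Comp[OF m1(1) this] m2(1)]
  obtain c' where c': "sextuple_mor Q susp (A, B, D, f, g, h) (A', B', D', f', g', h')
      (x2 \<cdot>\<^bsub>Q\<^esub> (a1 \<cdot>\<^bsub>Q\<^esub> x1)) (y2 \<cdot>\<^bsub>Q\<^esub> (b1 \<cdot>\<^bsub>Q\<^esub> y1)) c'"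
    by blast
  have "x2 \<cdot>\<^bsub>Q\<^esub> (a1 \<cdot>\<^bsub>Q\<^esub> x1) = a"
    unfolding a1_def using a x1 x2 1 2
    by (simp add: Q.comp_assoc Q.comp_reassoc[OF x1(4)] Q.comp_reassoc[OF x2(5)] del: Id_Q)
  moreover have "y2 \<cdot>\<^bsub>Q\<^esub> (b1 \<cdot>\<^bsub>Q\<^esub> y1) = b"
    unfolding b1_def using b y1 y2 1 2
    by (simp add: Q.comp_assoc Q.comp_reassoc[OF y1(4)] Q.comp_reassoc[OF y2(5)] del: Id_Q)
  ultimately show "\<exists>c. sextuple_mor Q susp (A, B, D, f, g, h) (A', B', D', f', g', h') a b c"
    using c' by auto
next
  fix A B D f g h u
  assume s: "(A, B, D, f, g, h) \<in> dist" and u: "Q.arr u" "Q.src u = D" "u \<cdot>\<^bsub>Q\<^esub> g = Zero Q B (Q.tgt u)"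
  obtain A1 B1 D1 f1 g1 h1 where t: "std A1 B1 D1 f1 g1 h1"
    "sextuple_isomorphic Q susp (A, B, D, f, g, h) (A1, B1, D1, cl f1, cl g1, cl h1)"
    using s unfolding dist_iff by blast
  obtain x y z where m: "sextuple_mor Q susp (A, B, D, f, g, h) (A1, B1, D1, cl f1, cl g1, cl h1) x y z"
    "isomorphism Q B B1 y" "isomorphism Q D D1 z"
    using t(2) unfolding Q.sextuple_isomorphic_iff by blast
  note 1 = m(1)[unfolded Q.sextuple_mor_iff Q.sextuples_iff]
  obtain y' where y: "Q.arr y'" "Q.src y' = B1" "Q.tgt y' = B" "y' \<cdot>\<^bsub>Q\<^esub> y = Id Q B" "y \<cdot>\<^bsub>Q\<^esub> y' = Id Q B1"
    using m(2) by (elim Q.isomorphismE)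
  obtain z' where z: "Q.arr z'" "Q.src z' = D1" "Q.tgt z' = D" "z' \<cdot>\<^bsub>Q\<^esub> z = Id Q D" "z \<cdot>\<^bsub>Q\<^esub> z' = Id Q D1"
    using m(3) by (elim Q.isomorphismE)
  note T = t(1)[unfolded std_def]
  have tu: "Q.tgt u \<in> \<A>" using Q.arr_ends(2)[OF u(1)] by simp
  have "z' \<cdot>\<^bsub>Q\<^esub> cl g1 = g \<cdot>\<^bsub>Q\<^esub> y'"
    using Q.square_inverse[of z g "cl g1" y y' z'] 1 y z by simp
  then have "(u \<cdot>\<^bsub>Q\<^esub> z') \<cdot>\<^bsub>Q\<^esub> cl g1 = (u \<cdot>\<^bsub>Q\<^esub> g) \<cdot>\<^bsub>Q\<^esub> y'"
    using u(1,2) z y 1 by (simp add: Q.comp_assoc)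
  also have "\<dots> = Zero Q B1 (Q.tgt u)" unfolding u(3) using y 1 u(1) tu by (simp del: Zero_Q)
  finally have *: "(u \<cdot>\<^bsub>Q\<^esub> z') \<cdot>\<^bsub>Q\<^esub> cl g1 = Zero Q B1 (Q.tgt u)" .
  have uz: "Q.arr (u \<cdot>\<^bsub>Q\<^esub> z')" "Q.src (u \<cdot>\<^bsub>Q\<^esub> z') = D1" "Q.tgt (u \<cdot>\<^bsub>Q\<^esub> z') = Q.tgt u"
    using u z by simp_all
  then obtain v where v: "arr v" "src v = D1" "tgt v = Q.tgt u" "u \<cdot>\<^bsub>Q\<^esub> z' = cl v" by (metis Q_arrE)
  have "cl (v \<cdot> g1) = cl (Zero C B1 (Q.tgt u))"
    using * tu v T std_in_\<A>[OF t(1)] unfolding v(4) by (simp add: Comp_Q)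
  then have "null (v \<cdot> g1)" using cl_eq_iff[of "v \<cdot> g1" "Zero C B1 (Q.tgt u)"] v T tu by simp
  then obtain m0 where m0: "arr m0" "src m0 = \<Sigma> A1" "tgt m0 = Q.tgt u" "cl v = cl (m0 \<cdot> h1)"
    using std_weak_cokernel[OF t(1), of v] v tu by auto
  have "u = (u \<cdot>\<^bsub>Q\<^esub> z') \<cdot>\<^bsub>Q\<^esub> z" using u z 1 by (simp add: Q.comp_assoc del: Id_Q)
  also have "\<dots> = (cl m0 \<cdot>\<^bsub>Q\<^esub> cl h1) \<cdot>\<^bsub>Q\<^esub> z"
    using v(4) m0 T tu std_in_\<A>[OF t(1)] by (simp add: Comp_Q)
  also have "\<dots> = (cl m0 \<cdot>\<^bsub>Q\<^esub> mor susp x) \<cdot>\<^bsub>Q\<^esub> h"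
    using 1 m0 T tu std_in_\<A>[OF t(1)] by (simp add: Q.comp_assoc)
  finally have u': "u = (cl m0 \<cdot>\<^bsub>Q\<^esub> mor susp x) \<cdot>\<^bsub>Q\<^esub> h" .
  show "\<exists>m. Q.arr m \<and> Q.src m = ob susp A \<and> Q.tgt m = Q.tgt u \<and> u = m \<cdot>\<^bsub>Q\<^esub> h"
    by (intro exI[of _ "cl m0 \<cdot>\<^bsub>Q\<^esub> mor susp x"] conjI u') (use 1 m0(1-3) T tu in simp_all)
qed

end

sublocale suspended_category \<subseteq> Q: weak_right_triangles "subfactor C \<A> \<X>" susp dist
  by (rule weak_right_triangles_dist)

context suspended_category
begin

text \<open>The given triangle is compared with the monic triangle that \<open>std_model\<close>
  attaches to \<open>f\<close>. The fill-ins \<open>c\<close>, \<open>c'\<close> cover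
  \<open>?b\<close> and \<open>p\<close>; here \<open>p \<cdot> ?b\<close> is an identity in C, but
  \<open>?b \<cdot> p\<close> is one only modulo \<X>. Accordingly \<open>c' \<cdot> c\<close> is
  invertible in C, whereas \<open>c \<cdot> c'\<close> is shown invertible only in the subfactor
  category.\<close>

lemma mtri_in_dist:
  assumes t: "mtri A B D f g k" shows "(A, B, D, cl f, cl g, cl (neg k)) \<in> dist"
proof -
  note 1 = t[unfolded mtri_def]
  obtain S D' i j p q g' k' where d: "S \<in> \<A>"
    "arr i" "src i = B" "tgt i = S" "arr j" "src j = mid \<tau> A" "tgt j = S"
    "arr p" "src p = S" "tgt p = B" "arr q" "src q = S" "tgt q = mid \<tau> A"
    "p \<cdot> i = Id C B" "p \<cdot> j = Zero C (mid \<tau> A) B" "i \<cdot> p \<boxplus> j \<cdot> q = Id C S"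
    and m: "mtri A S D' (i \<cdot> f \<boxplus> j \<cdot> \<alpha> A) g' k'" and s: "std A B D' f (g' \<cdot> i) (neg k')"
    using std_model[of f A B] 1 by metis
  let ?f = "i \<cdot> f \<boxplus> j \<cdot> \<alpha> A"
  note 2 = m[unfolded mtri_def]
  obtain u where u: "arr u" "src u = B" "tgt u = mid \<tau> A" "\<alpha> A = u \<cdot> f"
    using monicD[of f "\<alpha> A"] 1 by auto
  \<comment> \<open>The correction \<open>j \<cdot> u\<close> makes \<open>?b \<cdot> f\<close>
    equal to the enlarged map; \<open>i\<close> alone would achieve this only modulo \<X>.\<close>
  let ?b = "i \<boxplus> j \<cdot> u"
  have b: "arr ?b" "src ?b = B" "tgt ?b = S" using d u(1-3) by simp_all
  have bf: "?b \<cdot> f = ?f"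
    unfolding u(4) using d u(1-3) 1 by (simp add: comp_add_left comp_assoc)
  have pf: "p \<cdot> ?f = f"
    using 1 d by (simp add: comp_add_right comp_reassoc[OF d(14)] comp_reassoc[OF d(15)])
  have pb: "p \<cdot> ?b = Id C B"
    using 1 d u(1-3) by (simp add: comp_add_right comp_reassoc[OF d(15)])
  have clb: "cl ?b = cl i"
    by (rule cl_eqI[OF _ _ _ _ nullI refl]) (use d u(1-3) 1 in simp_all)
  have "?b \<cdot> f = ?f \<cdot> Id C A" "p \<cdot> ?f = f \<cdot> Id C A" using bf pf 1 2 by simp_all
  then obtain c c' where c: "arr c" "src c = D" "tgt c = D'" "c \<cdot> g = g' \<cdot> ?b"
      "L (Id C A) (R (\<gamma> A) k) = R (R (\<gamma> A) k') c"
    and c': "arr c'" "src c' = D'" "tgt c' = D" "c' \<cdot> g' = g \<cdot> p"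
      "L (Id C A) (R (\<gamma> A) k') = R (R (\<gamma> A) k) c'"
    using tri_fill[of A B D f g "R (\<gamma> A) k" A S D' ?f g' "R (\<gamma> A) k'" "Id C A" ?b]
      tri_fill[of A S D' ?f g' "R (\<gamma> A) k'" A B D f g "R (\<gamma> A) k" "Id C A" p] 1 2 d b
    by auto
  have e: "R (\<gamma> A) k \<in> E D A" "R (\<gamma> A) k' \<in> E D' A"
    using tri_iff[of A B D f g "R (\<gamma> A) k"] tri_iff[of A S D' ?f g' "R (\<gamma> A) k'"] 1 2 by simp_all
  have ek: "R (\<gamma> A) (k' \<cdot> c) = R (\<gamma> A) k" "R (\<gamma> A) (k \<cdot> c') = R (\<gamma> A) k'"
    using c(1-3,5) c'(1-3,5) 1 2 e L_Id[of A D] L_Id[of A D'] R_Comp[of k' c A "\<gamma> A"] R_Comp[of k c' A "\<gamma> A"]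
    by simp_all
  have "isomorphism C D D (c' \<cdot> c)"
  proof -
    \<comment> \<open>\<open>c' \<cdot> c\<close> fixes the connecting element, so it differs from
      the identity by a map through \<open>g\<close>; it also fixes \<open>g\<close>, hence is
      unipotent.\<close>
    have "R (R (\<gamma> A) k) (c' \<cdot> c) = R (R (\<gamma> A) k) (Id C D)"
      using c(1-3,5) c'(1-3,5) 1 2 e L_Id[of A D] L_Id[of A D'] R_Id[of A D] R_Comp[of c' c A "R (\<gamma> A) k"]
      by simp
    then obtain v where v: "arr v" "src v = D" "tgt v = B" "c' \<cdot> c = Id C D \<boxplus> g \<cdot> v"
      using tri_exact_right[of A B D f g "R (\<gamma> A) k" "c' \<cdot> c" "Id C D"] c(1-3) c'(1-3) 1 by auto
    have "(c' \<cdot> c) \<cdot> g = (c' \<cdot> g') \<cdot> ?b" using c c'(1-3) 1 2 b by (simp add: comp_assoc)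
    also have "\<dots> = g" unfolding c'(4) using pb 1 d b by (simp add: comp_assoc)
    finally have "(c' \<cdot> c) \<cdot> g = g" .
    then show ?thesis using isomorphism_if_fixes_left[of "c' \<cdot> c" D g v] c(1-3) c'(1-3) v 1 by simp
  qed
  moreover have "isomorphism Q D' D' (cl (c \<cdot> c'))"
  proof (rule Q.endomorphism_iso[OF std_in_dist[OF s]])
    show "Q.arr (cl (c \<cdot> c'))" "Q.src (cl (c \<cdot> c')) = D'" "Q.tgt (cl (c \<cdot> c')) = D'"
      using c(1-3) c'(1-3) 2 by simp_all
    have "(c \<cdot> c') \<cdot> (g' \<cdot> i) = c \<cdot> ((c' \<cdot> g') \<cdot> i)" using c(1-3) c'(1-3) 1 2 d by (simp add: comp_assoc)
    also have "\<dots> = c \<cdot> g" unfolding c'(4) using c(1-3) 1 d by (simp add: comp_assoc)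
    finally have "cl ((c \<cdot> c') \<cdot> (g' \<cdot> i)) = cl g' \<cdot>\<^bsub>Q\<^esub> cl ?b" unfolding c(4) using 2 b 1 d(1) by (simp add: Comp_Q)
    also have "\<dots> = cl (g' \<cdot> i)" unfolding clb using 1 2 d by (simp add: Comp_Q)
    finally show "cl (c \<cdot> c') \<cdot>\<^bsub>Q\<^esub> cl (g' \<cdot> i) = cl (g' \<cdot> i)"
      using c(1-3) c'(1-3) 1 2 d by (simp add: Comp_Q)
    have "R (\<gamma> A) (k' \<cdot> (c \<cdot> c')) = R (R (\<gamma> A) (k' \<cdot> c)) c'"
      using c(1-3) c'(1-3) 1 2 R_Comp[of "k' \<cdot> c" c' A "\<gamma> A"] by (simp add: comp_assoc)
    also have "\<dots> = R (\<gamma> A) k'"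
      unfolding ek(1) using ek(2) c'(1-3) 1 2 R_Comp[of k c' A "\<gamma> A"] by simp
    finally have "cl (k' \<cdot> (c \<cdot> c')) = cl k'"
      using cl_eq_if_R_eq[of "k' \<cdot> (c \<cdot> c')" k' A] c(1-3) c'(1-3) 1 2 by simp
    then have "cl (neg (k' \<cdot> (c \<cdot> c'))) = cl (neg k')"
      using neg_Q[of "k' \<cdot> (c \<cdot> c')"] neg_Q[of k'] c(1-3) c'(1-3) 1 2 by simp
    then show "cl (neg k') \<cdot>\<^bsub>Q\<^esub> cl (c \<cdot> c') = cl (neg k')"
      using c(1-3) c'(1-3) 1 2 by (simp add: Comp_Q)
  qed
  ultimately have c_iso: "isomorphism Q D D' (cl c)"
    using Q.isomorphism_if_one_sided[of "cl c" D D' "cl c'" "cl c'"] cl_isomorphism[of D D "c' \<cdot> c"]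
      c(1-3) c'(1-3) 1 2 by (simp add: Comp_Q)
  have "cl (k' \<cdot> c) = cl k" using cl_eq_if_R_eq[OF _ _ _ _ _ _ ek(1)] c(1-3) 1 2 by simp
  then have "cl (neg (k' \<cdot> c)) = cl (neg k)"
    using neg_Q[of "k' \<cdot> c"] neg_Q[of k] c(1-3) 1 2 by simp
  moreover have "cl c \<cdot>\<^bsub>Q\<^esub> cl g = cl (g' \<cdot> i)"
  proof -
    have "cl c \<cdot>\<^bsub>Q\<^esub> cl g = cl g' \<cdot>\<^bsub>Q\<^esub> cl ?b"
      using c 1 2 b d(1) by (simp add: Comp_Q)
    then show ?thesis unfolding clb using 1 2 d by (simp add: Comp_Q)
  qed
  ultimately have "sextuple_isomorphic Q susp (A, B, D, cl f, cl g, cl (neg k))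
      (A, B, D', cl f, cl (g' \<cdot> i), cl (neg k'))"
    unfolding Q.sextuple_isomorphic_iff Q.sextuple_mor_iff Q.sextuples_iff
    using 1 2 d c(1-3) c_iso Q.isomorphism_Id[of A] Q.isomorphism_Id[of B]
    by (intro exI[of _ "cl (Id C A)"] exI[of _ "cl (Id C B)"] exI[of _ "cl c"])
      (simp add: Comp_Q Q.mor_of_Id[of A, simplified])
  then show ?thesis using dist_iso_closed[OF std_in_dist[OF s]] by blast
qed

lemma dist_embed:
  assumes "Q.arr \<phi>" "Q.src \<phi> = A" "Q.tgt \<phi> = B"
  shows "\<exists>D g h. (A, B, D, \<phi>, g, h) \<in> dist"
proof -
  obtain f where f: "arr f" "src f = A" "tgt f = B" "\<phi> = cl f" "A \<in> \<A>" "B \<in> \<A>"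
    using assms Q_arrE[OF assms(1)] by metis
  show ?thesis using std_model[OF f(1-3,5,6)] std_in_dist f(4) by metis
qed

text \<open>In a standard triangle the second map is monic, and the connecting element
  \<open>L f' (\<gamma> A')\<close> lifts along \<open>\<gamma> B'\<close> to a representative
  \<open>k\<close> of the suspension of \<open>f'\<close>. So the rotated sequence is a monic
  triangle, and its last map \<open>neg k\<close> carries exactly the sign that rotation
  demands.\<close>

lemma dist_rotate:
  assumes s: "(A, B, D, f, g, h) \<in> dist"
  shows "(B, D, \<Sigma> A, g, h, Q.neg (mor susp f)) \<in> dist"
proof -
  obtain A' B' D' f' g' h' where t: "std A' B' D' f' g' h'"
    "sextuple_isomorphic Q susp (A, B, D, f, g, h) (A', B', D', cl f', cl g', cl h')"
    using s unfolding dist_iff by blast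
  note 1 = t(1)[unfolded std_def] std_in_\<A>[OF t(1)]
  obtain k where k: "arr k" "src k = \<Sigma> A'" "tgt k = \<Sigma> B'" "L f' (\<gamma> A') = R (\<gamma> B') k" "mor susp (cl f') = cl k"
    using mor_suspE[of f' A' B'] 1 by auto
  have "mtri B' D' (\<Sigma> A') g' h' k"
    unfolding mtri_def using std_monic[OF t(1)] 1 k by simp
  then have r: "(B', D', \<Sigma> A', cl g', cl h', cl (neg k)) \<in> dist" by (rule mtri_in_dist)
  obtain x y z where m: "sextuple_mor Q susp (A, B, D, f, g, h) (A', B', D', cl f', cl g', cl h') x y z"
    "isomorphism Q A A' x" "isomorphism Q B B' y" "isomorphism Q D D' z"
    using t(2) unfolding Q.sextuple_isomorphic_iff by blast
  note 2 = m(1)[unfolded Q.sextuple_mor_iff Q.sextuples_iff]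
  have "mor susp y \<cdot>\<^bsub>Q\<^esub> mor susp f = mor susp (cl f') \<cdot>\<^bsub>Q\<^esub> mor susp x"
    using 2 Q.mor_comp[of f y] Q.mor_comp[of x "cl f'"] by simp
  moreover have nk: "cl (neg k) = Q.neg (cl k)" using k(1-3) 1 by simp
  ultimately have "mor susp y \<cdot>\<^bsub>Q\<^esub> Q.neg (mor susp f) = cl (neg k) \<cdot>\<^bsub>Q\<^esub> mor susp x"
    unfolding k(5) nk using 2 k(1-3) 1 by (simp del: neg_Q)
  moreover have "isomorphism Q (\<Sigma> A) (\<Sigma> A') (mor susp x)" using Q.isomorphism_mor[OF m(2)] by simp
  ultimately have "sextuple_isomorphic Q susp (B, D, \<Sigma> A, g, h, Q.neg (mor susp f))
      (B', D', \<Sigma> A', cl g', cl h', cl (neg k))"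
    unfolding Q.sextuple_isomorphic_iff Q.sextuple_mor_iff Q.sextuples_iff
    using 1 2 k(1-3) m(3,4)
    by (intro exI[of _ y] exI[of _ z] exI[of _ "mor susp x"]) simp
  then show ?thesis using dist_iso_closed[OF r] by blast
qed

lemma monic_Comp: assumes "monic f" "monic g" "src g = tgt f" shows "monic (g \<cdot> f)"
  unfolding monic_def
proof (intro conjI allI impI)
  have fg: "arr f" "arr g" using assms unfolding monic_def by simp_all
  show "arr (g \<cdot> f)" using fg assms by simp
  fix u assume u: "arr u \<and> src u = src (g \<cdot> f) \<and> tgt u \<in> \<X>"
  then obtain v where v: "arr v" "src v = tgt f" "tgt v = tgt u" "u = v \<cdot> f"
    using monicD[OF assms(1), of u] fg assms(3) by auto
  obtain w where w: "arr w" "src w = tgt g" "tgt w = tgt v" "v = w \<cdot> g"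
    using monicD[OF assms(2), of v] v(1-3) u assms(3) by auto
  have "u = w \<cdot> (g \<cdot> f)" unfolding v(4) w(4) using w(1-3) fg assms(3) by (simp add: comp_assoc)
  then show "\<exists>v. arr v \<and> src v = tgt (g \<cdot> f) \<and> tgt v = tgt u \<and> u = v \<cdot> (g \<cdot> f)"
    using w(1-3) v(3) fg assms(3) by (intro exI[of _ w]) simp
qed

text \<open>Enlarging the target by \<open>mid \<tau> A\<close> makes a representative monic; modulo
  \<X> the target changes only by an isomorphism.\<close>

lemma monic_model:
  assumes "Q.arr \<phi>" "Q.src \<phi> = A" "Q.tgt \<phi> = B"
  obtains f i S where "monic f" "src f = A" "tgt f = S" "S \<in> \<A>" "Q.arr i" "isomorphism Q B S i" "cl f = i \<cdot>\<^bsub>Q\<^esub> \<phi>"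
proof -
  obtain f where f: "arr f" "src f = A" "tgt f = B" "\<phi> = cl f" "A \<in> \<A>" "B \<in> \<A>"
    using assms Q_arrE[OF assms(1)] by metis
  obtain S D i j p q g k where d: "S \<in> \<A>"
    "arr i" "src i = B" "tgt i = S" "arr j" "src j = mid \<tau> A" "tgt j = S"
    "arr p" "src p = S" "tgt p = B" "arr q" "src q = S" "tgt q = mid \<tau> A"
    "p \<cdot> i = Id C B" "i \<cdot> p \<boxplus> j \<cdot> q = Id C S"
    and m: "mtri A S D (i \<cdot> f \<boxplus> j \<cdot> \<alpha> A) g k"
    using std_model[OF f(1-3,5,6)] by metis
  have "cl (i \<cdot> f \<boxplus> j \<cdot> \<alpha> A) = cl (i \<cdot> f)"
    by (rule cl_eqI[OF _ _ _ _ nullI refl]) (use d f in simp_all)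
  then show thesis
    using that[of "i \<cdot> f \<boxplus> j \<cdot> \<alpha> A" S "cl i"] m[unfolded mtri_def] cl_summand(1)[of i B S j p q] d f
    by (simp add: Comp_Q)
qed

text \<open>\<open>f\<close> is made monic first, then \<open>a\<close>, precomposed with
  \<open>v'\<close> so that it starts at the new target; the composite of the two representatives is
  monic as well. The octahedron of C on these representatives is moved back by
  \<open>octahedron_transfer\<close>.\<close>

lemma dist_octahedron:
  assumes t1: "(A, B, D, f, g, h) \<in> dist" and t2: "(B, X, Y, a, b, c) \<in> dist"
    and t3: "(A, X, Z, a \<cdot>\<^bsub>Q\<^esub> f, d, e) \<in> dist"
  shows "\<exists>s \<in> Hom Q D Z. \<exists>t \<in> Hom Q Z Y.
            s \<cdot>\<^bsub>Q\<^esub> g = d \<cdot>\<^bsub>Q\<^esub> a \<and> e \<cdot>\<^bsub>Q\<^esub> s = h \<and> t \<cdot>\<^bsub>Q\<^esub> d = b \<and>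
            c \<cdot>\<^bsub>Q\<^esub> t = mor susp f \<cdot>\<^bsub>Q\<^esub> e \<and> (D, Z, Y, s, t, mor susp g \<cdot>\<^bsub>Q\<^esub> c) \<in> dist"
proof -
  note T = Q.tri_iff[OF t1] Q.tri_iff[OF t2] Q.tri_iff[OF t3]
  have f: "Q.arr f" "Q.src f = A" "Q.tgt f = B" using T by simp_all
  obtain f1 v S where f1: "monic f1" "src f1 = A" "tgt f1 = S" "S \<in> \<A>" "Q.arr v" "isomorphism Q B S v"
    "cl f1 = v \<cdot>\<^bsub>Q\<^esub> f"
    using f by (rule monic_model)
  obtain v' where v': "Q.src v = B" "Q.tgt v = S" "Q.arr v'" "Q.src v' = S" "Q.tgt v' = B"
    "v' \<cdot>\<^bsub>Q\<^esub> v = Id Q B" "v \<cdot>\<^bsub>Q\<^esub> v' = Id Q S"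
    using f1(6) by (elim Q.isomorphismE)
  have av: "Q.arr (a \<cdot>\<^bsub>Q\<^esub> v')" "Q.src (a \<cdot>\<^bsub>Q\<^esub> v') = S" "Q.tgt (a \<cdot>\<^bsub>Q\<^esub> v') = X" using T v' by simp_all
  obtain a1 w U where a1: "monic a1" "src a1 = S" "tgt a1 = U" "U \<in> \<A>" "Q.arr w" "isomorphism Q X U w"
    "cl a1 = w \<cdot>\<^bsub>Q\<^esub> (a \<cdot>\<^bsub>Q\<^esub> v')"
    using av by (rule monic_model)
  have w: "Q.src w = X" "Q.tgt w = U" using a1(6) by (auto elim: Q.isomorphismE)
  have wa: "w \<cdot>\<^bsub>Q\<^esub> a = cl a1 \<cdot>\<^bsub>Q\<^esub> v"
    unfolding a1(7) using T v' f1(5) w a1(5) by (simp add: Q.comp_assoc del: Id_Q)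
  have A: "A \<in> \<A>" using T by simp
  have ar: "arr f1" "arr a1" using f1(1) a1(1) unfolding monic_def by simp_all
  have af: "monic (a1 \<cdot> f1)" "src (a1 \<cdot> f1) = A" "tgt (a1 \<cdot> f1) = U"
    using monic_Comp[OF f1(1) a1(1)] f1 a1 ar by simp_all
  obtain D1 g1 k1 where u1: "mtri A S D1 f1 g1 k1" using mtri_exists[OF f1(1-3) A f1(4)] .
  obtain Y1 b1 k2 where u2: "mtri S U Y1 a1 b1 k2" using mtri_exists[OF a1(1-3) f1(4) a1(4)] .
  obtain Z1 d1 k3 where u3: "mtri A U Z1 (a1 \<cdot> f1) d1 k3" using mtri_exists[OF af A a1(4)] .
  note U = u1[unfolded mtri_def] u2[unfolded mtri_def] u3[unfolded mtri_def]
  obtain s t where st: "arr s" "src s = D1" "tgt s = Z1" "arr t" "src t = Z1" "tgt t = Y1"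
    "s \<cdot> g1 = d1 \<cdot> a1" "R (R (\<gamma> A) k3) s = R (\<gamma> A) k1" "t \<cdot> d1 = b1"
    "R (R (\<gamma> S) k2) t = L f1 (R (\<gamma> A) k3)" "(D1, Z1, Y1, s, t, L g1 (R (\<gamma> S) k2)) \<in> \<Delta>"
    using tri_octahedron[of A S D1 f1 g1 "R (\<gamma> A) k1" U Y1 a1 b1 "R (\<gamma> S) k2" Z1 d1 "R (\<gamma> A) k3"] U
    by blast
  have e2: "R (\<gamma> S) k2 \<in> E Y1 S" using tri_iff[of S U Y1 a1 b1 "R (\<gamma> S) k2"] U by simp
  \<comment> \<open>For \<open>u\<close> into \<X>, the map \<open>u \<cdot> g1\<close> extends
    along the monic \<open>a1\<close>, so it kills the connecting element of the triangle on
    \<open>a1\<close>. Hence \<open>u\<close> kills the connecting element of the triangle on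
    \<open>s\<close>, and coexactness extends it along \<open>s\<close>.\<close>
  have ms: "monic s"
    unfolding monic_def
  proof (intro conjI allI impI)
    fix u assume u: "arr u \<and> src u = src s \<and> tgt u \<in> \<X>"
    then obtain x where x: "arr x" "src x = U" "tgt x = tgt u" "u \<cdot> g1 = x \<cdot> a1"
      using monicD[OF a1(1), of "u \<cdot> g1"] U st(2) by auto
    have "L (u \<cdot> g1) (R (\<gamma> S) k2) = N Y1 (tgt u)"
      using tri_coexact_left[of S U Y1 a1 b1 "R (\<gamma> S) k2" "u \<cdot> g1"] U u x st(2) by auto
    then have "L u (L g1 (R (\<gamma> S) k2)) = N Y1 (tgt u)"
      using L_Comp[of g1 u Y1 "R (\<gamma> S) k2"] U u st(2) e2 by simp
    then show "\<exists>v. arr v \<and> src v = tgt s \<and> tgt v = tgt u \<and> u = v \<cdot> s"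
      using tri_coexact_left[OF st(11), of u] u st(2,3) by simp
  qed (use st in simp)
  obtain k where k: "arr k" "src k = \<Sigma> S" "tgt k = \<Sigma> D1" "L g1 (\<gamma> S) = R (\<gamma> D1) k" "mor susp (cl g1) = cl k"
    using mor_suspE[of g1 S D1] U by auto
  obtain l where l: "arr l" "src l = \<Sigma> A" "tgt l = \<Sigma> S" "L f1 (\<gamma> A) = R (\<gamma> S) l" "mor susp (cl f1) = cl l"
    using mor_suspE[of f1 A S] U by auto
  \<comment> \<open>\<open>k\<close> represents the suspension of \<open>g1\<close>, so the
    octahedral triangle lifts to a monic triangle with \<open>k \<cdot> k2\<close>, whose negative
    is the connecting map that the axiom prescribes.\<close>
  have "L g1 (R (\<gamma> S) k2) = R (\<gamma> D1) (k \<cdot> k2)"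
    using L_R[of g1 k2 "\<gamma> S"] R_Comp[of k k2 D1 "\<gamma> D1"] k U by simp
  then have "mtri D1 Z1 Y1 s t (k \<cdot> k2)"
    unfolding mtri_def using st ms k U by simp
  then have oct: "(D1, Z1, Y1, cl s, cl t, cl (neg (k \<cdot> k2))) \<in> dist" by (rule mtri_in_dist)
  have "R (\<gamma> A) (k3 \<cdot> s) = R (\<gamma> A) k1" using st U R_Comp[of k3 s A "\<gamma> A"] by simp
  then have "cl (k3 \<cdot> s) = cl k1" using cl_eq_if_R_eq[of "k3 \<cdot> s" k1 A] st U by simp
  then have o2: "cl (neg k3) \<cdot>\<^bsub>Q\<^esub> cl s = cl (neg k1)"
    using neg_Q[of "k3 \<cdot> s"] neg_Q[of k1] st U by (simp add: Comp_Q)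
  have "R (\<gamma> S) (k2 \<cdot> t) = R (L f1 (\<gamma> A)) k3"
    using st U R_Comp[of k2 t S "\<gamma> S"] L_R[of f1 k3 "\<gamma> A"] by simp
  also have "\<dots> = R (\<gamma> S) (l \<cdot> k3)" using l U R_Comp[of l k3 S "\<gamma> S"] by simp
  finally have "cl (k2 \<cdot> t) = cl (l \<cdot> k3)" using cl_eq_if_R_eq[of "k2 \<cdot> t" "l \<cdot> k3" S] st U l by simp
  then have o4: "cl (neg k2) \<cdot>\<^bsub>Q\<^esub> cl t = mor susp (cl f1) \<cdot>\<^bsub>Q\<^esub> cl (neg k3)"
    unfolding l(5) using neg_Q[of "k2 \<cdot> t"] neg_Q[of "l \<cdot> k3"] st(1-6) U l(1-3) by (simp add: Comp_Q)
  have af': "cl a1 \<cdot>\<^bsub>Q\<^esub> cl f1 = cl (a1 \<cdot> f1)" using U by (simp add: Comp_Q)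
  have o13: "cl s \<cdot>\<^bsub>Q\<^esub> cl g1 = cl d1 \<cdot>\<^bsub>Q\<^esub> cl a1" "cl t \<cdot>\<^bsub>Q\<^esub> cl d1 = cl b1"
    using st U by (simp_all add: Comp_Q)
  have o5: "(D1, Z1, Y1, cl s, cl t, mor susp (cl g1) \<cdot>\<^bsub>Q\<^esub> cl (neg k2)) \<in> dist"
    using oct unfolding k(5) using k(1-3) U by (simp add: Comp_Q)
  have ty: "Q.arr (cl s)" "Q.src (cl s) = D1" "Q.tgt (cl s) = Z1"
    "Q.arr (cl t)" "Q.src (cl t) = Z1" "Q.tgt (cl t) = Y1"
    using st(1-6) U by simp_all
  have u3': "(A, U, Z1, cl a1 \<cdot>\<^bsub>Q\<^esub> cl f1, cl d1, cl (neg k3)) \<in> dist"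
    unfolding af' by (rule mtri_in_dist[OF u3])
  show ?thesis
    by (rule Q.octahedron_transfer[OF t1 t2 t3 mtri_in_dist[OF u1] mtri_in_dist[OF u2] u3' f1(6) a1(6)
      f1(7)[symmetric] wa ty o13(1) o2 o13(2) o4 o5])
qed

text \<open>A zero object of the subfactor category need not be zero in C, since objects of \<X>
  become zero. The triangle is therefore built on a zero object \<open>Z0\<close> of C and
  transported along the isomorphism of \<open>Z\<close> with \<open>Z0\<close>.\<close>

lemma dist_zero_triangle:
  assumes "A \<in> \<A>" "zero_object Q Z"
  shows "(Z, A, A, Zero Q Z A, Id Q A, Zero Q A (\<Sigma> Z)) \<in> dist"
proof -
  obtain Z0 where Z0: "zero_object C Z0" using ex_zero_object by blast
  then have Z0A: "Z0 \<in> \<A>" by (rule zero_object_\<A>)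
  have Z: "Z \<in> \<A>" using assms(2) unfolding zero_object_def by simp
  let ?f = "Zero C Z0 A"
  have "monic ?f"
    unfolding monic_def
  proof (intro conjI allI impI)
    show "arr ?f" using Z0A assms by simp
    fix u assume u: "arr u \<and> src u = src ?f \<and> tgt u \<in> \<X>"
    then have "u = Zero C Z0 (tgt u)" using zero_object_arr[OF Z0, of u] Z0A assms by simp
    then show "\<exists>v. arr v \<and> src v = tgt ?f \<and> tgt v = tgt u \<and> u = v \<cdot> ?f"
      using u Z0A assms by (intro exI[of _ "Zero C A (tgt u)"]) auto
  qed
  moreover obtain e where "(Z0, A, A, ?f, Id C A, e) \<in> \<Delta>"
  proof -
    have "Id C Z0 = Zero C Z0 Z0" using zero_object_arr[OF Z0, of "Id C Z0"] Z0A by simp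
    \<comment> \<open>\<open>A\<close> is the direct sum of \<open>Z0\<close> and \<open>A\<close>,
      and the corresponding split triangle is the one wanted.\<close>
    then show thesis
      using tri_split[of Z0 A A ?f "Id C A" "Zero C A Z0" "Id C A"] that Z0A assms by auto
  qed
  ultimately obtain k where k: "mtri Z0 A A ?f (Id C A) k" using mtriI Z0A assms(1) by blast
  note 1 = k[unfolded mtri_def]
  have t: "(Z0, A, A, cl ?f, cl (Id C A), cl (neg k)) \<in> dist" by (rule mtri_in_dist[OF k])
  have ZQ: "zero_object Q Z0" by (rule Q_zero_object[OF Z0])
  have "zero_object Q (\<Sigma> Z)" "zero_object Q (\<Sigma> Z0)"
    using Q.zero_object_ob[OF assms(2)] Q.zero_object_ob[OF ZQ] by simp_all
  then have k0: "cl (neg k) = Zero Q A (\<Sigma> Z0)"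
    using Q.zero_object_arr[of "\<Sigma> Z0" "cl (neg k)"] 1 by simp
  let ?x = "Zero Q Z Z0" and ?y = "Zero Q Z0 Z"
  have "?y \<cdot>\<^bsub>Q\<^esub> ?x = Id Q Z" "?x \<cdot>\<^bsub>Q\<^esub> ?y = Id Q Z0"
    using Q.zero_object_arr[OF assms(2), of "Id Q Z"] Q.zero_object_arr[OF ZQ, of "Id Q Z0"] Z Z0A
    by (simp_all del: Id_Q Zero_Q)
  then have "isomorphism Q Z Z0 ?x"
    using Q.isomorphismI[of ?x ?y] Z Z0A by (simp del: Id_Q Zero_Q)
  then have "sextuple_isomorphic Q susp (Z, A, A, Zero Q Z A, Id Q A, Zero Q A (\<Sigma> Z))
      (Z0, A, A, cl ?f, cl (Id C A), cl (neg k))"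
    unfolding Q.sextuple_isomorphic_iff Q.sextuple_mor_iff Q.sextuples_iff k0
      Zero_Q[OF Z0A assms(1), symmetric] Id_Q[OF assms(1), symmetric]
    using Z Z0A assms(1) Q.isomorphism_Id[of A] Q.mor_Zero[of Z Z0]
    by (intro exI[of _ ?x] exI[of _ "Id Q A"]) (simp del: Id_Q Zero_Q)
  then show ?thesis using dist_iso_closed[OF t] by blast
qed

theorem right_triangulated_dist: "right_triangulated_category Q susp dist"
proof (intro right_triangulated_category.intro triangle_class.intro triangle_class_axioms.intro
    right_triangulated_category_axioms.intro additive_Q susp_functor)
  show "dist \<subseteq> sextuples Q susp" by (rule Q.tri_sextuples)
  show "s' \<in> dist" if "s \<in> dist" "sextuple_isomorphic Q susp s s'" for s s'
    using Q.tri_iso_closed that by blast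
  show "\<exists>D g h. (A, B, D, f, g, h) \<in> dist" if "A \<in> Obj Q" "B \<in> Obj Q" "f \<in> Hom Q A B" for A B f
    using dist_embed that Q.in_Hom_iff by blast
  show "(B, D, ob susp A, g, h, \<ominus>\<^bsub>hom_group Q (ob susp A) (ob susp B)\<^esub> mor susp f) \<in> dist"
    if "(A, B, D, f, g, h) \<in> dist" for A B D f g h
    using dist_rotate[OF that] Q.tri_iff[OF that] Q.a_inv_eq_neg[of "\<Sigma> A" "\<Sigma> B" "mor susp f"]
    by (simp add: Q.in_Hom_iff)
  show "\<exists>c. sextuple_mor Q susp (A, B, D, f, g, h) (A', B', D', f', g', h') a b c"
    if "(A, B, D, f, g, h) \<in> dist" "(A', B', D', f', g', h') \<in> dist" "a \<in> Hom Q A A'" "b \<in> Hom Q B B'"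
      "b \<cdot>\<^bsub>Q\<^esub> f = f' \<cdot>\<^bsub>Q\<^esub> a" for A B D f g h A' B' D' f' g' h' a b
    using Q.tri_fill that by blast
  show "(Z, A, A, Zero Q Z A, Id Q A, Zero Q A (ob susp Z)) \<in> dist"
    if "A \<in> Obj Q" "zero_object Q Z" for A Z
    using dist_zero_triangle that by simp
qed (rule dist_octahedron)

end


section \<open>Triangulated categories\<close>

context triangulated_category
begin

lemma tri_typing: "(A, B, D, f, g, h) \<in> \<Delta> \<Longrightarrow> A \<in> Obj C \<and> B \<in> Obj C \<and> D \<in> Obj C \<and>
     arr f \<and> src f = A \<and> tgt f = B \<and> arr g \<and> src g = B \<and> tgt g = D \<and>
     arr h \<and> src h = D \<and> tgt h = ob F A"
  using \<Delta>_sextuples sextuples_iff by blast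

lemma rotation: assumes "(A, B, D, f, g, h) \<in> \<Delta>" shows "(B, D, ob F A, g, h, neg (mor F f)) \<in> \<Delta>"
  using rotate[OF assms] tri_typing[OF assms] a_inv_eq_neg[of "ob F A" "ob F B" "mor F f"]
  by (simp add: in_Hom_iff)

lemma back_rotation:
  assumes "(B, D, ob F A, g, h, k) \<in> \<Delta>" "arr f" "src f = A" "tgt f = B" "k = neg (mor F f)"
  shows "(A, B, D, f, g, h) \<in> \<Delta>"
proof (rule rotate_back)
  have A: "A \<in> Obj C" using assms by auto
  then show "(A, B, D, f, g, h) \<in> sextuples C F"
    using tri_typing[OF assms(1)] assms by (simp add: sextuples_iff)
  show "(B, D, ob F A, g, h, \<ominus>\<^bsub>hom_group C (ob F A) (ob F B)\<^esub> mor F f) \<in> \<Delta>"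
    using assms A tri_typing[OF assms(1)] a_inv_eq_neg[of "ob F A" "ob F B" "mor F f"]
    by (simp add: in_Hom_iff)
qed

lemma filling:
  assumes t: "(A, B, D, f, g, h) \<in> \<Delta>" and t': "(A', B', D', f', g', h') \<in> \<Delta>"
    and a: "arr a" "src a = A" "tgt a = A'" and b: "arr b" "src b = B" "tgt b = B'" and "b \<cdot> f = f' \<cdot> a"
  shows "\<exists>c. arr c \<and> src c = D \<and> tgt c = D' \<and> c \<cdot> g = g' \<cdot> b \<and> mor F a \<cdot> h = h' \<cdot> c"
  using fill[OF t t', of a b] assms(3-9) tri_typing[OF t] tri_typing[OF t']
  unfolding sextuple_mor_iff by (auto simp: in_Hom_iff)

lemma mor_full:
  assumes "arr v" "src v = ob F A" "tgt v = ob F B" "A \<in> Obj C" "B \<in> Obj C"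
  shows "\<exists>u. arr u \<and> src u = A \<and> tgt u = B \<and> v = mor F u"
proof -
  have "v \<in> mor F ` Hom C A B"
    using fully_faithful[OF assms(4,5)] assms by (simp add: bij_betw_def in_Hom_iff)
  then show ?thesis using assms(4,5) by (auto simp: in_Hom_iff)
qed

lemma mor_inject:
  assumes "mor F u = mor F v" "arr u" "arr v" "src v = src u" "tgt v = tgt u" shows "u = v"
proof (rule inj_onD)
  show "inj_on (mor F) (Hom C (src u) (tgt u))"
    using fully_faithful[of "src u" "tgt u"] assms(2) by (simp add: bij_betw_def)
  show "mor F u = mor F v" by (rule assms(1))
  show "u \<in> Hom C (src u) (tgt u)" "v \<in> Hom C (src u) (tgt u)"
    using assms(2-5) by (simp_all add: in_Hom_iff)
qed

text \<open>The isomorphism is minus the identity on the middle object. It disposes of signs created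
  by rotations.\<close>

lemma tri_neg: assumes "(A, B, D, f, g, h) \<in> \<Delta>" shows "(A, B, D, neg f, neg g, h) \<in> \<Delta>"
proof (rule \<Delta>_iso_closed[OF assms])
  show "sextuple_isomorphic C F (A, B, D, f, g, h) (A, B, D, neg f, neg g, h)"
    unfolding sextuple_isomorphic_iff sextuple_mor_iff sextuples_iff
    using tri_typing[OF assms]
    by (intro exI[of _ "Id C A"] exI[of _ "neg (Id C B)"] exI[of _ "Id C D"])
      (simp add: isomorphism_Id isomorphism_neg_Id)
qed

text \<open>The identity triangle on \<open>A\<close> maps to the given one along the identity and
  \<open>f\<close>; hence \<open>g \<cdot> f\<close> passes through a zero object.\<close>

lemma comp_eq_Zero: assumes t: "(A, B, D, f, g, h) \<in> \<Delta>" shows "g \<cdot> f = Zero C A D"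
proof -
  obtain Z where Z: "zero_object C Z" using ex_zero_object by blast
  then have ZO: "Z \<in> Obj C" unfolding zero_object_def by simp
  note 1 = tri_typing[OF t]
  obtain c where "arr c" "src c = Z" "c \<cdot> Zero C A Z = g \<cdot> f" "tgt c = D"
    using filling[OF identity_triangle[OF _ Z] t, of A "Id C A" f] 1 by auto
  then show ?thesis using 1 by simp
qed

section \<open>Exactness of the Hom sequences of a triangle\<close>

lemma mor_comp_eq_Zero: assumes t: "(A, B, D, f, g, h) \<in> \<Delta>" shows "mor F f \<cdot> h = Zero C D (ob F B)"
  using comp_eq_Zero[OF rotation[OF rotation[OF t]]] tri_typing[OF t]
    neg_neg[of "mor F f \<cdot> h"] by simp

text \<open>The zero map and \<open>u\<close> form a commuting square into the triangle that starts
  with the map from a zero object to \<open>tgt u\<close>; the third component of a fill-in is the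
  factor.\<close>

lemma coexact_middle:
  assumes t: "(A, B, D, f, g, h) \<in> \<Delta>" and u: "arr u" "src u = B" "u \<cdot> f = Zero C A (tgt u)"
  shows "\<exists>v. arr v \<and> src v = D \<and> tgt v = tgt u \<and> u = v \<cdot> g"
proof -
  obtain Z where Z: "zero_object C Z" using ex_zero_object by blast
  then have ZO: "Z \<in> Obj C" unfolding zero_object_def by simp
  note 1 = tri_typing[OF t]
  let ?X = "tgt u"
  \<comment> \<open>The zero object is taken of the form \<open>ob F Z\<close> because rotating back
    needs a third object in the image of the shift.\<close>
  have "(?X, ?X, ob F Z, Id C ?X, Zero C ?X (ob F Z), Zero C (ob F Z) (ob F ?X)) \<in> \<Delta>"
    using identity_triangle[OF _ zero_object_ob[OF Z]] u by simp
  then have "(Z, ?X, ?X, Zero C Z ?X, Id C ?X, Zero C ?X (ob F Z)) \<in> \<Delta>"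
    by (rule back_rotation) (use ZO u in simp_all)
  from filling[OF t this, of "Zero C A Z" u] obtain v where "arr v" "src v = D" "tgt v = ?X" "v \<cdot> g = Id C ?X \<cdot> u"
    using 1 u ZO by auto
  then show ?thesis using u by auto
qed

text \<open>For the existence of \<open>v\<close>, two rotations reduce to
  \<open>coexact_middle\<close> for \<open>mor F u\<close>; fullness and faithfulness bring the
  factor back, up to the sign of the rotation.\<close>

lemma coexact_left:
  assumes t: "(A, B, D, f, g, h) \<in> \<Delta>" and u: "arr u" "src u = A"
  shows "mor F u \<cdot> h = Zero C D (ob F (tgt u)) \<longleftrightarrow> (\<exists>v. arr v \<and> src v = B \<and> tgt v = tgt u \<and> u = v \<cdot> f)"
proof
  note 1 = tri_typing[OF t]
  assume "mor F u \<cdot> h = Zero C D (ob F (tgt u))"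
  then obtain w where w: "arr w" "src w = ob F B" "tgt w = ob F (tgt u)" "mor F u = w \<cdot> neg (mor F f)"
    using coexact_middle[OF rotation[OF rotation[OF t]], of "mor F u"] u by auto
  obtain v where v: "arr v" "src v = B" "tgt v = tgt u" "w = mor F v"
    using mor_full[OF w(1-3)] 1 u by auto
  have "mor F u = mor F (neg v \<cdot> f)" unfolding w(4) v(4) using 1 v(1-3) by (simp add: mor_comp)
  then have "u = neg v \<cdot> f" using mor_inject[of u "neg v \<cdot> f"] 1 v(1-3) u by simp
  then show "\<exists>v. arr v \<and> src v = B \<and> tgt v = tgt u \<and> u = v \<cdot> f"
    using v(1-3) by (intro exI[of _ "neg v"]) simp
next
  note 1 = tri_typing[OF t]
  assume "\<exists>v. arr v \<and> src v = B \<and> tgt v = tgt u \<and> u = v \<cdot> f"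
  then obtain v where v: "arr v" "src v = B" "tgt v = tgt u" "u = v \<cdot> f" by blast
  have "mor F u \<cdot> h = mor F v \<cdot> (mor F f \<cdot> h)" unfolding v(4) using v(1-3) 1 by (simp add: mor_comp comp_assoc)
  then show "mor F u \<cdot> h = Zero C D (ob F (tgt u))"
    using mor_comp_eq_Zero[OF t] v(1-3) 1 by simp
qed

text \<open>A fill-in from the rotated identity triangle of \<open>src u\<close> to the rotated
  given triangle has a third component of the form \<open>mor F v\<close>, and this \<open>v\<close>
  is the factor.\<close>

lemma exact_middle:
  assumes t: "(A, B, D, f, g, h) \<in> \<Delta>" and u: "arr u" "tgt u = B" "g \<cdot> u = Zero C (src u) D"
  shows "\<exists>v. arr v \<and> src v = src u \<and> tgt v = A \<and> u = f \<cdot> v"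
proof -
  obtain Z where Z: "zero_object C Z" using ex_zero_object by blast
  then have ZO: "Z \<in> Obj C" unfolding zero_object_def by simp
  note 1 = tri_typing[OF t]
  let ?X = "src u"
  have "(?X, Z, ob F ?X, Zero C ?X Z, Zero C Z (ob F ?X), neg (mor F (Id C ?X))) \<in> \<Delta>"
    using rotation[OF identity_triangle[OF _ Z]] u by simp
  from filling[OF this rotation[OF t], of u "Zero C Z D"]
  obtain w where w: "arr w" "src w = ob F ?X" "tgt w = ob F A"
    "mor F u \<cdot> neg (mor F (Id C ?X)) = neg (mor F f) \<cdot> w"
    using 1 u ZO by auto
  obtain v where v: "arr v" "src v = ?X" "tgt v = A" "w = mor F v"
    using mor_full[OF w(1-3)] 1 u by auto
  have "mor F u = mor F (f \<cdot> v)"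
    using w(4) 1 v(1-3) u unfolding v(4) by (simp add: mor_comp)
  then have "u = f \<cdot> v" using mor_inject[of u "f \<cdot> v"] 1 v(1-3) u by simp
  then show ?thesis using v by blast
qed

lemma exact_right:
  assumes t: "(A, B, D, f, g, h) \<in> \<Delta>" and u: "arr u" "arr u'" "tgt u = D" "tgt u' = D" "src u' = src u"
    and eq: "h \<cdot> u = h \<cdot> u'"
  shows "\<exists>v. arr v \<and> src v = src u \<and> tgt v = B \<and> u = u' \<boxplus> g \<cdot> v"
proof -
  note 1 = tri_typing[OF t]
  have "h \<cdot> (u \<boxplus> neg u') = Zero C (src u) (ob F A)"
    using 1 u eq by (simp add: comp_add_right)
  then obtain v where v: "arr v" "src v = src u" "tgt v = B" "u \<boxplus> neg u' = g \<cdot> v"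
    using exact_middle[OF rotation[OF t], of "u \<boxplus> neg u'"] u by auto
  have "u = u' \<boxplus> g \<cdot> v" by (rule iffD2[OF eq_add_iff]) (use v 1 u in simp_all)
  then show ?thesis using v by blast
qed

lemma coexact_right:
  assumes t: "(A, B, D, f, g, h) \<in> \<Delta>" and u: "arr u" "tgt u = D"
  shows "h \<cdot> u = Zero C (src u) (ob F A) \<longleftrightarrow> (\<exists>v. arr v \<and> src v = src u \<and> tgt v = B \<and> u = g \<cdot> v)"
proof
  assume "h \<cdot> u = Zero C (src u) (ob F A)"
  then show "\<exists>v. arr v \<and> src v = src u \<and> tgt v = B \<and> u = g \<cdot> v"
    by (rule exact_middle[OF rotation[OF t] u])
next
  note 1 = tri_typing[OF t]
  assume "\<exists>v. arr v \<and> src v = src u \<and> tgt v = B \<and> u = g \<cdot> v"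
  then obtain v where v: "arr v" "src v = src u" "tgt v = B" "u = g \<cdot> v" by blast
  have "h \<cdot> u = (h \<cdot> g) \<cdot> v" unfolding v(4) using v(1-3) 1 by (simp add: comp_assoc)
  then show "h \<cdot> u = Zero C (src u) (ob F A)"
    using comp_eq_Zero[OF rotation[OF t]] v(1-3) 1 by simp
qed

lemma exact_left:
  assumes t: "(A, B, D, f, g, h) \<in> \<Delta>" and u: "arr u" "arr u'" "src u = A" "src u' = A" "tgt u' = tgt u"
    and eq: "mor F u \<cdot> h = mor F u' \<cdot> h"
  shows "\<exists>v. arr v \<and> src v = B \<and> tgt v = tgt u \<and> u = u' \<boxplus> v \<cdot> f"
proof -
  note 1 = tri_typing[OF t]
  have "mor F (u \<boxplus> neg u') \<cdot> h = Zero C D (ob F (tgt u))"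
    using 1 u eq by (simp add: mor_add comp_add_left)
  then obtain v where v: "arr v" "src v = B" "tgt v = tgt u" "u \<boxplus> neg u' = v \<cdot> f"
    using coexact_left[OF t, of "u \<boxplus> neg u'"] u by auto
  have "u = u' \<boxplus> v \<cdot> f" by (rule iffD2[OF eq_add_iff]) (use v 1 u in simp_all)
  then show ?thesis using v by blast
qed

text \<open>After two rotations the unknown middle map is the third component of a fill-in over
  identities; fullness writes it as \<open>mor F b\<close>, and faithfulness removes the shift from
  both squares.\<close>

lemma middle_filling:
  assumes t: "(A, B, D, f, g, h) \<in> \<Delta>" and t': "(A, B', D, f', g', h) \<in> \<Delta>"
  shows "\<exists>b. arr b \<and> src b = B \<and> tgt b = B' \<and> b \<cdot> f = f' \<and> g' \<cdot> b = g"
proof -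
  note 1 = tri_typing[OF t] tri_typing[OF t']
  obtain c where c: "arr c" "src c = ob F B" "tgt c = ob F B'"
    "c \<cdot> neg (mor F f) = neg (mor F f') \<cdot> Id C (ob F A)"
    "mor F (Id C D) \<cdot> neg (mor F g) = neg (mor F g') \<cdot> c"
    using filling[OF rotation[OF rotation[OF t]] rotation[OF rotation[OF t']], of "Id C D" "Id C (ob F A)"] 1
    by auto
  obtain b where b: "arr b" "src b = B" "tgt b = B'" "c = mor F b"
    using mor_full[OF c(1-3)] 1 by auto
  have "mor F (b \<cdot> f) = mor F f'" "mor F (g' \<cdot> b) = mor F g"
    using c(4,5) 1 b(1-3) unfolding b(4) by (simp_all add: mor_comp)
  then have "b \<cdot> f = f'" "g' \<cdot> b = g"
    using mor_inject[of "b \<cdot> f" f'] mor_inject[of "g' \<cdot> b" g] 1 b(1-3) by simp_all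
  then show ?thesis using b by blast
qed

lemma left_filling:
  assumes t: "(A, B, D, f, g, h) \<in> \<Delta>" and t': "(A', B', D', f', g', h') \<in> \<Delta>"
    and b: "arr b" "src b = B" "tgt b = B'" and c: "arr c" "src c = D" "tgt c = D'" and "c \<cdot> g = g' \<cdot> b"
  shows "\<exists>a. arr a \<and> src a = A \<and> tgt a = A' \<and> b \<cdot> f = f' \<cdot> a \<and> mor F a \<cdot> h = h' \<cdot> c"
proof -
  note 1 = tri_typing[OF t] tri_typing[OF t']
  obtain x where x: "arr x" "src x = ob F A" "tgt x = ob F A'" "x \<cdot> h = h' \<cdot> c"
    "mor F b \<cdot> neg (mor F f) = neg (mor F f') \<cdot> x"
    using filling[OF rotation[OF t] rotation[OF t'] b c assms(9)] by blast
  obtain a where a: "arr a" "src a = A" "tgt a = A'" "x = mor F a"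
    using mor_full[OF x(1-3)] 1 by auto
  have "mor F (b \<cdot> f) = mor F (f' \<cdot> a)"
    using x(5) 1 a(1-3) b unfolding a(4) by (simp add: mor_comp)
  then have "b \<cdot> f = f' \<cdot> a" using mor_inject[of "b \<cdot> f" "f' \<cdot> a"] 1 a(1-3) b by simp
  then show ?thesis using a x(4) by blast
qed

lemma cone_exists: "arr f \<Longrightarrow> \<exists>D g h. (src f, tgt f, D, f, g, h) \<in> \<Delta>"
  using embed[of "src f" "tgt f" f] arr_in_Hom[of f] by simp

text \<open>Essential surjectivity replaces the cone of \<open>g\<close> by an isomorphic object
  \<open>ob F A\<close>; only then can the triangle be rotated back.\<close>

lemma cocone_exists:
  assumes g: "arr g" shows "\<exists>A f h. (A, src g, tgt g, f, g, h) \<in> \<Delta>"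
proof -
  let ?B = "src g" and ?D = "tgt g"
  obtain Y h k where t: "(?B, ?D, Y, g, h, k) \<in> \<Delta>" using cone_exists[OF g] by blast
  note 1 = tri_typing[OF t]
  obtain A x where A: "A \<in> Obj C" "isomorphism C (ob F A) Y x"
    using essentially_surjective[of Y] 1 unfolding isomorphic_def by blast
  obtain y where x: "arr x" "src x = ob F A" "tgt x = Y" "arr y" "src y = Y" "tgt y = ob F A"
    "y \<cdot> x = Id C (ob F A)" "x \<cdot> y = Id C Y"
    using A(2) by (elim isomorphismE)
  have iy: "isomorphism C Y (ob F A) y" using isomorphismI[of y x] x by simp
  have "sextuple_isomorphic C F (?B, ?D, Y, g, h, k) (?B, ?D, ob F A, g, y \<cdot> h, k \<cdot> x)"
    unfolding sextuple_isomorphic_iff sextuple_mor_iff sextuples_iff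
    using 1 x iy A(1)
    by (intro exI[of _ "Id C ?B"] exI[of _ "Id C ?D"] exI[of _ y])
      (simp add: isomorphism_Id comp_assoc)
  then have t': "(?B, ?D, ob F A, g, y \<cdot> h, k \<cdot> x) \<in> \<Delta>" using \<Delta>_iso_closed[OF t] by blast
  obtain f where f: "arr f" "src f = A" "tgt f = ?B" "k \<cdot> x = mor F f"
    using mor_full[of "k \<cdot> x" A ?B] 1 x A(1) by auto
  have "(A, ?B, ?D, neg f, g, y \<cdot> h) \<in> \<Delta>"
    using back_rotation[OF t', of "neg f"] f by simp
  then show ?thesis by blast
qed

text \<open>In any triangle on \<open>i\<close> the connecting map \<open>e\<close> vanishes, since
  \<open>i\<close> has the retraction \<open>p\<close>. The factor \<open>v\<close> of
  \<open>q\<close> through \<open>g\<close> has the inverse \<open>g \<cdot> j\<close>: one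
  composite is \<open>q \<cdot> j\<close>, the other differs from the identity by some
  \<open>m \<cdot> e\<close>.\<close>

lemma split_triangle:
  assumes d: "A \<in> Obj C" "B \<in> Obj C" "D \<in> Obj C"
    "arr i" "src i = A" "tgt i = D" "arr j" "src j = B" "tgt j = D"
    "arr p" "src p = D" "tgt p = A" "arr q" "src q = D" "tgt q = B"
    "p \<cdot> i = Id C A" "q \<cdot> j = Id C B" "q \<cdot> i = Zero C A B" "p \<cdot> j = Zero C B A"
    "i \<cdot> p \<boxplus> j \<cdot> q = Id C D"
  shows "(A, D, B, i, q, Zero C B (ob F A)) \<in> \<Delta>"
proof -
  obtain Y g e where t: "(A, D, Y, i, g, e) \<in> \<Delta>" using cone_exists[of i] d by auto
  note 1 = tri_typing[OF t]
  have "e = mor F (p \<cdot> i) \<cdot> e" using 1 d by simp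
  also have "\<dots> = mor F p \<cdot> (mor F i \<cdot> e)" using 1 d(4-15) by (simp add: mor_comp comp_assoc)
  also have "\<dots> = Zero C Y (ob F A)" using mor_comp_eq_Zero[OF t] 1 d by simp
  finally have e: "e = Zero C Y (ob F A)" .
  obtain v where v: "arr v" "src v = Y" "tgt v = B" "q = v \<cdot> g"
    using coexact_middle[OF t, of q] d by auto
  let ?w = "g \<cdot> j"
  have vw: "v \<cdot> ?w = Id C B" using d(17) v 1 d(7-9) by (simp add: comp_assoc)
  have gip: "g \<cdot> (i \<cdot> p) = Zero C D Y"
    using comp_eq_Zero[OF t] 1 d(4-15) by (simp flip: comp_assoc)
  have "(?w \<cdot> v) \<cdot> g = (g \<cdot> j) \<cdot> q" unfolding v(4) using v(1-3) 1 d(7-9) by (simp add: comp_assoc)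
  also have "\<dots> = g \<cdot> (i \<cdot> p \<boxplus> j \<cdot> q)"
    using 1 d(4-15) gip by (simp add: comp_add_right comp_assoc)
  also have "\<dots> = g" using d(20) 1 by simp
  finally have wvg: "(?w \<cdot> v) \<cdot> g = g" .
  have "(?w \<cdot> v \<boxplus> neg (Id C Y)) \<cdot> g = Zero C D Y"
    using wvg 1 v(1-3) d(7-9) by (simp add: comp_add_left)
  then obtain m where m: "arr m" "src m = ob F A" "tgt m = Y" "?w \<cdot> v \<boxplus> neg (Id C Y) = m \<cdot> e"
    using coexact_middle[OF rotation[OF t], of "?w \<cdot> v \<boxplus> neg (Id C Y)"] 1 v(1-3) d(7-9) by auto
  then have "?w \<cdot> v \<boxplus> neg (Id C Y) = Zero C Y Y" unfolding e using 1 by simp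
  then have wv: "?w \<cdot> v = Id C Y"
    using diff_eq_Zero_iff[of "?w \<cdot> v" "Id C Y"] 1 v(1-3) d(7-9) by simp
  have "isomorphism C Y B v" using isomorphismI[of v ?w] vw wv v(1-3) 1 d(7-9) by simp
  then have "sextuple_isomorphic C F (A, D, Y, i, g, e) (A, D, B, i, q, Zero C B (ob F A))"
    unfolding sextuple_isomorphic_iff sextuple_mor_iff sextuples_iff e
    using 1 d(1-15) v(1-3) v(4)[symmetric]
    by (intro exI[of _ "Id C A"] exI[of _ "Id C D"] exI[of _ v]) (simp add: isomorphism_Id)
  then show ?thesis using \<Delta>_iso_closed[OF t] by blast
qed

section \<open>Octahedra: rotated form and mirror images\<close>

lemma octahedral:
  assumes "(A, B, D, f, g, h) \<in> \<Delta>" "(B, X, Y, a, b, c) \<in> \<Delta>" "(A, X, Z, a \<cdot> f, d, e) \<in> \<Delta>"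
  shows "\<exists>s t. arr s \<and> src s = D \<and> tgt s = Z \<and> arr t \<and> src t = Z \<and> tgt t = Y \<and>
    s \<cdot> g = d \<cdot> a \<and> e \<cdot> s = h \<and> t \<cdot> d = b \<and> c \<cdot> t = mor F f \<cdot> e \<and> (D, Z, Y, s, t, mor F g \<cdot> c) \<in> \<Delta>"
proof -
  have "D \<in> Obj C" "Z \<in> Obj C" "Y \<in> Obj C" using assms tri_typing by blast+
  note iff = in_Hom_iff[OF this(1,2)] in_Hom_iff[OF this(2,3)]
  obtain s t where "s \<in> Hom C D Z" "t \<in> Hom C Z Y" "s \<cdot> g = d \<cdot> a" "e \<cdot> s = h" "t \<cdot> d = b"
    "c \<cdot> t = mor F f \<cdot> e" "(D, Z, Y, s, t, mor F g \<cdot> c) \<in> \<Delta>"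
    using octahedron[OF assms] by blast
  then show ?thesis unfolding iff by blast
qed

text \<open>The octahedron is applied with the second triangle rotated, and the resulting triangle
  is rotated back. It provides \<open>w\<close> with
  \<open>neg (mor F i) \<cdot> w = mor F f \<cdot> e''\<close>; taking \<open>neg w\<close> for
  \<epsilon> removes this sign, and \<open>tri_neg\<close> passes it on to \<open>k\<close>.\<close>

lemma octahedral':
  assumes t: "(A, M, D, f, g, e) \<in> \<Delta>" and s: "(B, M, X, i, q, e') \<in> \<Delta>" and r: "(A, X, Z, q \<cdot> f, d, e'') \<in> \<Delta>"
  shows "\<exists>k \<epsilon>. arr k \<and> src k = D \<and> tgt k = Z \<and> k \<cdot> g = d \<cdot> q \<and> e'' \<cdot> k = e \<and> mor F i \<cdot> \<epsilon> = mor F f \<cdot> e'' \<and>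
            (B, D, Z, g \<cdot> i, neg k, \<epsilon>) \<in> \<Delta>"
proof -
  note 1 = tri_typing[OF t] tri_typing[OF s] tri_typing[OF r]
  obtain k w where k: "arr k" "src k = D" "tgt k = Z" "arr w" "src w = Z" "tgt w = ob F B"
    "k \<cdot> g = d \<cdot> q" "e'' \<cdot> k = e" "neg (mor F i) \<cdot> w = mor F f \<cdot> e''"
    "(D, Z, ob F B, k, w, mor F g \<cdot> neg (mor F i)) \<in> \<Delta>"
    using octahedral[OF t rotation[OF s] r] by blast
  have "(B, D, Z, g \<cdot> i, neg k, neg w) \<in> \<Delta>"
    using back_rotation[OF tri_neg[OF k(10)], of "g \<cdot> i"] 1 by (simp add: mor_comp)
  moreover have "mor F i \<cdot> neg w = mor F f \<cdot> e''" using k 1 by simp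
  ultimately show ?thesis using k by blast
qed

text \<open>Rotating all three triangles turns their second maps into first ones, so the ordinary
  octahedron applies. Its maps descend through the shift by fullness, and three backward rotations
  return the triangle.\<close>

lemma dual_octahedral:
  assumes t1: "(D, B, A, g, f, e) \<in> \<Delta>" and t2: "(Y, X, B, b, a, e') \<in> \<Delta>"
    and t3: "(Z, X, A, d, f \<cdot> a, e'') \<in> \<Delta>"
  shows "\<exists>s t. arr s \<and> src s = Z \<and> tgt s = D \<and> arr t \<and> src t = Y \<and> tgt t = Z \<and>
    g \<cdot> s = a \<cdot> d \<and> mor F s \<cdot> e'' = e \<and> d \<cdot> t = b \<and> mor F t \<cdot> e' = e'' \<cdot> f \<and> (Y, Z, D, t, s, e' \<cdot> g) \<in> \<Delta>"
proof -
  note 1 = tri_typing[OF t1] tri_typing[OF t2] tri_typing[OF t3]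
  obtain s' t' where st: "arr s'" "src s' = ob F Y" "tgt s' = ob F Z" "arr t'" "src t' = ob F Z" "tgt t' = ob F D"
    "s' \<cdot> e' = e'' \<cdot> f" "neg (mor F d) \<cdot> s' = neg (mor F b)" "t' \<cdot> e'' = e"
    "neg (mor F g) \<cdot> t' = mor F a \<cdot> neg (mor F d)"
    "(ob F Y, ob F Z, ob F D, s', t', mor F e' \<cdot> neg (mor F g)) \<in> \<Delta>"
    using octahedral[OF rotation[OF t2] rotation[OF t1] rotation[OF t3]] by blast
  obtain t where t: "arr t" "src t = Y" "tgt t = Z" "s' = mor F t" using mor_full[OF st(1-3)] 1 by auto
  obtain s where s: "arr s" "src s = Z" "tgt s = D" "t' = mor F s" using mor_full[OF st(4-6)] 1 by auto
  have "mor F (d \<cdot> t) = mor F b" "mor F (g \<cdot> s) = mor F (a \<cdot> d)"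
    using st(8,10) 1 t(1-3) s(1-3) unfolding t(4) s(4) by (simp_all add: mor_comp)
  then have "d \<cdot> t = b" "g \<cdot> s = a \<cdot> d"
    using mor_inject[of "d \<cdot> t" b] mor_inject[of "g \<cdot> s" "a \<cdot> d"] 1 t(1-3) s(1-3) by simp_all
  moreover have "(D, ob F Y, ob F Z, e' \<cdot> g, neg (mor F t), neg (mor F s)) \<in> \<Delta>"
    using back_rotation[OF tri_neg[OF st(11)], of "e' \<cdot> g"] 1 t(4) s(4) by (simp add: mor_comp)
  then have "(Z, D, ob F Y, s, e' \<cdot> g, neg (mor F t)) \<in> \<Delta>" by (rule back_rotation) (use s in simp_all)
  then have "(Y, Z, D, t, s, e' \<cdot> g) \<in> \<Delta>" by (rule back_rotation) (use t in simp_all)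
  ultimately show ?thesis using s t st(7,9) by blast
qed

text \<open>Here only the first and the third triangle are rotated before the octahedron is applied;
  the sign of \<open>k\<close> arises in the last backward rotation.\<close>

lemma dual_octahedral':
  assumes t: "(D, M, A, g, f, e) \<in> \<Delta>" and s: "(X, M, B, q, i, e') \<in> \<Delta>" and r: "(Z, X, A, d, f \<cdot> q, e'') \<in> \<Delta>"
  shows "\<exists>k \<epsilon>. arr k \<and> src k = Z \<and> tgt k = D \<and> g \<cdot> k = q \<cdot> d \<and> mor F k \<cdot> e'' = e \<and> \<epsilon> \<cdot> i = e'' \<cdot> f \<and>
            (Z, D, B, neg k, i \<cdot> g, \<epsilon>) \<in> \<Delta>"
proof -
  note 1 = tri_typing[OF t] tri_typing[OF s] tri_typing[OF r]
  obtain \<epsilon> t' where st: "arr \<epsilon>" "src \<epsilon> = B" "tgt \<epsilon> = ob F Z" "arr t'" "src t' = ob F Z" "tgt t' = ob F D"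
    "\<epsilon> \<cdot> i = e'' \<cdot> f" "t' \<cdot> e'' = e" "neg (mor F g) \<cdot> t' = mor F q \<cdot> neg (mor F d)"
    "(B, ob F Z, ob F D, \<epsilon>, t', mor F i \<cdot> neg (mor F g)) \<in> \<Delta>"
    using octahedral[OF s rotation[OF t] rotation[OF r]] by blast
  obtain k where k: "arr k" "src k = Z" "tgt k = D" "t' = mor F k" using mor_full[OF st(4-6)] 1 by auto
  have "mor F (g \<cdot> k) = mor F (q \<cdot> d)"
    using st(9) 1 k(1-3) unfolding k(4) by (simp add: mor_comp)
  then have "g \<cdot> k = q \<cdot> d" using mor_inject[of "g \<cdot> k" "q \<cdot> d"] 1 k(1-3) by simp
  moreover have "(D, B, ob F Z, i \<cdot> g, \<epsilon>, mor F k) \<in> \<Delta>"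
    using back_rotation[OF st(10), of "i \<cdot> g"] 1 k(4) by (simp add: mor_comp)
  then have "(Z, D, B, neg k, i \<cdot> g, \<epsilon>) \<in> \<Delta>" by (rule back_rotation) (use k in simp_all)
  ultimately show ?thesis using k st(7,8) by blast
qed

lemma cone_category_triangulated:
  "cone_category C (\<lambda>D A. Hom C D (ob F A)) (\<lambda>u e. mor F u \<cdot> e) (\<lambda>e v. e \<cdot> v) (\<lambda>D A. Zero C D (ob F A)) \<Delta>"
proof (intro cone_category.intro cone_category_axioms.intro)
  show "additive_category C" by (rule additive_category_axioms)
  fix A B D f g e assume t: "(A, B, D, f, g, e) \<in> \<Delta>"
  show "A \<in> Obj C \<and> B \<in> Obj C \<and> D \<in> Obj C \<and>
      arr f \<and> src f = A \<and> tgt f = B \<and> arr g \<and> src g = B \<and> tgt g = D \<and> e \<in> Hom C D (ob F A)"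
    using tri_typing[OF t] by (simp add: in_Hom_iff)
next
  fix A B D i j p q
  assume "A \<in> Obj C" "B \<in> Obj C" "D \<in> Obj C"
    "arr i" "src i = A" "tgt i = D" "arr j" "src j = B" "tgt j = D"
    "arr p" "src p = D" "tgt p = A" "arr q" "src q = D" "tgt q = B"
    "p \<cdot> i = Id C A" "q \<cdot> j = Id C B" "q \<cdot> i = Zero C A B" "p \<cdot> j = Zero C B A"
    "i \<cdot> p \<boxplus> j \<cdot> q = Id C D"
  then show "\<exists>e. (A, D, B, i, q, e) \<in> \<Delta>" using split_triangle by blast
next
  fix u u' v v' e e'
  assume "arr u" "arr u'" "src u' = src u" "tgt u' = tgt u" "arr v" "arr v'" "src v' = src v" "tgt v' = tgt v"
    "e \<in> Hom C (src v) (ob F (src u))" "e' \<in> Hom C (tgt v) (ob F (tgt u))"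
    "mor F u \<cdot> e = e' \<cdot> v" "mor F u' \<cdot> e = e' \<cdot> v'"
  then show "mor F (u \<boxplus> u') \<cdot> e = e' \<cdot> (v \<boxplus> v')"
    by (simp add: mor_add in_Hom_iff comp_add_left comp_add_right)
qed (assumption | rule cone_exists filling middle_filling exact_middle coexact_middle exact_right coexact_left
    octahedral octahedral' | simp add: in_Hom_iff mor_comp comp_assoc)+

end


section \<open>Opposite categories\<close>

lemma op_cat_simps [simp]:
  "Obj (op_cat C) = Obj C" "Hom (op_cat C) A B = Hom C B A" "Id (op_cat C) = Id C"
  "g \<cdot>\<^bsub>op_cat C\<^esub> f = f \<cdot>\<^bsub>C\<^esub> g" "Add (op_cat C) = Add C" "Zero (op_cat C) A B = Zero C B A"
  by (simp_all add: op_cat_def)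

lemma isomorphism_op: "isomorphism (op_cat C) A B f \<longleftrightarrow> isomorphism C B A f"
  unfolding isomorphism_def by auto

lemma isomorphic_op: "isomorphic (op_cat C) A B \<longleftrightarrow> isomorphic C A B"
  unfolding isomorphic_def isomorphism_op unfolding isomorphism_def by blast

lemma zero_object_op: "zero_object (op_cat C) Z \<longleftrightarrow> zero_object C Z"
  unfolding zero_object_def by auto

lemma direct_sum_op_if: "direct_sum C A B D \<Longrightarrow> direct_sum (op_cat C) A B D"
  unfolding direct_sum_def op_cat_simps by blast

lemma full_subcat_op: "full_subcat (op_cat C) \<A> = op_cat (full_subcat C \<A>)"
  by (simp add: full_subcat_def op_cat_def)

lemma direct_sum_op: "direct_sum (op_cat C) A B D \<longleftrightarrow> direct_sum C A B D"
proof
  assume "direct_sum (op_cat C) A B D"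
  then have "direct_sum (op_cat (op_cat C)) A B D" by (rule direct_sum_op_if)
  then show "direct_sum C A B D" unfolding direct_sum_def op_cat_simps by simp
qed (rule direct_sum_op_if)

lemma subcategory_op: "subcategory (op_cat C) \<A> \<longleftrightarrow> subcategory C \<A>"
  unfolding subcategory_def isomorphic_op zero_object_op direct_sum_op by simp

lemma factor_hom_op: "factor_hom (op_cat C) \<X> A B = factor_hom C \<X> B A"
  unfolding factor_hom_def op_cat_simps by blast

lemma mor_class_op: "mor_class (op_cat C) \<X> A B f = mor_class C \<X> B A f"
  unfolding mor_class_def factor_hom_op a_r_coset_def' by (simp add: hom_group_def)

text \<open>The cosets and the set of pairs of representatives are literally the same, so this is an
  equality of records and statements about one side can be rewritten into the other.\<close>

lemma quotient_cat_op: "quotient_cat (op_cat C) \<X> = op_cat (quotient_cat C \<X>)"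
proof -
  have "Hom (quotient_cat (op_cat C) \<X>) = (\<lambda>A B. Hom (quotient_cat C \<X>) B A)"
    by (simp add: quotient_cat_def fun_eq_iff A_RCOSETS_def' factor_hom_op a_r_coset_def' hom_group_def)
  moreover have "Comp (quotient_cat (op_cat C) \<X>) = (\<lambda>\<psi> \<phi>. Comp (quotient_cat C \<X>) \<phi> \<psi>)"
  proof (intro ext)
    fix \<psi> \<phi>
    have "{mor_class (op_cat C) \<X> A D (g \<cdot>\<^bsub>op_cat C\<^esub> f) | A B D f g.
         A \<in> Obj (op_cat C) \<and> B \<in> Obj (op_cat C) \<and> D \<in> Obj (op_cat C) \<and>
         f \<in> \<phi> \<inter> Hom (op_cat C) A B \<and> g \<in> \<psi> \<inter> Hom (op_cat C) B D} =
      {mor_class C \<X> A D (g \<cdot>\<^bsub>C\<^esub> f) | A B D f g.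
         A \<in> Obj C \<and> B \<in> Obj C \<and> D \<in> Obj C \<and> f \<in> \<psi> \<inter> Hom C A B \<and> g \<in> \<phi> \<inter> Hom C B D}"
      unfolding mor_class_op op_cat_simps by blast
    then show "Comp (quotient_cat (op_cat C) \<X>) \<psi> \<phi> = Comp (quotient_cat C \<X>) \<phi> \<psi>"
      by (simp add: quotient_cat_def)
  qed
  moreover have "Zero (quotient_cat (op_cat C) \<X>) = (\<lambda>A B. Zero (quotient_cat C \<X>) B A)"
    by (simp add: quotient_cat_def fun_eq_iff factor_hom_op)
  moreover have "Id (quotient_cat (op_cat C) \<X>) = Id (quotient_cat C \<X>)"
    by (simp add: quotient_cat_def fun_eq_iff mor_class_op)
  moreover have "Obj (quotient_cat (op_cat C) \<X>) = Obj (quotient_cat C \<X>)"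
    "Add (quotient_cat (op_cat C) \<X>) = Add (quotient_cat C \<X>)"
    by (simp_all add: quotient_cat_def)
  ultimately show ?thesis unfolding op_cat_def by (intro cat.equality) simp_all
qed

lemma (in category) category_op: "category (op_cat C)"
proof
  fix A B D E f g h
  assume "A \<in> Obj (op_cat C)" "B \<in> Obj (op_cat C)" "D \<in> Obj (op_cat C)" "E \<in> Obj (op_cat C)"
    "f \<in> Hom (op_cat C) A B" "g \<in> Hom (op_cat C) B D" "h \<in> Hom (op_cat C) D E"
  then show "(h \<cdot>\<^bsub>op_cat C\<^esub> g) \<cdot>\<^bsub>op_cat C\<^esub> f = h \<cdot>\<^bsub>op_cat C\<^esub> (g \<cdot>\<^bsub>op_cat C\<^esub> f)"
    using Comp_assoc[of E D B A h g f] by simp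
next
  fix A B A' B' f
  assume "A \<in> Obj (op_cat C)" "B \<in> Obj (op_cat C)" "A' \<in> Obj (op_cat C)" "B' \<in> Obj (op_cat C)"
    "f \<in> Hom (op_cat C) A B" "f \<in> Hom (op_cat C) A' B'"
  then show "A = A' \<and> B = B'" using Hom_disjoint[of B A B' A' f] by simp
next
  fix A B D f g
  assume "A \<in> Obj (op_cat C)" "B \<in> Obj (op_cat C)" "D \<in> Obj (op_cat C)"
    "f \<in> Hom (op_cat C) A B" "g \<in> Hom (op_cat C) B D"
  then show "g \<cdot>\<^bsub>op_cat C\<^esub> f \<in> Hom (op_cat C) A D" using Comp_in[of D B A g f] by simp
qed (simp_all add: Id_in Comp_Id Id_Comp)

lemma (in preadditive_category) preadditive_op: "preadditive_category (op_cat C)"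
proof (intro preadditive_category.intro preadditive_category_axioms.intro category_op)
  fix A B assume AB: "A \<in> Obj (op_cat C)" "B \<in> Obj (op_cat C)"
  interpret G: abelian_group "hom_group C B A" using AB by (simp add: Hom_abelian_group)
  have "carrier (hom_group (op_cat C) A B) = Hom C B A"
    "zero (hom_group (op_cat C) A B) = Zero C B A" "ring.add (hom_group (op_cat C) A B) = Add C"
    by (simp_all add: hom_group_def)
  then show "abelian_group (hom_group (op_cat C) A B)"
    using G.a_closed G.zero_closed G.a_assoc G.a_comm G.l_zero G.l_neg G.a_inv_closed
    by (intro abelian_groupI) (auto, metis)
next
  fix A B D f f' g
  assume "A \<in> Obj (op_cat C)" "B \<in> Obj (op_cat C)" "D \<in> Obj (op_cat C)"
    "f \<in> Hom (op_cat C) A B" "f' \<in> Hom (op_cat C) A B" "g \<in> Hom (op_cat C) B D"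
  then show "g \<cdot>\<^bsub>op_cat C\<^esub> Add (op_cat C) f f' =
      Add (op_cat C) (g \<cdot>\<^bsub>op_cat C\<^esub> f) (g \<cdot>\<^bsub>op_cat C\<^esub> f')"
    using Comp_Add_left[of D B A g f f'] by simp
next
  fix A B D f g g'
  assume "A \<in> Obj (op_cat C)" "B \<in> Obj (op_cat C)" "D \<in> Obj (op_cat C)"
    "f \<in> Hom (op_cat C) A B" "g \<in> Hom (op_cat C) B D" "g' \<in> Hom (op_cat C) B D"
  then show "Add (op_cat C) g g' \<cdot>\<^bsub>op_cat C\<^esub> f =
      Add (op_cat C) (g \<cdot>\<^bsub>op_cat C\<^esub> f) (g' \<cdot>\<^bsub>op_cat C\<^esub> f)"
    using Comp_Add_right[of D B A g g' f] by simp
qed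

lemma (in additive_category) additive_op: "additive_category (op_cat C)"
  using ex_zero_object ex_direct_sum
  by (intro additive_category.intro additive_category_axioms.intro preadditive_op)
    (simp_all add: zero_object_op direct_sum_op)

lemma (in category) arr_op: "category.arr (op_cat C) f \<longleftrightarrow> arr f"
  unfolding category.arr_def[OF category_op] arr_def by auto

lemma (in category) src_op: "category.src (op_cat C) f = tgt f"
  unfolding category.src_def[OF category_op] tgt_def by simp

lemma (in category) tgt_op: "category.tgt (op_cat C) f = src f"
  unfolding category.tgt_def[OF category_op] src_def by simp

lemma (in preadditive_category) neg_op: "preadditive_category.neg (op_cat C) f = neg f"
  unfolding preadditive_category.neg_def[OF preadditive_op] neg_def arr_op src_op tgt_op
  by (simp add: a_inv_def hom_group_def)

text \<open>The connecting element is kept unchanged and merely read in E with its arguments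
  exchanged. This differs from \<open>op_sextuples\<close>, which reverses left sextuples whose
  connecting map is a morphism at the other end.\<close>

definition rev_triangles :: "('o, 'm) sextuple set \<Rightarrow> ('o, 'm) sextuple set" where
  "rev_triangles \<Delta> = {(D, B, A, g, f, e) | A B D f g e. (A, B, D, f, g, e) \<in> \<Delta>}"

lemma rev_triangles_iff [simp]: "(D, B, A, g, f, e) \<in> rev_triangles \<Delta> \<longleftrightarrow> (A, B, D, f, g, e) \<in> \<Delta>"
  by (auto simp: rev_triangles_def)

context triangulated_category
begin

text \<open>Each axiom becomes its mirror image: cones turn into cocones, fill-ins into
  \<open>left_filling\<close>, exactness into coexactness, while \<open>middle_filling\<close>
  mirrors itself with the two triangles exchanged.\<close>

lemma cone_category_op:
  "cone_category (op_cat C) (\<lambda>D A. Hom C A (ob F D)) (\<lambda>u e. e \<cdot> u) (\<lambda>e v. mor F v \<cdot> e)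
    (\<lambda>D A. Zero C A (ob F D)) (rev_triangles \<Delta>)"
proof (intro cone_category.intro cone_category_axioms.intro additive_op,
    unfold rev_triangles_iff arr_op src_op tgt_op neg_op op_cat_simps)
  fix A B D f g e assume t: "(D, B, A, g, f, e) \<in> \<Delta>"
  show "A \<in> Obj C \<and> B \<in> Obj C \<and> D \<in> Obj C \<and>
      arr f \<and> tgt f = A \<and> src f = B \<and> arr g \<and> tgt g = B \<and> src g = D \<and> e \<in> Hom C A (ob F D)"
    using tri_typing[OF t] by (simp add: in_Hom_iff)
next
  fix A B D i j p q
  assume "A \<in> Obj C" "B \<in> Obj C" "D \<in> Obj C"
    "arr i" "tgt i = A" "src i = D" "arr j" "tgt j = B" "src j = D"
    "arr p" "tgt p = D" "src p = A" "arr q" "tgt q = D" "src q = B"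
    "i \<cdot> p = Id C A" "j \<cdot> q = Id C B" "i \<cdot> q = Zero C B A" "j \<cdot> p = Zero C A B"
    "p \<cdot> i \<boxplus> q \<cdot> j = Id C D"
  then show "\<exists>e. (B, D, A, q, i, e) \<in> \<Delta>"
    using split_triangle[of B A D q p j i] add_commute[of "q \<cdot> j" "p \<cdot> i"] by auto
next
  fix u u' v v' e e'
  assume "arr u" "arr u'" "tgt u' = tgt u" "src u' = src u" "arr v" "arr v'" "tgt v' = tgt v" "src v' = src v"
    "e \<in> Hom C (tgt u) (ob F (tgt v))" "e' \<in> Hom C (src u) (ob F (src v))"
    "e \<cdot> u = mor F v \<cdot> e'" "e \<cdot> u' = mor F v' \<cdot> e'"
  then show "e \<cdot> (u \<boxplus> u') = mor F (v \<boxplus> v') \<cdot> e'"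
    by (simp add: mor_add in_Hom_iff comp_add_left comp_add_right)
next
  fix A B D f g e A' B' D' f' g' e' a b
  assume "(D, B, A, g, f, e) \<in> \<Delta>" "(D', B', A', g', f', e') \<in> \<Delta>"
    "arr a" "tgt a = A" "src a = A'" "arr b" "tgt b = B" "src b = B'" "f \<cdot> b = a \<cdot> f'"
  then show "\<exists>c. arr c \<and> tgt c = D \<and> src c = D' \<and> g \<cdot> c = b \<cdot> g' \<and> e \<cdot> a = mor F c \<cdot> e'"
    using left_filling[of D' B' A' g' f' e' D B A g f e b a] by metis
next
  fix A B D f g e B' f' g'
  assume "(D, B, A, g, f, e) \<in> \<Delta>" "(D, B', A, g', f', e) \<in> \<Delta>"
  then show "\<exists>b. arr b \<and> tgt b = B \<and> src b = B' \<and> f \<cdot> b = f' \<and> b \<cdot> g' = g"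
    using middle_filling[of D B' A g' f' e B g f] by blast
next
  fix A B D f g e u assume "(D, B, A, g, f, e) \<in> \<Delta>" "arr u" "tgt u = A"
  then show "e \<cdot> u = Zero C (src u) (ob F D) \<longleftrightarrow> (\<exists>v. arr v \<and> tgt v = B \<and> src v = src u \<and> u = f \<cdot> v)"
    using coexact_right[of D B A g f e u] by blast
qed (assumption | rule cocone_exists | (drule (3) coexact_middle, blast) | (drule (3) exact_middle, blast)
    | (drule (6) exact_left, blast) | (drule (2) dual_octahedral, blast) | (drule (2) dual_octahedral', blast)
    | simp add: in_Hom_iff mor_comp comp_assoc)+

end


section \<open>The two halves of the theorem\<close>

lemma left_sextuples_op:
  "(A, B, D, h, g, f) \<in> left_sextuples C F \<longleftrightarrow> (D, B, A, f, g, h) \<in> sextuples (op_cat C) F"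
  unfolding left_sextuples_def sextuples_def by auto

lemma left_sextuple_mor_op:
  "left_sextuple_mor C F (A, B, D, h, g, f) (A', B', D', h', g', f') a b c \<longleftrightarrow>
    sextuple_mor (op_cat C) F (D', B', A', f', g', h') (D, B, A, f, g, h) c b a"
  unfolding left_sextuple_mor_def sextuple_mor_def left_sextuples_op prod.case op_cat_simps by metis

lemma left_sextuple_isomorphic_op:
  "left_sextuple_isomorphic C F (A, B, D, h, g, f) (A', B', D', h', g', f') \<longleftrightarrow>
    sextuple_isomorphic (op_cat C) F (D', B', A', f', g', h') (D, B, A, f, g, h)"
  unfolding left_sextuple_isomorphic_def sextuple_isomorphic_def left_sextuple_mor_op prod.case
    isomorphism_op by blast

lemma op_sextuples_iff: "(D, B, A, f, g, h) \<in> op_sextuples \<Delta> \<longleftrightarrow> (A, B, D, h, g, f) \<in> \<Delta>"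
  unfolding op_sextuples_def by auto

context triangulated_category
begin

theorem right_triangulated_subfactor:
  assumes "subcategory C \<A>" "subcategory (full_subcat C \<A>) \<X>"
    and "monics_have_cones C \<Delta> \<A> \<X>" "right_choice C \<Delta> \<A> \<X> \<tau>"
  shows "right_triangulated_category (subfactor C \<A> \<X>) (suspension C F \<A> \<X> \<tau>)
    (distinguished_right_triangles C F \<Delta> \<A> \<X> \<tau>)"
proof -
  interpret R: suspended_category C "\<lambda>D A. Hom C D (ob F A)" "\<lambda>u e. mor F u \<cdot> e" "\<lambda>e v. e \<cdot> v"
    "\<lambda>D A. Zero C D (ob F A)" \<Delta> \<A> \<X> \<tau>
    using assms
    by (intro suspended_category.intro subfactor_category.intro subfactor_category_axioms.intro
        suspended_category_axioms.intro cone_category_triangulated additive_category_axioms)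
  have ext: "R.ext_mor (right_tri \<tau> A) (right_tri \<tau> A') f g h \<longleftrightarrow>
      sextuple_mor C F (right_tri \<tau> A) (right_tri \<tau> A') f g h" if "A \<in> \<A>" "A' \<in> \<A>" for A A' f g h
  proof -
    have "right_tri \<tau> A \<in> sextuples C F" "right_tri \<tau> A' \<in> sextuples C F"
      using assms(4) that \<Delta>_sextuples unfolding right_choice_def by blast+
    then show ?thesis unfolding R.ext_mor_def sextuple_mor_def by simp
  qed
  have "R.susp = suspension C F \<A> \<X> \<tau>"
  proof -
    have "{sub_class C \<A> \<X> (outer \<tau> A) (outer \<tau> A') h | A A' f g h.
         A \<in> \<A> \<and> A' \<in> \<A> \<and> f \<in> \<phi> \<and> R.ext_mor (right_tri \<tau> A) (right_tri \<tau> A') f g h} =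
      {sub_class C \<A> \<X> (outer \<tau> A) (outer \<tau> A') h | A A' f g h.
         A \<in> \<A> \<and> A' \<in> \<A> \<and> f \<in> \<phi> \<and> sextuple_mor C F (right_tri \<tau> A) (right_tri \<tau> A') f g h}" for \<phi>
      using ext by blast
    then show ?thesis unfolding R.susp_def suspension_def by simp
  qed
  then show ?thesis
    using R.right_triangulated_dist unfolding R.dist_def distinguished_right_triangles_def by (simp only:)
qed

theorem left_triangulated_subfactor:
  assumes "subcategory C \<A>" "subcategory (full_subcat C \<A>) \<Y>"
    and "epics_have_cocones C \<Delta> \<A> \<Y>" "left_choice C \<Delta> \<A> \<Y> \<tau>"
  shows "left_triangulated_category (subfactor C \<A> \<Y>) (loop C F \<A> \<Y> \<tau>)
    (distinguished_left_triangles C F \<Delta> \<A> \<Y> \<tau>)"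
proof -
  \<comment> \<open>Reading a chosen left triangle backwards exchanges its first two maps and keeps
    the connecting element.\<close>
  define \<tau>' where "\<tau>' = \<tau>\<lparr>map1 := map2 \<tau>, map2 := map1 \<tau>\<rparr>"
  have \<tau>' [simp]: "outer \<tau>' = outer \<tau>" "mid \<tau>' = mid \<tau>" "map1 \<tau>' = map2 \<tau>" "map2 \<tau>' = map1 \<tau>" "map3 \<tau>' = map3 \<tau>"
    by (simp_all add: \<tau>'_def)
  have cones: "monics_have_cones (op_cat C) (rev_triangles \<Delta>) \<A> \<Y>"
  proof -
    have "monic_wrt (op_cat C) \<Y> A B f \<longleftrightarrow> epic_wrt C \<Y> B A f" for A B f
      by (simp add: monic_wrt_def epic_wrt_def)
    with assms(3) show ?thesis
      unfolding monics_have_cones_def epics_have_cocones_def rev_triangles_iff by metis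
  qed
  have choice: "right_choice (op_cat C) (rev_triangles \<Delta>) \<A> \<Y> \<tau>'"
    using assms(4)
    by (simp add: right_choice_def left_choice_def left_approximation_def right_approximation_def
        right_tri_def left_tri_def)
  interpret L: suspended_category "op_cat C" "\<lambda>D A. Hom C A (ob F D)" "\<lambda>u e. e \<cdot> u" "\<lambda>e v. mor F v \<cdot> e"
    "\<lambda>D A. Zero C A (ob F D)" "rev_triangles \<Delta>" \<A> \<Y> \<tau>'
    using assms(1,2) cones choice
    by (intro suspended_category.intro subfactor_category.intro subfactor_category_axioms.intro
        suspended_category_axioms.intro cone_category_op additive_op) (simp_all add: full_subcat_op subcategory_op)
  have Q: "subfactor (op_cat C) \<A> \<Y> = op_cat (subfactor C \<A> \<Y>)"
    by (simp add: full_subcat_op quotient_cat_op)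
  have cl: "sub_class (op_cat C) \<A> \<Y> A B f = sub_class C \<A> \<Y> B A f" for A B f
    by (simp add: full_subcat_op mor_class_op)
  have ext: "L.ext_mor (right_tri \<tau>' A') (right_tri \<tau>' A) f g h \<longleftrightarrow>
      sextuple_mor C F (left_tri \<tau> A) (left_tri \<tau> A') h g f" if "A \<in> \<A>" "A' \<in> \<A>" for A A' f g h
  proof -
    have "left_tri \<tau> A \<in> sextuples C F" "left_tri \<tau> A' \<in> sextuples C F"
      using assms(4) that \<Delta>_sextuples unfolding left_choice_def by blast+
    then show ?thesis
      unfolding L.ext_mor_def sextuple_mor_def by (auto simp: right_tri_def left_tri_def)
  qed
  have susp: "L.susp = loop C F \<A> \<Y> \<tau>"
  proof -
    have "{sub_class (op_cat C) \<A> \<Y> (outer \<tau>' A) (outer \<tau>' A') h | A A' f g h.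
         A \<in> \<A> \<and> A' \<in> \<A> \<and> f \<in> \<phi> \<and> L.ext_mor (right_tri \<tau>' A) (right_tri \<tau>' A') f g h} =
      {sub_class C \<A> \<Y> (outer \<tau> A) (outer \<tau> A') h | A A' f g h.
         A \<in> \<A> \<and> A' \<in> \<A> \<and> f \<in> \<phi> \<and> sextuple_mor C F (left_tri \<tau> A) (left_tri \<tau> A') h g f}" for \<phi>
      unfolding cl \<tau>' using ext by blast
    then show ?thesis unfolding L.susp_def loop_def by simp
  qed
  have dist: "L.dist = op_sextuples (distinguished_left_triangles C F \<Delta> \<A> \<Y> \<tau>)"
  proof (intro Set.set_eqI)
    fix s :: "('a, 'b set) sextuple"
    obtain D B A f g h where s: "s = (D, B, A, f, g, h)" by (cases s)
    \<comment> \<open>Passing to the opposite category also reverses the direction of the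
      comparison, so the symmetry of isomorphism of sextuples enters.\<close>
    have iso: "sextuple_isomorphic (op_cat (subfactor C \<A> \<Y>)) (loop C F \<A> \<Y> \<tau>) s (A', B', D', f', g', h') \<longleftrightarrow>
        left_sextuple_isomorphic (subfactor C \<A> \<Y>) (loop C F \<A> \<Y> \<tau>) (A, B, D, h, g, f) (D', B', A', h', g', f')"
      for A' B' D' f' g' h'
      unfolding left_sextuple_isomorphic_op s
      using L.Q.sextuple_isomorphic_sym unfolding susp Q by blast
    show "s \<in> L.dist \<longleftrightarrow> s \<in> op_sextuples (distinguished_left_triangles C F \<Delta> \<A> \<Y> \<tau>)"
      unfolding L.dist_def mem_Collect_eq susp Q cl rev_triangles_iff iso \<tau>' op_cat_simps
      unfolding s op_sextuples_iff distinguished_left_triangles_def mem_Collect_eq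
      by blast
  qed
  show ?thesis
    unfolding left_triangulated_category_def using L.right_triangulated_dist unfolding dist susp Q .
qed

end

theorem theorem2p9:
  fixes K :: "('k, 'y) ring_scheme"
    and T :: "('k, 'o, 'm) lin_cat"
    and S :: "('o, 'm) endofunctor"
    and \<Delta> :: "('o, 'm) sextuple set"
    and \<A> \<X> \<Y> :: "'o set"
  assumes "linear_category K T"
    and "Hom_finite K T"
    and "Krull_Schmidt T"
    and "triangulated_category T S \<Delta>"
    and "subcategory T \<A>"
    and "subcategory (full_subcat T \<A>) \<X>"
    and "covariantly_finite (full_subcat T \<A>) \<X>"
    and "subcategory (full_subcat T \<A>) \<Y>"
    and "contravariantly_finite (full_subcat T \<A>) \<Y>"
  shows "(monics_have_cones T \<Delta> \<A> \<X> \<longrightarrow>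
           (\<forall>\<tau>. right_choice T \<Delta> \<A> \<X> \<tau> \<longrightarrow>
              right_triangulated_category (subfactor T \<A> \<X>) (suspension T S \<A> \<X> \<tau>)
                (distinguished_right_triangles T S \<Delta> \<A> \<X> \<tau>))) \<and>
         (epics_have_cocones T \<Delta> \<A> \<Y> \<longrightarrow>
           (\<forall>\<tau>. left_choice T \<Delta> \<A> \<Y> \<tau> \<longrightarrow>
              left_triangulated_category (subfactor T \<A> \<Y>) (loop T S \<A> \<Y> \<tau>)
                (distinguished_left_triangles T S \<Delta> \<A> \<Y> \<tau>)))"
proof -
  interpret triangulated_category T S \<Delta> by (rule assms(4))
  show ?thesis
    using right_triangulated_subfactor left_triangulated_subfactor assms(5,6,8) by blast
qed

end
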